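(* Let $\Lambda$ be an Artin algebra and let $\mathsf{S}$ be a set of simple $\Lambda$-modules. (1) Let $0\to L\to M\to N\to 0$ be an exact sequence in $\mathrm{mod}\,\Lambda$. Then $$\max\{\ell\ell^{t_{\mathsf S}}(L),\ell\ell^{t_{\mathsf S}}(N)\}\le \ell\ell^{t_{\mathsf S}}(M)\le \ell\ell^{t_{\mathsf S}}(L)+\ell\ell^{t_{\mathsf S}}(N).$$ In particular, if $\ell\ell^{t_{\mathsf S}}(L)=0$, then $\ell\ell^{t_{\mathsf S}}(N)=\ell\ell^{t_{\mathsf S}}(M)$; and if $\ell\ell^{t_{\mathsf S}}(N)=0$, then $\ell\ell^{t_{\mathsf S}}(L)=\ell\ell^{t_{\mathsf S}}(M)$. (2) If $\Lambda$ is representation-finite, then $$\Big\{\Big\lceil \frac{\ell\ell^{t_{\mathsf S}}(\Lambda)}{d}\Big\rceil-1 \ \Big|\ d\in\mathbb N,\ 1\le d<\ell\ell^{t_{\mathsf S}}(\Lambda)\Big\}\subseteq \mathrm{OSpec}(\Lambda),$$ where $\lceil\alpha\rceil$ is the least integer greater than or equal to $\alpha$.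
   Context: $\mathrm{mod}\,\Lambda$ is the category of finitely generated right $\Lambda$-modules; $\mathbb N$ is the set of natural numbers including $0$. $\Lambda$ is representation-finite if it has only finitely many indecomposable finitely generated modules up to isomorphism. Radical layer length. Let $\mathsf S'$ be the set of simple $\Lambda$-modules not in $\mathsf S$ (simple modules being taken up to isomorphism). Let $\mathcal F_{\mathsf S}$ be the full subcategory of $\mathrm{mod}\,\Lambda$ of modules $M$ having an $\mathsf S$-filtration, i.e. a finite filtration $0=M_0\subseteq M_1\subseteq\cdots\subseteq M_m=M$ with each $M_i/M_{i-1}$ $(1\le i\le m)$ isomorphic to a module in $\mathsf S$. There is a unique class $\mathcal T_{\mathsf S}$ such that $(\mathcal T_{\mathsf S},\mathcal F_{\mathsf S})$ is a torsion pair in $\mathrm{mod}\,\Lambda$, namely $\mathcal T_{\mathsf S}=\{M : \mathrm{Hom}_\Lambda(M,N)=0 \text{ for all } N\in\mathcal F_{\mathsf S}\}$, equivalently the modules $M$ whose top $M/\mathrm{rad}\,M$ is a direct sum of modules in $\mathsf S'$. Let $t_{\mathsf S}(M)$ be the largest submodule of $M$ lying in $\mathcal T_{\mathsf S}$, and let $F_{t_{\mathsf S}}=\mathrm{rad}\circ t_{\mathsf S}$, i.e. $F_{t_{\mathsf S}}(M)=\mathrm{rad}(t_{\mathsf S}(M))$. The $t_{\mathsf S}$-radical layer length of $M$ is $$\ell\ell^{t_{\mathsf S}}(M)=\inf\{i\ge 0 \mid t_{\mathsf S}(F_{t_{\mathsf S}}^{\,i}(M))=0\},$$ and $\ell\ell^{t_{\mathsf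 S}}(\Lambda)$ is its value on the regular module $\Lambda_\Lambda$. Orlov spectrum. For an Abelian category $\mathcal A$ and a subclass $\mathcal U$, $\mathrm{add}\,\mathcal U$ is the full subcategory of direct summands of finite direct sums of objects of $\mathcal U$. For subcategories $\mathcal U_1,\mathcal U_2$, put $\mathcal U_1\bullet\mathcal U_2=\mathrm{add}\{X\in\mathcal A\mid \text{there is an exact sequence } 0\to U_1\to X\to U_2\to 0 \text{ with } U_1\in\mathcal U_1,\ U_2\in\mathcal U_2\}$. For an object $X$ put $[X]_0=0$, $[X]_1=\mathrm{add}\,X$, $[X]_n=[X]_1\bullet[X]_{n-1}$ for $n\ge2$. The generation time of $X$ is $\inf\{n\in\mathbb N\mid \mathcal A=[X]_{n+1}\}$ if $[X]_t=\mathcal A$ for some $t\in\mathbb N$, and $+\infty$ otherwise; $X$ is a strong generator if its generation time is finite. $\mathrm{OSpec}(\mathcal A)$ is the set of generation times of all strong generators of $\mathcal A$, and $\mathrm{OSpec}(\Lambda):=\mathrm{OSpec}(\mathrm{mod}\,\Lambda)$. *)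

theory Defs
  imports Complex_Main "HOL-Algebra.Module" "HOL-Algebra.Ideal" "HOL-Library.Extended_Nat"
begin

section \<open>Right modules over a ring\<close>

text \<open>The library locale \<open>module\<close> requires a commutative ring of scalars. We keep its record,
  reading \<open>a \<odot>\<^bsub>M\<^esub> x\<close> as the right action \<open>x \<cdot> a\<close>, which shows in the law \<open>smult_assoc\<close>.
  The fields \<open>mult\<close> and \<open>one\<close> of the record are never used for modules. Submodules are those of
  the library (\<^locale>\<open>submodule\<close> only uses the carrier of the ring of scalars); a submodule \<open>H\<close> of
  \<open>M\<close> is regarded as a module by restricting the carrier.\<close>

locale right_module = R?: ring R + M?: abelian_group M
  for R :: "('a, 'b) ring_scheme" (structure) and M :: "('a, 'm, 'c) module_scheme" (structure) +
  assumes smult_closed: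
      "\<lbrakk>a \<in> carrier R; x \<in> carrier M\<rbrakk> \<Longrightarrow> a \<odot>\<^bsub>M\<^esub> x \<in> carrier M"
    and smult_l_distr:
      "\<lbrakk>a \<in> carrier R; b \<in> carrier R; x \<in> carrier M\<rbrakk> \<Longrightarrow>
        (a \<oplus> b) \<odot>\<^bsub>M\<^esub> x = a \<odot>\<^bsub>M\<^esub> x \<oplus>\<^bsub>M\<^esub> b \<odot>\<^bsub>M\<^esub> x"
    and smult_r_distr:
      "\<lbrakk>a \<in> carrier R; x \<in> carrier M; y \<in> carrier M\<rbrakk> \<Longrightarrow>
        a \<odot>\<^bsub>M\<^esub> (x \<oplus>\<^bsub>M\<^esub> y) = a \<odot>\<^bsub>M\<^esub> x \<oplus>\<^bsub>M\<^esub> a \<odot>\<^bsub>M\<^esub> y"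
    and smult_assoc:
      "\<lbrakk>a \<in> carrier R; b \<in> carrier R; x \<in> carrier M\<rbrakk> \<Longrightarrow>
        (a \<otimes> b) \<odot>\<^bsub>M\<^esub> x = b \<odot>\<^bsub>M\<^esub> (a \<odot>\<^bsub>M\<^esub> x)"
    and smult_one: "x \<in> carrier M \<Longrightarrow> \<one> \<odot>\<^bsub>M\<^esub> x = x"

definition restrict_mod :: "('a, 'm) module \<Rightarrow> 'm set \<Rightarrow> ('a, 'm) module" where
  "restrict_mod M H = M\<lparr>carrier := H\<rparr>"

definition quot_mod :: "('a, 'm) module \<Rightarrow> 'm set \<Rightarrow> ('a, 'm set) module" where
  "quot_mod M H =
    \<lparr>carrier = a_rcosets\<^bsub>M\<^esub> H, mult = undefined, one = undefined, zero = H, add = set_add M,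
     smult = (\<lambda>a X. set_add M H ((\<lambda>x. a \<odot>\<^bsub>M\<^esub> x) ` X))\<rparr>"

text \<open>The direct sum of a finite list of modules; the empty list gives the zero module.\<close>

definition dsum :: "('a, 'm) module list \<Rightarrow> ('a, nat \<Rightarrow> 'm) module" where
  "dsum Ms =
    \<lparr>carrier = (\<Pi>\<^sub>E i\<in>{..<length Ms}. carrier (Ms ! i)), mult = undefined, one = undefined,
     zero = (\<lambda>i\<in>{..<length Ms}. \<zero>\<^bsub>Ms ! i\<^esub>),
     add = (\<lambda>f g. \<lambda>i\<in>{..<length Ms}. f i \<oplus>\<^bsub>Ms ! i\<^esub> g i),
     smult = (\<lambda>a f. \<lambda>i\<in>{..<length Ms}. a \<odot>\<^bsub>Ms ! i\<^esub> f i)\<rparr>"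

definition regular_mod :: "('a, 'b) ring_scheme \<Rightarrow> ('a, 'a) module" where
  "regular_mod R =
    \<lparr>carrier = carrier R, mult = undefined, one = undefined, zero = \<zero>\<^bsub>R\<^esub>, add = add R,
     smult = (\<lambda>a x. x \<otimes>\<^bsub>R\<^esub> a)\<rparr>"

definition mod_hom :: "('a, 'b) ring_scheme \<Rightarrow> ('a, 'm) module \<Rightarrow> ('a, 'n) module \<Rightarrow> ('m \<Rightarrow> 'n) set"
  where
  "mod_hom R M N = {f \<in> carrier M \<rightarrow> carrier N.
     (\<forall>x\<in>carrier M. \<forall>y\<in>carrier M. f (x \<oplus>\<^bsub>M\<^esub> y) = f x \<oplus>\<^bsub>N\<^esub> f y) \<and>
     (\<forall>a\<in>carrier R. \<forall>x\<in>carrier M. f (a \<odot>\<^bsub>M\<^esub> x) = a \<odot>\<^bsub>N\<^esub> f x)}"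

definition mod_iso :: "('a, 'b) ring_scheme \<Rightarrow> ('a, 'm) module \<Rightarrow> ('a, 'n) module \<Rightarrow> bool" where
  "mod_iso R M N \<longleftrightarrow> (\<exists>f\<in>mod_hom R M N. bij_betw f (carrier M) (carrier N))"

definition zero_mod :: "('a, 'm) module \<Rightarrow> bool" where
  "zero_mod M \<longleftrightarrow> carrier M = {\<zero>\<^bsub>M\<^esub>}"

definition gen_submod :: "('a, 'b) ring_scheme \<Rightarrow> ('a, 'm) module \<Rightarrow> 'm set \<Rightarrow> 'm set" where
  "gen_submod R M A = \<Inter>{H. submodule H R M \<and> A \<subseteq> H}"

definition fg_module :: "('a, 'b) ring_scheme \<Rightarrow> ('a, 'm) module \<Rightarrow> bool" where
  "fg_module R M \<longleftrightarrow> right_module R M \<and>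
     (\<exists>A. finite A \<and> A \<subseteq> carrier M \<and> gen_submod R M A = carrier M)"

definition short_exact ::
  "('a, 'b) ring_scheme \<Rightarrow> ('a, 'l) module \<Rightarrow> ('l \<Rightarrow> 'm) \<Rightarrow> ('a, 'm) module \<Rightarrow> ('m \<Rightarrow> 'n) \<Rightarrow>
    ('a, 'n) module \<Rightarrow> bool" where
  "short_exact R L f M g N \<longleftrightarrow> f \<in> mod_hom R L M \<and> g \<in> mod_hom R M N \<and>
     inj_on f (carrier L) \<and> f ` carrier L = {x \<in> carrier M. g x = \<zero>\<^bsub>N\<^esub>} \<and>
     g ` carrier M = carrier N"

definition simple_mod :: "('a, 'b) ring_scheme \<Rightarrow> ('a, 'm) module \<Rightarrow> bool" where
  "simple_mod R M \<longleftrightarrow> right_module R M \<and> \<not> zero_mod M \<and>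
     (\<forall>H. submodule H R M \<longrightarrow> H = {\<zero>\<^bsub>M\<^esub>} \<or> H = carrier M)"

definition indecomposable_mod :: "('a, 'b) ring_scheme \<Rightarrow> ('a, 'm) module \<Rightarrow> bool" where
  "indecomposable_mod R M \<longleftrightarrow> right_module R M \<and> \<not> zero_mod M \<and>
     (\<forall>H K. submodule H R M \<and> submodule K R M \<and> set_add M H K = carrier M \<and> H \<inter> K = {\<zero>\<^bsub>M\<^esub>} \<longrightarrow>
        H = {\<zero>\<^bsub>M\<^esub>} \<or> K = {\<zero>\<^bsub>M\<^esub>})"

definition maximal_submod :: "('a, 'b) ring_scheme \<Rightarrow> ('a, 'm) module \<Rightarrow> 'm set \<Rightarrow> bool" where
  "maximal_submod R M K \<longleftrightarrow> submodule K R M \<and> K \<noteq> carrier M \<and>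
     (\<forall>H. submodule H R M \<and> K \<subseteq> H \<longrightarrow> H = K \<or> H = carrier M)"

definition rad :: "('a, 'b) ring_scheme \<Rightarrow> ('a, 'm) module \<Rightarrow> ('a, 'm) module" where
  "rad R M = restrict_mod M (carrier M \<inter> \<Inter>{K. maximal_submod R M K})"


section \<open>The category of finitely generated modules\<close>

text \<open>HOL cannot quantify over all carrier types at once, so the category of finitely generated right
  \<open>R\<close>-modules is represented by those with carrier in a fixed type. The type of
  \<open>quot_mod (dsum (replicate n (regular_mod R))) H\<close> is large enough to contain an isomorphic copy of
  every finitely generated module; this is proved as \<open>fg_module_iso_modcat\<close> below.\<close>

type_synonym 'a rmod = "('a, (nat \<Rightarrow> 'a) set) module"

definition modcat :: "('a, 'b) ring_scheme \<Rightarrow> 'a rmod set" where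
  "modcat R = {M. fg_module R M}"

lemma (in right_module) smult_zero: "x \<in> carrier M \<Longrightarrow> \<zero> \<odot>\<^bsub>M\<^esub> x = \<zero>\<^bsub>M\<^esub>"
  by (metis M.add.r_cancel_one' R.r_zero R.zero_closed smult_closed smult_l_distr)

lemma (in right_module) smult_minus_one:
  assumes "x \<in> carrier M" shows "(\<ominus> \<one>) \<odot>\<^bsub>M\<^esub> x = \<ominus>\<^bsub>M\<^esub> x"
proof -
  have "(\<ominus> \<one>) \<odot>\<^bsub>M\<^esub> x \<oplus>\<^bsub>M\<^esub> x = (\<ominus> \<one>) \<odot>\<^bsub>M\<^esub> x \<oplus>\<^bsub>M\<^esub> \<one> \<odot>\<^bsub>M\<^esub> x"
    using assms by (simp add: smult_one)
  also have "\<dots> = (\<ominus> \<one> \<oplus> \<one>) \<odot>\<^bsub>M\<^esub> x"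
    using assms by (simp add: smult_l_distr)
  also have "\<dots> = \<zero>\<^bsub>M\<^esub>"
    using assms by (simp add: R.l_neg smult_zero)
  finally show ?thesis
    using assms by (metis M.minus_equality R.add.inv_closed R.one_closed smult_closed)
qed

lemma (in right_module) submodI:
  assumes "H \<subseteq> carrier M" "\<zero>\<^bsub>M\<^esub> \<in> H" "\<And>x y. x \<in> H \<Longrightarrow> y \<in> H \<Longrightarrow> x \<oplus>\<^bsub>M\<^esub> y \<in> H"
    and "\<And>a x. a \<in> carrier R \<Longrightarrow> x \<in> H \<Longrightarrow> a \<odot>\<^bsub>M\<^esub> x \<in> H"
  shows "submodule H R M"
proof -
  have "inv\<^bsub>add_monoid M\<^esub> x \<in> H" if "x \<in> H" for x
    using assms(4)[of "\<ominus> \<one>" x] that assms(1) smult_minus_one[of x]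
    by (auto simp: a_inv_def)
  then show ?thesis
    using assms by unfold_locales auto
qed

lemma fg_module_transport:
  fixes R :: "('a, 'b) ring_scheme" and M :: "('a, 'm) module" and e :: "'m \<Rightarrow> 'n"
  assumes fg: "fg_module R M" and inj: "inj_on e (carrier M)"
  shows "\<exists>N :: ('a, 'n) module. fg_module R N \<and> mod_iso R M N"
proof -
  interpret right_module R M using fg by (simp add: fg_module_def)
  define d where "d = inv_into (carrier M) e"
  have d[simp]: "d (e x) = x" if "x \<in> carrier M" for x
    using inj that by (simp add: d_def)
  define N :: "('a, 'n) module" where "N =
    \<lparr>carrier = e ` carrier M, mult = undefined, one = undefined, zero = e \<zero>\<^bsub>M\<^esub>,
     add = (\<lambda>u v. e (d u \<oplus>\<^bsub>M\<^esub> d v)), smult = (\<lambda>a u. e (a \<odot>\<^bsub>M\<^esub> d u))\<rparr>"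
  have N[simp]: "carrier N = e ` carrier M" "\<zero>\<^bsub>N\<^esub> = e \<zero>\<^bsub>M\<^esub>"
    "u \<oplus>\<^bsub>N\<^esub> v = e (d u \<oplus>\<^bsub>M\<^esub> d v)" "a \<odot>\<^bsub>N\<^esub> u = e (a \<odot>\<^bsub>M\<^esub> d u)" for a u v
    by (simp_all add: N_def)
  have "abelian_group N"
  proof (rule abelian_groupI)
    fix u assume "u \<in> carrier N"
    then obtain x where x: "x \<in> carrier M" "u = e x" by auto
    then show "\<exists>v\<in>carrier N. v \<oplus>\<^bsub>N\<^esub> u = \<zero>\<^bsub>N\<^esub>"
      by (intro bexI[of _ "e (\<ominus>\<^bsub>M\<^esub> x)"]) (auto simp: M.l_neg)
  qed (auto simp: M.a_ac)
  then have "right_module R N"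
    unfolding right_module_def right_module_axioms_def using R.ring_axioms
    by (auto simp: smult_closed smult_l_distr smult_r_distr smult_assoc smult_one)
  obtain A where A: "finite A" "A \<subseteq> carrier M" "gen_submod R M A = carrier M"
    using fg by (auto simp: fg_module_def)
  have "carrier N \<subseteq> H" if H: "submodule H R N" "e ` A \<subseteq> H" for H
  proof -
    interpret H: submodule H R N by fact
    have zero: "e \<zero>\<^bsub>M\<^esub> \<in> H" using H.one_closed by simp
    have add: "e (x \<oplus>\<^bsub>M\<^esub> y) \<in> H" if "x \<in> carrier M" "y \<in> carrier M" "e x \<in> H" "e y \<in> H" for x y
      using H.m_closed[of "e x" "e y"] that by simp
    have smult: "e (a \<odot>\<^bsub>M\<^esub> x) \<in> H" if "a \<in> carrier R" "x \<in> carrier M" "e x \<in> H" for a x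
      using H.smult_closed[of a "e x"] that by simp
    have "submodule {x \<in> carrier M. e x \<in> H} R M"
      by (rule submodI) (auto simp: zero add smult smult_closed)
    then have "gen_submod R M A \<subseteq> {x \<in> carrier M. e x \<in> H}"
      unfolding gen_submod_def using A(2) H(2) by blast
    then show ?thesis using A(3) by auto
  qed
  moreover have "submodule (carrier N) R N"
    using \<open>right_module R N\<close> by (intro right_module.submodI)
      (auto simp: smult_closed)
  ultimately have "gen_submod R N (e ` A) = carrier N"
    unfolding gen_submod_def using image_mono[OF A(2), of e] by (simp del: N add: N(1)) blast
  then have "fg_module R N"
    unfolding fg_module_def using \<open>right_module R N\<close> A(1,2)
    by (metis N(1) finite_imageI image_mono)
  moreover have "mod_iso R M N"
    unfolding mod_iso_def mod_hom_def using inj by (intro bexI[of _ e]) (auto simp: bij_betw_def)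
  ultimately show ?thesis by blast
qed

theorem fg_module_iso_modcat:
  fixes R :: "('a, 'b) ring_scheme" (structure) and M :: "('a, 'm) module"
  assumes fg: "fg_module R M"
  shows "\<exists>N\<in>modcat R. mod_iso R M N"
proof -
  interpret right_module R M using fg by (simp add: fg_module_def)
  obtain A where A: "finite A" "A \<subseteq> carrier M" "gen_submod R M A = carrier M"
    using fg by (auto simp: fg_module_def)
  obtain n and x :: "nat \<Rightarrow> 'm" where "A = x ` {i. i < n}"
    using A(1) by (auto simp: finite_conv_nat_seg_image)
  then have x: "A = x ` {..<n}" "\<And>i. i < n \<Longrightarrow> x i \<in> carrier M"
    using A(2) by auto
  define h where "h = (\<lambda>c. \<Oplus>\<^bsub>M\<^esub>i\<in>{..<n}. c i \<odot>\<^bsub>M\<^esub> x i)"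
  define C where "C = ({..<n} \<rightarrow> carrier R)"
  have hM: "h c \<in> carrier M" if "c \<in> C" for c
    using that x(2) by (auto simp: h_def C_def intro!: M.finsum_closed smult_closed)
  have h0: "h (\<lambda>i. \<zero>) = \<zero>\<^bsub>M\<^esub>"
    unfolding h_def using x(2) by (intro M.add.finprod_one_eqI) (auto simp: smult_zero)
  have hadd: "h c \<oplus>\<^bsub>M\<^esub> h c' = h (\<lambda>i. c i \<oplus> c' i)" if "c \<in> C" "c' \<in> C" for c c'
  proof -
    have "h (\<lambda>i. c i \<oplus> c' i) = (\<Oplus>\<^bsub>M\<^esub>i\<in>{..<n}. c i \<odot>\<^bsub>M\<^esub> x i \<oplus>\<^bsub>M\<^esub> c' i \<odot>\<^bsub>M\<^esub> x i)"
      unfolding h_def using that x(2)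
      by (intro M.finsum_cong') (auto simp: C_def Pi_def smult_l_distr smult_closed)
    also have "\<dots> = h c \<oplus>\<^bsub>M\<^esub> h c'"
      unfolding h_def using that x(2) by (intro M.finsum_addf) (auto simp: C_def Pi_def smult_closed)
    finally show ?thesis by simp
  qed
  have sum_smult: "a \<odot>\<^bsub>M\<^esub> (\<Oplus>\<^bsub>M\<^esub>i\<in>I. y i) = (\<Oplus>\<^bsub>M\<^esub>i\<in>I. a \<odot>\<^bsub>M\<^esub> y i)"
    if "finite I" "a \<in> carrier R" "y \<in> I \<rightarrow> carrier M" for a I and y :: "nat \<Rightarrow> 'm"
    using that(1,3)
  proof (induction I)
    case empty
    have "a \<odot>\<^bsub>M\<^esub> (\<zero> \<odot>\<^bsub>M\<^esub> \<zero>\<^bsub>M\<^esub>) = \<zero> \<odot>\<^bsub>M\<^esub> \<zero>\<^bsub>M\<^esub>"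
      using that(2) by (subst smult_assoc[symmetric]) auto
    then show ?case by (simp add: smult_zero)
  next
    case (insert i I)
    then have "(\<lambda>i. a \<odot>\<^bsub>M\<^esub> y i) \<in> I \<rightarrow> carrier M" using that(2) by (auto simp: smult_closed Pi_iff)
    then show ?case using insert that(2) by (simp add: smult_r_distr smult_closed Pi_def)
  qed
  have hsmult: "a \<odot>\<^bsub>M\<^esub> h c = h (\<lambda>i. c i \<otimes> a)" if "a \<in> carrier R" "c \<in> C" for a c
  proof -
    have "a \<odot>\<^bsub>M\<^esub> h c = (\<Oplus>\<^bsub>M\<^esub>i\<in>{..<n}. a \<odot>\<^bsub>M\<^esub> (c i \<odot>\<^bsub>M\<^esub> x i))"
      unfolding h_def using that x(2) by (intro sum_smult) (auto simp: C_def Pi_def smult_closed)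
    also have "\<dots> = h (\<lambda>i. c i \<otimes> a)"
      unfolding h_def using that x(2)
      by (intro M.finsum_cong') (auto simp: C_def Pi_def smult_assoc smult_closed)
    finally show ?thesis .
  qed
  have "submodule (h ` C) R M"
  proof (rule submodI)
    show "h ` C \<subseteq> carrier M" using hM by auto
    show "\<zero>\<^bsub>M\<^esub> \<in> h ` C" using h0 by (intro image_eqI[of _ _ "\<lambda>i. \<zero>"]) (auto simp: C_def)
    show "u \<oplus>\<^bsub>M\<^esub> v \<in> h ` C" if "u \<in> h ` C" "v \<in> h ` C" for u v
    proof -
      obtain c c' where c: "c \<in> C" "u = h c" "c' \<in> C" "v = h c'" using \<open>u \<in> h ` C\<close> \<open>v \<in> h ` C\<close> by blast
      then have "(\<lambda>i. c i \<oplus> c' i) \<in> C" by (auto simp: C_def)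
      with c show ?thesis by (simp add: hadd)
    qed
    show "a \<odot>\<^bsub>M\<^esub> u \<in> h ` C" if "a \<in> carrier R" "u \<in> h ` C" for a u
    proof -
      obtain c where c: "c \<in> C" "u = h c" using \<open>u \<in> h ` C\<close> by blast
      then have "(\<lambda>i. c i \<otimes> a) \<in> C" using \<open>a \<in> carrier R\<close> by (auto simp: C_def)
      with c \<open>a \<in> carrier R\<close> show ?thesis by (simp add: hsmult)
    qed
  qed
  moreover have "A \<subseteq> h ` C"
  proof
    fix u assume "u \<in> A"
    then obtain j where j: "j < n" "u = x j" using x(1) by auto
    have "h (\<lambda>i. if i = j then \<one> else \<zero>) = (\<Oplus>\<^bsub>M\<^esub>i\<in>{..<n}. if j = i then x i else \<zero>\<^bsub>M\<^esub>)"
      unfolding h_def using x(2)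
      by (intro M.finsum_cong') (auto simp: smult_one smult_zero)
    also have "\<dots> = x j"
      using j x(2) by (intro M.add.finprod_singleton) auto
    finally show "u \<in> h ` C" using j
      by (intro image_eqI[of _ _ "\<lambda>i. if i = j then \<one> else \<zero>"]) (auto simp: C_def)
  qed
  ultimately have "gen_submod R M A \<subseteq> h ` C"
    unfolding gen_submod_def by blast
  then have surj: "carrier M \<subseteq> h ` C" using A(3) by simp
  have "inj_on (\<lambda>y. {c \<in> C. h c = y}) (carrier M)"
  proof (rule inj_onI)
    fix y z assume "y \<in> carrier M" and eq: "{c \<in> C. h c = y} = {c \<in> C. h c = z}"
    then obtain c where "c \<in> C" "h c = y" using surj by blast
    then show "y = z" using eq by blast
  qed
  from fg_module_transport[OF fg this] show ?thesis
    by (auto simp: modcat_def)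
qed

definition rep_finite :: "('a, 'b) ring_scheme \<Rightarrow> bool" where
  "rep_finite R \<longleftrightarrow> (\<exists>\<I> :: 'a rmod set. finite \<I> \<and>
     (\<forall>M\<in>modcat R. indecomposable_mod R M \<longrightarrow> (\<exists>I\<in>\<I>. mod_iso R M I)))"


section \<open>Artin algebras\<close>

definition artinian_ring :: "('k, 'c) ring_scheme \<Rightarrow> bool" where
  "artinian_ring k \<longleftrightarrow> ring k \<and>
     (\<forall>I :: nat \<Rightarrow> 'k set. (\<forall>n. ideal (I n) k \<and> I (Suc n) \<subseteq> I n) \<longrightarrow> (\<exists>m. \<forall>n\<ge>m. I n = I m))"

text \<open>\<open>R\<close> is an algebra over the commutative Artinian ring \<open>k\<close> via the structure map \<open>\<phi>\<close> into the
  centre of \<open>R\<close>, and is finitely generated as a \<open>k\<close>-module.\<close>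

definition artin_algebra ::
  "('k, 'c) ring_scheme \<Rightarrow> ('k \<Rightarrow> 'a) \<Rightarrow> ('a, 'b) ring_scheme \<Rightarrow> bool" where
  "artin_algebra k \<phi> R \<longleftrightarrow> cring k \<and> artinian_ring k \<and> ring R \<and> \<phi> \<in> ring_hom k R \<and>
     (\<forall>c\<in>carrier k. \<forall>x\<in>carrier R. \<phi> c \<otimes>\<^bsub>R\<^esub> x = x \<otimes>\<^bsub>R\<^esub> \<phi> c) \<and>
     fg_module k \<lparr>carrier = carrier R, mult = undefined, one = undefined, zero = \<zero>\<^bsub>R\<^esub>, add = add R,
                  smult = (\<lambda>c x. x \<otimes>\<^bsub>R\<^esub> \<phi> c)\<rparr>"


section \<open>Radical layer length\<close>

definition filtered :: "('a, 'b) ring_scheme \<Rightarrow> 'a rmod set \<Rightarrow> ('a, 'm) module \<Rightarrow> bool" where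
  "filtered R S M \<longleftrightarrow> fg_module R M \<and>
     (\<exists>(m :: nat) F. F 0 = {\<zero>\<^bsub>M\<^esub>} \<and> F m = carrier M \<and> (\<forall>i\<le>m. submodule (F i) R M) \<and>
        (\<forall>i<m. F i \<subseteq> F (Suc i) \<and>
           (\<exists>T\<in>S. mod_iso R (quot_mod (restrict_mod M (F (Suc i))) (F i)) T)))"

definition torsion :: "('a, 'b) ring_scheme \<Rightarrow> 'a rmod set \<Rightarrow> ('a, 'm) module \<Rightarrow> bool" where
  "torsion R S M \<longleftrightarrow> fg_module R M \<and>
     (\<forall>N\<in>modcat R. filtered R S N \<longrightarrow> (\<forall>f\<in>mod_hom R M N. \<forall>x\<in>carrier M. f x = \<zero>\<^bsub>N\<^esub>))"

definition torsion_sub :: "('a, 'b) ring_scheme \<Rightarrow> 'a rmod set \<Rightarrow> ('a, 'm) module \<Rightarrow> ('a, 'm) module"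
  where
  "torsion_sub R S M =
     restrict_mod M (GREATEST H. submodule H R M \<and> torsion R S (restrict_mod M H))"

definition rad_torsion :: "('a, 'b) ring_scheme \<Rightarrow> 'a rmod set \<Rightarrow> ('a, 'm) module \<Rightarrow> ('a, 'm) module"
  where
  "rad_torsion R S M = rad R (torsion_sub R S M)"

text \<open>The infimum is taken in \<^typ>\<open>enat\<close>, so that it would be \<open>\<infinity>\<close> (and not 0) for the empty set.\<close>

definition layer_length :: "('a, 'b) ring_scheme \<Rightarrow> 'a rmod set \<Rightarrow> ('a, 'm) module \<Rightarrow> enat" where
  "layer_length R S M = Inf {enat i | i. zero_mod (torsion_sub R S ((rad_torsion R S ^^ i) M))}"


section \<open>Orlov spectrum\<close>

definition add_closure :: "('a, 'b) ring_scheme \<Rightarrow> 'a rmod set \<Rightarrow> 'a rmod set" where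
  "add_closure R \<U> = {X \<in> modcat R. \<exists>Y\<in>modcat R. \<exists>Us. set Us \<subseteq> \<U> \<and>
     mod_iso R (dsum [X, Y]) (dsum Us)}"

definition bullet :: "('a, 'b) ring_scheme \<Rightarrow> 'a rmod set \<Rightarrow> 'a rmod set \<Rightarrow> 'a rmod set" where
  "bullet R \<U> \<V> = add_closure R {X \<in> modcat R. \<exists>U\<in>\<U>. \<exists>V\<in>\<V>. \<exists>f g. short_exact R U f X g V}"

fun ext_layer :: "('a, 'b) ring_scheme \<Rightarrow> 'a rmod \<Rightarrow> nat \<Rightarrow> 'a rmod set" where
  "ext_layer R X 0 = {M \<in> modcat R. zero_mod M}"
| "ext_layer R X (Suc 0) = add_closure R {X}"
| "ext_layer R X (Suc (Suc n)) = bullet R (add_closure R {X}) (ext_layer R X (Suc n))"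

definition generation_time :: "('a, 'b) ring_scheme \<Rightarrow> 'a rmod \<Rightarrow> enat" where
  "generation_time R X =
     (if \<exists>t. ext_layer R X t = modcat R then Inf {enat n | n. modcat R = ext_layer R X (n + 1)}
      else \<infinity>)"

definition strong_generator :: "('a, 'b) ring_scheme \<Rightarrow> 'a rmod \<Rightarrow> bool" where
  "strong_generator R X \<longleftrightarrow> X \<in> modcat R \<and> generation_time R X \<noteq> \<infinity>"

definition OSpec :: "('a, 'b) ring_scheme \<Rightarrow> enat set" where
  "OSpec R = {generation_time R X | X. strong_generator R X}"

end

theory Submission
  imports Defs
begin

text \<open>Write \<open>t\<close> for the torsion submodule and \<open>F = rad \<circ> t\<close>. By the descending chain condition \<open>t(M)\<close> is the
  least submodule \<open>K\<close> with \<open>M / K\<close> filtered by \<open>S\<close>. Both \<open>t\<close> and \<open>rad\<close> are subfunctors of the identity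
  preserving surjections, hence so are the \<open>F\<^sup>i\<close>; the bounds for a submodule and a quotient follow. For
  an exact sequence \<open>0 \<rightarrow> L \<rightarrow> M \<rightarrow> N \<rightarrow> 0\<close> with \<open>t(F\<^sup>n(N)) = 0\<close> one gets \<open>t(F\<^sup>n(M)) \<subseteq> L\<close>, and \<open>t \<circ> t = t\<close> gives
  \<open>t(F\<^sup>m(F\<^sup>n(M))) = t(F\<^sup>m(t(F\<^sup>n(M)))) \<subseteq> t(F\<^sup>m(L))\<close>, hence subadditivity.

  For the second part let \<open>X\<close> be the sum of the indecomposables of layer length at most \<open>d\<close>. Subadditivity,
  and the splitting of \<open>M\<close> into \<open>F\<^sup>n(M)\<close> and \<open>M / F\<^sup>n(M)\<close>, show that \<open>[X]\<^sub>n\<close> consists exactly of the modules of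
  layer length at most \<open>nd\<close>. As every module is a quotient of a free module, this is everything
  if and only if \<open>nd\<close> is at least the layer length of the ring.\<close>

section \<open>Submodules and homomorphisms\<close>

text \<open>Preserving surjections is not automatic for the radical: Z -> Z/4 is onto, yet rad(Z) is
  zero and rad(Z/4) is not. The descending chain condition on finitely generated modules, inherited
  from the Artinian base ring, supplies what is needed: a submodule containing the radical is then
  an intersection of maximal submodules. That t(M) and rad(M) are again finitely generated is a
  further point; it rests on the fact that over a commutative Artinian ring the chain condition
  forces finite generation. For t the surjection is followed down a filtration of M/t(M), one simple
  factor at a time. Types also shape the proof. t, rad and F are kept as restrictions of M, so their
  powers stay in one carrier type; direct sums and quotients leave it and are copied back before
  they can be members of an extension layer. Of decompositions into indecomposables only existence
  enters, in the form of a retraction from a power of X. The -1 in the spectrum is an index shift: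
  generation time n refers to the layer with index n+1, and the least n with l at most (n+1)d is
  wanted, l being the layer length of the ring.\<close>

lemma restrict_mod_simps [simp]:
  "carrier (restrict_mod M H) = H" "\<zero>\<^bsub>restrict_mod M H\<^esub> = \<zero>\<^bsub>M\<^esub>"
  "x \<oplus>\<^bsub>restrict_mod M H\<^esub> y = x \<oplus>\<^bsub>M\<^esub> y" "a \<odot>\<^bsub>restrict_mod M H\<^esub> x = a \<odot>\<^bsub>M\<^esub> x"
  "restrict_mod (restrict_mod M H) K = restrict_mod M K" "restrict_mod M (carrier M) = M"
  by (simp_all add: restrict_mod_def)

lemma set_add_iff: "x \<in> set_add M H K \<longleftrightarrow> (\<exists>h\<in>H. \<exists>k\<in>K. x = h \<oplus>\<^bsub>M\<^esub> k)"
  by (simp add: set_add_def set_mult_def)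

locale rmodule = right_module R M
  for R :: "('a, 'b) ring_scheme" (structure) and M :: "('a, 'm) module"
begin

lemmas M_smult_simps [simp] = smult_closed smult_one smult_zero

lemma smult_zero_right [simp]: "a \<in> carrier R \<Longrightarrow> a \<odot>\<^bsub>M\<^esub> \<zero>\<^bsub>M\<^esub> = \<zero>\<^bsub>M\<^esub>"
  using smult_assoc[of "\<zero>" a "\<zero>\<^bsub>M\<^esub>"] by simp

lemma submodule_iff:
  "submodule H R M \<longleftrightarrow> H \<subseteq> carrier M \<and> \<zero>\<^bsub>M\<^esub> \<in> H \<and> (\<forall>x\<in>H. \<forall>y\<in>H. x \<oplus>\<^bsub>M\<^esub> y \<in> H) \<and>
     (\<forall>a\<in>carrier R. \<forall>x\<in>H. a \<odot>\<^bsub>M\<^esub> x \<in> H)" (is "_ \<longleftrightarrow> ?rhs")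
proof
  assume "submodule H R M"
  then interpret H: submodule H R M .
  show ?rhs using H.subset H.one_closed H.m_closed by auto
qed (auto intro: submodI)

lemma submoduleD:
  assumes "submodule H R M"
  shows "H \<subseteq> carrier M" "\<And>x. x \<in> H \<Longrightarrow> x \<in> carrier M" "\<zero>\<^bsub>M\<^esub> \<in> H"
    "\<And>x y. x \<in> H \<Longrightarrow> y \<in> H \<Longrightarrow> x \<oplus>\<^bsub>M\<^esub> y \<in> H" "\<And>a x. a \<in> carrier R \<Longrightarrow> x \<in> H \<Longrightarrow> a \<odot>\<^bsub>M\<^esub> x \<in> H"
  using assms by (auto simp: submodule_iff)

lemma submodule_uminus: "submodule H R M \<Longrightarrow> x \<in> H \<Longrightarrow> \<ominus>\<^bsub>M\<^esub> x \<in> H"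
  using submoduleD(2,5)[of H] smult_minus_one[of x] by (metis R.add.inv_closed R.one_closed)

lemma submodule_minus: "submodule H R M \<Longrightarrow> x \<in> H \<Longrightarrow> y \<in> H \<Longrightarrow> x \<ominus>\<^bsub>M\<^esub> y \<in> H"
  by (simp add: a_minus_def submodule_uminus submoduleD(4))

lemma add_minus_cancel [simp]:
  assumes "x \<in> carrier M" "y \<in> carrier M"
  shows "x \<oplus>\<^bsub>M\<^esub> (y \<ominus>\<^bsub>M\<^esub> x) = y" "(y \<ominus>\<^bsub>M\<^esub> x) \<oplus>\<^bsub>M\<^esub> x = y" "(x \<oplus>\<^bsub>M\<^esub> y) \<ominus>\<^bsub>M\<^esub> y = x"
    "(x \<oplus>\<^bsub>M\<^esub> y) \<ominus>\<^bsub>M\<^esub> x = y"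
proof -
  have "x \<oplus>\<^bsub>M\<^esub> (y \<oplus>\<^bsub>M\<^esub> \<ominus>\<^bsub>M\<^esub> x) = y" if "x \<in> carrier M" "y \<in> carrier M" for x y
    using that by (simp add: M.a_lcomm[of x y] M.r_neg)
  from this[of x y] this[of y x] show "x \<oplus>\<^bsub>M\<^esub> (y \<ominus>\<^bsub>M\<^esub> x) = y" "(y \<ominus>\<^bsub>M\<^esub> x) \<oplus>\<^bsub>M\<^esub> x = y"
    "(x \<oplus>\<^bsub>M\<^esub> y) \<ominus>\<^bsub>M\<^esub> y = x" "(x \<oplus>\<^bsub>M\<^esub> y) \<ominus>\<^bsub>M\<^esub> x = y"
    using assms by (simp_all add: a_minus_def M.a_ac)
qed

lemma submodule_add_cancel:
  assumes "submodule H R M" "x \<in> H" "y \<in> carrier M" "x \<oplus>\<^bsub>M\<^esub> y \<in> H"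
  shows "y \<in> H"
  using submodule_minus[OF assms(1,4,2)] assms submoduleD(2)[OF assms(1)] by simp

lemma submodule_add_cancel':
  assumes "submodule H R M" "y \<in> H" "x \<in> carrier M" "x \<oplus>\<^bsub>M\<^esub> y \<in> H"
  shows "x \<in> H"
  using submodule_minus[OF assms(1,4,2)] assms submoduleD(2)[OF assms(1)] by simp

lemma submodule_carrier: "submodule (carrier M) R M"
  by (simp add: submodule_iff)

lemma submodule_singleton: "submodule {\<zero>\<^bsub>M\<^esub>} R M"
  by (simp add: submodule_iff)

lemma submodule_Int: "submodule H R M \<Longrightarrow> submodule K R M \<Longrightarrow> submodule (H \<inter> K) R M"
  by (auto simp: submodule_iff)

lemma submodule_Inter: "(\<And>K. K \<in> X \<Longrightarrow> submodule K R M) \<Longrightarrow> submodule (carrier M \<inter> \<Inter>X) R M"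
  by (simp add: submodule_iff)

lemma submodule_Union_chain:
  assumes "C \<noteq> {}" "\<And>K. K \<in> C \<Longrightarrow> submodule K R M" "\<And>K L. K \<in> C \<Longrightarrow> L \<in> C \<Longrightarrow> K \<subseteq> L \<or> L \<subseteq> K"
  shows "submodule (\<Union>C) R M"
proof (rule submodI)
  show "x \<oplus>\<^bsub>M\<^esub> y \<in> \<Union>C" if xy: "x \<in> \<Union>C" "y \<in> \<Union>C" for x y
  proof -
    obtain K L where "x \<in> K" "K \<in> C" "y \<in> L" "L \<in> C" using xy by blast
    then show ?thesis using assms(2,3) by (meson UnionI subsetD submoduleD(4))
  qed
  show "\<Union>C \<subseteq> carrier M" using assms(2) submoduleD(1) by blast
  show "\<zero>\<^bsub>M\<^esub> \<in> \<Union>C" using assms(1,2) submoduleD(3) by blast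
  show "a \<odot>\<^bsub>M\<^esub> x \<in> \<Union>C" if "a \<in> carrier R" "x \<in> \<Union>C" for a x
    using that assms(2) submoduleD(5) by blast
qed

lemma submodule_set_add:
  assumes "submodule H R M" "submodule K R M"
  shows "submodule (set_add M H K) R M"
proof (rule submodI)
  note [intro] = submoduleD(2-5)[OF assms(1)] submoduleD(2-5)[OF assms(2)]
  show "set_add M H K \<subseteq> carrier M"
    using submoduleD(2)[OF assms(1)] submoduleD(2)[OF assms(2)] unfolding set_add_iff subset_iff
    by (metis M.add.m_closed)
  show "\<zero>\<^bsub>M\<^esub> \<in> set_add M H K"
    unfolding set_add_iff by (rule bexI[of _ "\<zero>\<^bsub>M\<^esub>"], rule bexI[of _ "\<zero>\<^bsub>M\<^esub>"]) auto
  show "x \<oplus>\<^bsub>M\<^esub> y \<in> set_add M H K" if xy: "x \<in> set_add M H K" "y \<in> set_add M H K" for x y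
  proof -
    obtain h k h' k' where *: "h \<in> H" "k \<in> K" "x = h \<oplus>\<^bsub>M\<^esub> k" "h' \<in> H" "k' \<in> K" "y = h' \<oplus>\<^bsub>M\<^esub> k'"
      using xy unfolding set_add_iff by blast
    then have "h \<in> carrier M" "k \<in> carrier M" "h' \<in> carrier M" "k' \<in> carrier M" by auto
    then have "x \<oplus>\<^bsub>M\<^esub> y = (h \<oplus>\<^bsub>M\<^esub> h') \<oplus>\<^bsub>M\<^esub> (k \<oplus>\<^bsub>M\<^esub> k')"
      using * by (simp add: M.a_ac)
    then show ?thesis using * unfolding set_add_iff by blast
  qed
  show "a \<odot>\<^bsub>M\<^esub> x \<in> set_add M H K" if ax: "a \<in> carrier R" "x \<in> set_add M H K" for a x
  proof -
    obtain h k where *: "h \<in> H" "k \<in> K" "x = h \<oplus>\<^bsub>M\<^esub> k" using ax unfolding set_add_iff by blast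
    then have "a \<odot>\<^bsub>M\<^esub> x = a \<odot>\<^bsub>M\<^esub> h \<oplus>\<^bsub>M\<^esub> a \<odot>\<^bsub>M\<^esub> k" using ax by (auto intro: smult_r_distr)
    then show ?thesis using * ax unfolding set_add_iff by blast
  qed
qed

lemma set_add_upper1: "submodule H R M \<Longrightarrow> submodule K R M \<Longrightarrow> H \<subseteq> set_add M H K"
  unfolding set_add_iff subset_iff by (metis M.r_zero submoduleD(2,3))

lemma set_add_upper2: "submodule H R M \<Longrightarrow> submodule K R M \<Longrightarrow> K \<subseteq> set_add M H K"
  unfolding set_add_iff subset_iff by (metis M.l_zero submoduleD(2,3))

lemma set_add_least:
  "submodule L R M \<Longrightarrow> H \<subseteq> L \<Longrightarrow> K \<subseteq> L \<Longrightarrow> set_add M H K \<subseteq> L"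
  unfolding set_add_iff subset_iff using submoduleD(4) by blast

lemma submodule_cyclic:
  assumes "x \<in> carrier M"
  shows "submodule ((\<lambda>a. a \<odot>\<^bsub>M\<^esub> x) ` carrier R) R M" "x \<in> (\<lambda>a. a \<odot>\<^bsub>M\<^esub> x) ` carrier R"
proof -
  show "submodule ((\<lambda>a. a \<odot>\<^bsub>M\<^esub> x) ` carrier R) R M"
    unfolding submodule_iff using assms
    by (auto simp: smult_l_distr[symmetric] smult_assoc[symmetric] intro!: image_eqI[of _ _ "\<zero>"])
  show "x \<in> (\<lambda>a. a \<odot>\<^bsub>M\<^esub> x) ` carrier R"
    using assms by (intro image_eqI[of _ _ "\<one>"]) auto
qed

lemma rmodule_restrict:
  assumes "submodule H R M" shows "rmodule R (restrict_mod M H)"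
proof -
  note [intro, simp] = submoduleD[OF assms]
  have "abelian_group (restrict_mod M H)"
  proof (rule abelian_groupI)
    fix x assume "x \<in> carrier (restrict_mod M H)"
    then show "\<exists>y\<in>carrier (restrict_mod M H). y \<oplus>\<^bsub>restrict_mod M H\<^esub> x = \<zero>\<^bsub>restrict_mod M H\<^esub>"
      using submodule_uminus[OF assms, of x] by (intro bexI[of _ "\<ominus>\<^bsub>M\<^esub> x"]) (auto simp: M.l_neg)
  qed (auto simp: M.a_ac)
  then show ?thesis
    unfolding rmodule_def right_module_def right_module_axioms_def using R.ring_axioms
    by (auto simp: smult_l_distr smult_r_distr smult_assoc)
qed

lemma submodule_restrict:
  assumes "submodule H R M"
  shows "submodule K R (restrict_mod M H) \<longleftrightarrow> submodule K R M \<and> K \<subseteq> H"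
  using submoduleD(1)[OF assms] rmodule.submodule_iff[OF rmodule_restrict[OF assms]]
  by (auto simp: submodule_iff)

lemma submodule_gen: "A \<subseteq> carrier M \<Longrightarrow> submodule (gen_submod R M A) R M"
  using submodule_Inter[of "{H. submodule H R M \<and> A \<subseteq> H}"] submodule_carrier
  unfolding gen_submod_def by (simp add: Int_absorb1 Inter_lower)

lemma gen_upper: "A \<subseteq> gen_submod R M A"
  unfolding gen_submod_def by blast

lemma gen_least: "submodule H R M \<Longrightarrow> A \<subseteq> H \<Longrightarrow> gen_submod R M A \<subseteq> H"
  unfolding gen_submod_def by blast

lemma gen_mono: "A \<subseteq> B \<Longrightarrow> gen_submod R M A \<subseteq> gen_submod R M B"
  unfolding gen_submod_def by blast

lemma gen_restrict:
  assumes "submodule H R M" "A \<subseteq> H"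
  shows "gen_submod R (restrict_mod M H) A = gen_submod R M A"
proof
  have H: "A \<subseteq> carrier M" using assms submoduleD(1) by blast
  interpret H: rmodule R "restrict_mod M H" by (rule rmodule_restrict[OF assms(1)])
  show "gen_submod R (restrict_mod M H) A \<subseteq> gen_submod R M A"
    using H gen_least[OF assms] by (intro H.gen_least gen_upper) (simp add: assms(1) submodule_restrict submodule_gen)
  have "submodule (gen_submod R (restrict_mod M H) A) R (restrict_mod M H)"
    using H.submodule_gen assms(2) by simp
  then show "gen_submod R M A \<subseteq> gen_submod R (restrict_mod M H) A"
    by (intro gen_least H.gen_upper) (simp add: assms(1) submodule_restrict)
qed

lemma gen_insert:
  assumes "A \<subseteq> carrier M" "x \<in> carrier M"
  shows "gen_submod R M (insert x A) = set_add M (gen_submod R M A) ((\<lambda>a. a \<odot>\<^bsub>M\<^esub> x) ` carrier R)"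
    (is "_ = set_add M ?A ?x")
proof
  have A: "submodule ?A R M" and x: "submodule ?x R M" "x \<in> ?x"
    using assms by (simp_all add: submodule_gen submodule_cyclic)
  show "gen_submod R M (insert x A) \<subseteq> set_add M ?A ?x"
    using set_add_upper1[OF A x(1)] set_add_upper2[OF A x(1)] gen_upper[of A] x(2)
    by (intro gen_least submodule_set_add A x) auto
  have ins: "submodule (gen_submod R M (insert x A)) R M" using assms by (intro submodule_gen) auto
  have "x \<in> gen_submod R M (insert x A)" using gen_upper[of "insert x A"] by blast
  then show "set_add M ?A ?x \<subseteq> gen_submod R M (insert x A)"
    using gen_mono[of A "insert x A"] submoduleD(5)[OF ins] by (intro set_add_least ins) auto
qed

lemma gen_empty: "gen_submod R M {} = {\<zero>\<^bsub>M\<^esub>}"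
  using gen_least[OF submodule_singleton, of "{}"] submoduleD(3)[OF submodule_gen[of "{}"]] by auto

text \<open>Zorn's lemma applies because the union of a chain of submodules missing \<open>x\<close>
  still misses \<open>x\<close>. The result serves two ends: with \<open>W\<close> zero it plays the
  role of a hyperplane, and with \<open>W\<close> spanned by all but one member of a smallest
  generating set it is a maximal submodule.\<close>

lemma submodule_avoiding:
  assumes "submodule W R M" "x \<notin> W"
  obtains G where "submodule G R M" "W \<subseteq> G" "x \<notin> G"
    "\<And>H. submodule H R M \<Longrightarrow> G \<subset> H \<Longrightarrow> x \<in> H"
proof -
  define X where "X = {G. submodule G R M \<and> W \<subseteq> G \<and> x \<notin> G}"
  have "\<exists>G\<in>X. \<forall>H\<in>X. G \<subseteq> H \<longrightarrow> H = G"
  proof (rule subset_Zorn_nonempty)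
    show "X \<noteq> {}" using assms unfolding X_def by blast
    show "\<Union>C \<in> X" if "C \<noteq> {}" "subset.chain X C" for C
    proof -
      have "submodule (\<Union>C) R M"
        using that by (intro submodule_Union_chain) (auto simp: subset.chain_def X_def)
      then show ?thesis using that unfolding X_def subset.chain_def by blast
    qed
  qed
  then obtain G where G: "G \<in> X" "\<And>H. H \<in> X \<Longrightarrow> G \<subseteq> H \<Longrightarrow> H = G" by blast
  show thesis
  proof (rule that)
    show "x \<in> H" if "submodule H R M" "G \<subset> H" for H
      using G(2)[of H] G(1) that unfolding X_def by blast
  qed (use G(1) in \<open>auto simp: X_def\<close>)
qed

end

section \<open>Homomorphisms: kernels, images and generators\<close>

locale rmodule_hom = M: rmodule R M + N: rmodule R N
  for R :: "('a, 'b) ring_scheme" and M :: "('a, 'm) module" and N :: "('a, 'n) module" +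
  fixes f assumes hom: "f \<in> mod_hom R M N"
begin

lemma f_closed [simp]: "x \<in> carrier M \<Longrightarrow> f x \<in> carrier N"
  and f_add [simp]: "x \<in> carrier M \<Longrightarrow> y \<in> carrier M \<Longrightarrow> f (x \<oplus>\<^bsub>M\<^esub> y) = f x \<oplus>\<^bsub>N\<^esub> f y"
  and f_smult [simp]: "a \<in> carrier R \<Longrightarrow> x \<in> carrier M \<Longrightarrow> f (a \<odot>\<^bsub>M\<^esub> x) = a \<odot>\<^bsub>N\<^esub> f x"
  using hom unfolding mod_hom_def by auto

lemma f_zero [simp]: "f \<zero>\<^bsub>M\<^esub> = \<zero>\<^bsub>N\<^esub>"
  using f_smult[of "\<zero>\<^bsub>R\<^esub>" "\<zero>\<^bsub>M\<^esub>"] by simp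

lemma f_uminus [simp]: "x \<in> carrier M \<Longrightarrow> f (\<ominus>\<^bsub>M\<^esub> x) = \<ominus>\<^bsub>N\<^esub> f x"
  by (metis M.R.add.inv_closed M.R.one_closed M.smult_minus_one N.smult_minus_one f_closed f_smult)

lemma f_minus [simp]: "x \<in> carrier M \<Longrightarrow> y \<in> carrier M \<Longrightarrow> f (x \<ominus>\<^bsub>M\<^esub> y) = f x \<ominus>\<^bsub>N\<^esub> f y"
  by (simp add: a_minus_def)

lemma submodule_preimage:
  assumes "submodule K R N" shows "submodule {x \<in> carrier M. f x \<in> K} R M"
  using N.submoduleD[OF assms] unfolding M.submodule_iff by simp

lemma submodule_image:
  assumes "submodule H R M" shows "submodule (f ` H) R N"
  unfolding N.submodule_iff
proof (intro conjI ballI)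
  note H [simp] = M.submoduleD[OF assms]
  show "f ` H \<subseteq> carrier N" by auto
  show "\<zero>\<^bsub>N\<^esub> \<in> f ` H" by (rule image_eqI[of _ _ "\<zero>\<^bsub>M\<^esub>"]) auto
  show "x \<oplus>\<^bsub>N\<^esub> y \<in> f ` H" if "x \<in> f ` H" "y \<in> f ` H" for x y
    using that H(4) f_add H(2) by (smt (verit) image_iff)
  show "a \<odot>\<^bsub>N\<^esub> x \<in> f ` H" if "a \<in> carrier R" "x \<in> f ` H" for a x
    using that H(5) f_smult H(2) by (smt (verit) image_iff)
qed

lemma submodule_kernel: "submodule {x \<in> carrier M. f x = \<zero>\<^bsub>N\<^esub>} R M"
  using submodule_preimage[OF N.submodule_singleton] by simp

lemma inj_iff_kernel: "inj_on f (carrier M) \<longleftrightarrow> (\<forall>x\<in>carrier M. f x = \<zero>\<^bsub>N\<^esub> \<longrightarrow> x = \<zero>\<^bsub>M\<^esub>)"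
proof
  assume "inj_on f (carrier M)"
  then show "\<forall>x\<in>carrier M. f x = \<zero>\<^bsub>N\<^esub> \<longrightarrow> x = \<zero>\<^bsub>M\<^esub>"
    by (metis M.M.zero_closed f_zero inj_onD)
next
  assume *: "\<forall>x\<in>carrier M. f x = \<zero>\<^bsub>N\<^esub> \<longrightarrow> x = \<zero>\<^bsub>M\<^esub>"
  show "inj_on f (carrier M)"
  proof (rule inj_onI)
    fix x y assume xy: "x \<in> carrier M" "y \<in> carrier M" "f x = f y"
    then have "x \<ominus>\<^bsub>M\<^esub> y = \<zero>\<^bsub>M\<^esub>"
      using * by (simp add: a_minus_def N.M.r_neg)
    then show "x = y" using M.add_minus_cancel(1)[OF xy(2,1)] xy by simp
  qed
qed

lemma image_gen:
  assumes "A \<subseteq> carrier M" shows "f ` gen_submod R M A = gen_submod R N (f ` A)"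
proof
  have sub: "f ` A \<subseteq> carrier N" using assms by auto
  have "gen_submod R M A \<subseteq> {x \<in> carrier M. f x \<in> gen_submod R N (f ` A)}"
    using assms N.gen_upper[of "f ` A"] by (intro M.gen_least submodule_preimage N.submodule_gen sub) auto
  then show "f ` gen_submod R M A \<subseteq> gen_submod R N (f ` A)" by auto
  show "gen_submod R N (f ` A) \<subseteq> f ` gen_submod R M A"
    by (intro N.gen_least submodule_image M.submodule_gen assms image_mono M.gen_upper)
qed

text \<open>Every element of \<open>M\<close> differs by an element of the kernel from one generated
  by \<open>A\<close>.\<close>

lemma gen_union_kernel:
  assumes A: "A \<subseteq> carrier M" "gen_submod R N (f ` A) = f ` carrier M"
    and B: "B \<subseteq> carrier M" "gen_submod R M B = {x \<in> carrier M. f x = \<zero>\<^bsub>N\<^esub>}"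
  shows "gen_submod R M (A \<union> B) = carrier M"
proof
  have AB: "submodule (gen_submod R M (A \<union> B)) R M" using assms by (intro M.submodule_gen) auto
  then show "gen_submod R M (A \<union> B) \<subseteq> carrier M" by (rule M.submoduleD)
  show "carrier M \<subseteq> gen_submod R M (A \<union> B)"
  proof
    fix x assume x: "x \<in> carrier M"
    then obtain y where y: "y \<in> gen_submod R M A" "f x = f y"
      using A image_gen[OF A(1)] by (metis imageE image_eqI)
    then have yM: "y \<in> carrier M" using M.submoduleD(2)[OF M.submodule_gen[OF A(1)]] by blast
    then have "x \<ominus>\<^bsub>M\<^esub> y \<in> gen_submod R M B"
      using x y B(2) by (simp add: a_minus_def N.M.r_neg)
    then have "(x \<ominus>\<^bsub>M\<^esub> y) \<oplus>\<^bsub>M\<^esub> y \<in> gen_submod R M (A \<union> B)"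
      using y M.gen_mono[of A "A \<union> B"] M.gen_mono[of B "A \<union> B"] by (intro M.submoduleD(4)[OF AB]) auto
    then show "x \<in> gen_submod R M (A \<union> B)" using x yM by simp
  qed
qed

end

section \<open>Chain conditions over an Artin algebra\<close>

lemma regular_mod_simps [simp]:
  "carrier (regular_mod R) = carrier R" "\<zero>\<^bsub>regular_mod R\<^esub> = \<zero>\<^bsub>R\<^esub>"
  "x \<oplus>\<^bsub>regular_mod R\<^esub> y = x \<oplus>\<^bsub>R\<^esub> y" "a \<odot>\<^bsub>regular_mod R\<^esub> x = x \<otimes>\<^bsub>R\<^esub> a"
  by (simp_all add: regular_mod_def)

lemma (in ring) rmodule_regular: "rmodule R (regular_mod R)"
proof -
  have "abelian_group (regular_mod R)"
    by (rule abelian_groupI) (auto simp: a_ac intro: l_neg bexI[of _ "\<ominus> _"])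
  then show ?thesis
    unfolding rmodule_def right_module_def right_module_axioms_def using ring_axioms
    by (auto simp: l_distr r_distr m_assoc)
qed

lemma (in cring) ideal_if_submodule_regular:
  assumes "submodule I R (regular_mod R)" shows "ideal I R"
proof -
  interpret rmodule R "regular_mod R" by (rule rmodule_regular)
  have uminus: "\<ominus> a \<in> I" if "a \<in> I" for a
    using submoduleD(5)[OF assms, of "\<ominus> \<one>" a] submoduleD(2)[OF assms, of a] that by (simp add: r_minus)
  have "subgroup I (add_monoid R)"
    using submoduleD[OF assms] uminus
    by (intro subgroup.intro) (auto simp: a_inv_def[symmetric])
  moreover have r: "x \<otimes> a \<in> I" if "a \<in> carrier R" "x \<in> I" for a x
    using submoduleD(5)[OF assms that] by simp
  moreover have "a \<otimes> x \<in> I" if "a \<in> carrier R" "x \<in> I" for a x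
    using r[OF that] m_comm[of a x] submoduleD(2)[OF assms that(2)] that(1) by simp
  ultimately show ?thesis
    by (intro idealI ring_axioms) auto
qed

section \<open>The descending chain condition and finite generation\<close>

definition dcc :: "('a, 'b) ring_scheme \<Rightarrow> ('a, 'm) module \<Rightarrow> bool" where
  "dcc R M \<longleftrightarrow> (\<forall>H :: nat \<Rightarrow> 'm set. (\<forall>n. submodule (H n) R M \<and> H (Suc n) \<subseteq> H n) \<longrightarrow>
     (\<exists>m. \<forall>n\<ge>m. H n = H m))"

text \<open>Without a minimal submodule, dependent choice would produce a strictly descending
  sequence. In this form the chain condition yields minimal counterexamples, minimal supplements and
  the torsion submodule.\<close>

lemma dcc_minimal:
  assumes "dcc R M" "submodule H R M" "P H"
  shows "\<exists>K. submodule K R M \<and> P K \<and> (\<forall>L. submodule L R M \<longrightarrow> P L \<longrightarrow> L \<subseteq> K \<longrightarrow> L = K)"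
proof (rule ccontr)
  assume "\<not> ?thesis"
  then have neg: "\<exists>L. (submodule L R M \<and> P L) \<and> L \<subset> K" if "submodule K R M \<and> P K" for K
    using that by blast
  have "\<exists>F. \<forall>n. (submodule (F n) R M \<and> P (F n)) \<and> F (Suc n) \<subset> F n"
    by (rule dependent_nat_choice) (use assms(2,3) neg in auto)
  then obtain F where F: "\<forall>n. (submodule (F n) R M \<and> P (F n)) \<and> F (Suc n) \<subset> F n" ..
  then have "\<forall>n. submodule (F n) R M \<and> F (Suc n) \<subseteq> F n" by auto
  then obtain m where "\<forall>n\<ge>m. F n = F m" using assms(1)[unfolded dcc_def, THEN spec, of F] by blast
  then have "F (Suc m) = F m" by (meson le_SucI order_refl)
  then show False using F by auto
qed

text \<open>A property of a subset inside the ambient module, so that kernels, images and a change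
  of the scalar ring can be handled without passing to restricted modules.\<close>

definition fg_submod :: "('a, 'b) ring_scheme \<Rightarrow> ('a, 'm) module \<Rightarrow> 'm set \<Rightarrow> bool" where
  "fg_submod R M H \<longleftrightarrow> (\<exists>A. finite A \<and> A \<subseteq> carrier M \<and> gen_submod R M A = H)"

lemma (in rmodule) fg_module_restrict_iff:
  assumes "submodule H R M"
  shows "fg_module R (restrict_mod M H) \<longleftrightarrow> fg_submod R M H"
proof -
  interpret H: rmodule R "restrict_mod M H" by (rule rmodule_restrict[OF assms])
  have "A \<subseteq> H \<and> gen_submod R (restrict_mod M H) A = H \<longleftrightarrow> A \<subseteq> carrier M \<and> gen_submod R M A = H" for A
    using gen_restrict[OF assms, of A] gen_upper[of A] submoduleD(1)[OF assms] by auto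
  then show ?thesis
    unfolding fg_module_def fg_submod_def using H.right_module_axioms by simp
qed

lemma (in rmodule) fg_module_iff: "fg_module R M \<longleftrightarrow> fg_submod R M (carrier M)"
  using fg_module_restrict_iff[OF submodule_carrier] by simp

lemma (in rmodule_hom) fg_submod_if_image_kernel:
  assumes "fg_submod R N (f ` carrier M)" "fg_submod R M {x \<in> carrier M. f x = \<zero>\<^bsub>N\<^esub>}"
  shows "fg_submod R M (carrier M)"
proof -
  obtain A' where A': "finite A'" "A' \<subseteq> carrier N" "gen_submod R N A' = f ` carrier M"
    using assms(1) unfolding fg_submod_def by blast
  then have "A' \<subseteq> f ` carrier M" using N.gen_upper by blast
  then obtain A where A: "A \<subseteq> carrier M" "finite A" "A' = f ` A"
    using finite_subset_image[OF A'(1)] by metis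
  obtain B where B: "finite B" "B \<subseteq> carrier M" "gen_submod R M B = {x \<in> carrier M. f x = \<zero>\<^bsub>N\<^esub>}"
    using assms(2) unfolding fg_submod_def by blast
  have "gen_submod R M (A \<union> B) = carrier M"
    using gen_union_kernel[OF A(1) _ B(2,3)] A'(3) A(3) by simp
  then show ?thesis
    unfolding fg_submod_def using A(1,2) B(1,2) by (intro exI[of _ "A \<union> B"]) auto
qed

lemma (in rmodule_hom) fg_submod_image:
  assumes "fg_submod R M (carrier M)" shows "fg_submod R N (f ` carrier M)"
proof -
  obtain A where A: "finite A" "A \<subseteq> carrier M" "gen_submod R M A = carrier M"
    using assms unfolding fg_submod_def by blast
  then show ?thesis
    unfolding fg_submod_def using image_gen[OF A(2)] by (intro exI[of _ "f ` A"]) auto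
qed

lemma (in rmodule) regular_hom:
  "x \<in> carrier M \<Longrightarrow> rmodule_hom R (regular_mod R) M (\<lambda>a. a \<odot>\<^bsub>M\<^esub> x)"
  using rmodule_axioms R.rmodule_regular
  by (auto simp: rmodule_hom_def rmodule_hom_axioms_def mod_hom_def smult_l_distr smult_assoc)

section \<open>Modules over a commutative Artinian ring\<close>

locale artinian_rmodule = rmodule k M + cring k
  for k :: "('k, 'c) ring_scheme" (structure) and M :: "('k, 'm) module" +
  assumes artinian: "artinian_ring k"
begin

text \<open>The traces on \<open>B\<close> of a chain in \<open>M\<close> become stationary. Letting
  \<open>B\<close> grow by one generator at a time inside the fixed module \<open>M\<close> replaces
  the usual induction through quotients.\<close>

definition stabilizes_on :: "'m set \<Rightarrow> bool" where
  "stabilizes_on B \<longleftrightarrow> (\<forall>H. (\<forall>n :: nat. submodule (H n) k M \<and> H (Suc n) \<subseteq> H n) \<longrightarrow>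
     (\<exists>m. \<forall>n\<ge>m. H m \<inter> B \<subseteq> H n))"

lemma regular_dcc: "dcc k (regular_mod k)"
  unfolding dcc_def using artinian ideal_if_submodule_regular unfolding artinian_ring_def by blast

text \<open>The coefficients \<open>c\<close> with \<open>c x\<close> in \<open>H n + B\<close> form
  a descending chain of ideals, which stops. For late indices an element \<open>b + c x\<close> of
  the chain then has \<open>c x = h + b'\<close> with \<open>h\<close> in the later member, and the
  remainder \<open>b + b'\<close> lies in \<open>B\<close>, where the chain is already
  stationary.\<close>

lemma stabilizes_on_adjoin:
  assumes st: "stabilizes_on B" and B: "submodule B k M" and x: "x \<in> carrier M"
  shows "stabilizes_on (set_add M B ((\<lambda>a. a \<odot>\<^bsub>M\<^esub> x) ` carrier k))"
  unfolding stabilizes_on_def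
proof (intro allI impI)
  fix H :: "nat \<Rightarrow> _" assume H: "\<forall>n. submodule (H n) k M \<and> H (Suc n) \<subseteq> H n"
  interpret x: rmodule_hom k "regular_mod k" M "\<lambda>a. a \<odot>\<^bsub>M\<^esub> x" by (rule regular_hom[OF x])
  define I where "I n = {c \<in> carrier (regular_mod k). c \<odot>\<^bsub>M\<^esub> x \<in> set_add M (H n) B}" for n
  have anti: "H n \<subseteq> H m" if "m \<le> n" for m n
    using lift_Suc_antimono_le[of H] H that by blast
  have "submodule (I n) k (regular_mod k)" for n
    unfolding I_def using H B by (intro x.submodule_preimage submodule_set_add) auto
  moreover have "I (Suc n) \<subseteq> I n" for n
    using H unfolding I_def set_add_iff by blast
  ultimately obtain m where m: "\<And>n. n \<ge> m \<Longrightarrow> I n = I m"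
    using regular_dcc unfolding dcc_def by metis
  obtain p where p: "\<And>n. n \<ge> p \<Longrightarrow> H p \<inter> B \<subseteq> H n"
    using st H unfolding stabilizes_on_def by metis
  show "\<exists>m. \<forall>n\<ge>m. H m \<inter> set_add M B ((\<lambda>a. a \<odot>\<^bsub>M\<^esub> x) ` carrier k) \<subseteq> H n"
  proof (intro exI[of _ "max m p"] allI impI subsetI)
    fix n y assume n: "max m p \<le> n" and "y \<in> H (max m p) \<inter> set_add M B ((\<lambda>a. a \<odot>\<^bsub>M\<^esub> x) ` carrier k)"
    then obtain b c where y: "y \<in> H (max m p)" "b \<in> B" "c \<in> carrier k" "y = b \<oplus>\<^bsub>M\<^esub> c \<odot>\<^bsub>M\<^esub> x"
      unfolding Int_iff set_add_iff by blast
    have [simp]: "b \<in> carrier M" using y(2) submoduleD(2)[OF B] by simp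
    note Hn = conjunct1[OF H[rule_format, of n]] and Hq = conjunct1[OF H[rule_format, of "max m p"]]
    have "c \<odot>\<^bsub>M\<^esub> x = (\<ominus>\<^bsub>M\<^esub> b) \<oplus>\<^bsub>M\<^esub> y" using y x by (simp add: M.r_neg1)
    also have "\<dots> = y \<oplus>\<^bsub>M\<^esub> \<ominus>\<^bsub>M\<^esub> b" using submoduleD(2)[OF Hq y(1)] by (simp add: M.a_comm)
    finally have "c \<in> I (max m p)"
      unfolding I_def set_add_iff using y submodule_uminus[OF B y(2)] by auto
    then have "c \<in> I n" using m[of n] m[of "max m p"] n by simp
    then obtain h b' where hb: "h \<in> H n" "b' \<in> B" "c \<odot>\<^bsub>M\<^esub> x = h \<oplus>\<^bsub>M\<^esub> b'"
      unfolding I_def set_add_iff by blast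
    have [simp]: "h \<in> carrier M" "b' \<in> carrier M"
      using hb submoduleD(2)[OF B] submoduleD(2)[OF Hn] by simp_all
    have y_eq: "y = h \<oplus>\<^bsub>M\<^esub> (b \<oplus>\<^bsub>M\<^esub> b')" using y(4) hb(3) by (simp add: M.a_ac)
    then have "b \<oplus>\<^bsub>M\<^esub> b' \<in> H (max m p)"
      using submodule_add_cancel[OF Hq, of h "b \<oplus>\<^bsub>M\<^esub> b'"] hb(1) anti[OF n] y(1) by auto
    then have "b \<oplus>\<^bsub>M\<^esub> b' \<in> H n"
      using p[of n] n anti[of p "max m p"] submoduleD(4)[OF B y(2) hb(2)] by auto
    then show "y \<in> H n" using y_eq submoduleD(4)[OF Hn hb(1)] by simp
  qed
qed

lemma stabilizes_on_gen:
  "finite A \<Longrightarrow> A \<subseteq> carrier M \<Longrightarrow> stabilizes_on (gen_submod k M A)"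
proof (induction A rule: finite_induct)
  case empty
  show ?case unfolding gen_empty stabilizes_on_def using submoduleD(3) by blast
next
  case (insert x A)
  then show ?case by (simp add: gen_insert stabilizes_on_adjoin submodule_gen)
qed

lemma fg_imp_dcc:
  assumes "fg_submod k M (carrier M)" shows "dcc k M"
  unfolding dcc_def
proof (intro allI impI)
  fix H :: "nat \<Rightarrow> _" assume H: "\<forall>n. submodule (H n) k M \<and> H (Suc n) \<subseteq> H n"
  have "stabilizes_on (carrier M)"
    using assms stabilizes_on_gen unfolding fg_submod_def by metis
  then obtain m where m: "\<forall>n\<ge>m. H m \<inter> carrier M \<subseteq> H n" using H unfolding stabilizes_on_def by blast
  have "H n \<subseteq> H m" if "m \<le> n" for m n
    using lift_Suc_antimono_le[of H] H that by blast
  then show "\<exists>m. \<forall>n\<ge>m. H n = H m"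
    using m H submoduleD(1) by (intro exI[of _ m]) blast
qed

text \<open>Commutativity of \<open>k\<close> makes multiplication by a scalar linear, so that its
  kernel and image are submodules.\<close>

lemma scalar_hom: "c \<in> carrier k \<Longrightarrow> rmodule_hom k M M (\<lambda>x. c \<odot>\<^bsub>M\<^esub> x)"
  using rmodule_axioms
  by (auto simp: rmodule_hom_def rmodule_hom_axioms_def mod_hom_def smult_r_distr
      smult_assoc[symmetric] m_comm)

text \<open>If \<open>M\<close> is minimal among the modules that are not finitely generated, every scalar acts on \<open>M\<close> as
  zero or surjectively (otherwise image and kernel are finitely generated), hence by the descending
  chain condition as zero or invertibly. So \<open>M\<close> is a vector space over a residue field of \<open>k\<close>, and a
  hyperplane shows that it is finitely generated.\<close>

lemma fg_if_proper_fg: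
  assumes proper: "\<And>H. submodule H k M \<Longrightarrow> H \<noteq> carrier M \<Longrightarrow> fg_submod k M H"
  shows "fg_submod k M (carrier M)"
proof (rule ccontr)
  assume nfg: "\<not> fg_submod k M (carrier M)"
  have surj: "(\<lambda>x. c \<odot>\<^bsub>M\<^esub> x) ` carrier M = carrier M"
    if c: "c \<in> carrier k" "y \<in> carrier M" "c \<odot>\<^bsub>M\<^esub> y \<noteq> \<zero>\<^bsub>M\<^esub>" for c y
  proof (rule ccontr)
    assume ns: "(\<lambda>x. c \<odot>\<^bsub>M\<^esub> x) ` carrier M \<noteq> carrier M"
    interpret c: rmodule_hom k M M "\<lambda>x. c \<odot>\<^bsub>M\<^esub> x" by (rule scalar_hom[OF c(1)])
    have "fg_submod k M {x \<in> carrier M. c \<odot>\<^bsub>M\<^esub> x = \<zero>\<^bsub>M\<^esub>}"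
      using c by (intro proper c.submodule_kernel) auto
    moreover have "fg_submod k M ((\<lambda>x. c \<odot>\<^bsub>M\<^esub> x) ` carrier M)"
      using ns by (intro proper c.submodule_image submodule_carrier)
    ultimately show False using c.fg_submod_if_image_kernel nfg by simp
  qed
  have inverse: "\<exists>s\<in>carrier k. \<forall>x\<in>carrier M. s \<odot>\<^bsub>M\<^esub> (c \<odot>\<^bsub>M\<^esub> x) = x"
    if c: "c \<in> carrier k" "y \<in> carrier M" "c \<odot>\<^bsub>M\<^esub> y \<noteq> \<zero>\<^bsub>M\<^esub>" for c y
  proof -
    interpret reg: rmodule k "regular_mod k" by (rule rmodule_regular)
    \<comment> \<open>The ideals generated by the powers of \<open>c\<close>. Once they stop,
      \<open>c^m = c^(m+1) a\<close> for some \<open>a\<close>. Multiplication by \<open>c\<close>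
      is onto, so every \<open>x\<close> is \<open>c^m z\<close>, and hence \<open>a\<close> undoes
      \<open>c\<close> on \<open>x\<close>.\<close>
    define I where "I n = (\<lambda>a. a \<odot>\<^bsub>regular_mod k\<^esub> (c [^] (n::nat))) ` carrier k" for n
    have pow: "c [^] n \<in> carrier (regular_mod k)" for n :: nat using c(1) by simp
    have "submodule (I n) k (regular_mod k)" for n
      unfolding I_def by (rule reg.submodule_cyclic[OF pow])
    moreover have "I (Suc n) \<subseteq> I n" for n
      unfolding I_def using c(1) by (auto simp: m_assoc intro!: image_eqI[of _ _ "c \<otimes> _"])
    ultimately obtain m where m: "\<And>n. n \<ge> m \<Longrightarrow> I n = I m"
      using regular_dcc unfolding dcc_def by metis
    have "c [^] m \<in> I m"
      unfolding I_def using c(1) by (intro image_eqI[of _ _ "\<one>"]) auto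
    then have "c [^] m \<in> I (Suc m)" using m[of "Suc m"] by simp
    then obtain a where a: "a \<in> carrier k" "c [^] m = c [^] Suc m \<otimes> a" unfolding I_def by auto
    have "\<exists>z\<in>carrier M. x = c [^] n \<odot>\<^bsub>M\<^esub> z" if "x \<in> carrier M" for x and n :: nat
    proof (induction n)
      case (Suc n)
      then obtain z where "z \<in> carrier M" "x = c [^] n \<odot>\<^bsub>M\<^esub> z" by blast
      moreover from this obtain w where "w \<in> carrier M" "z = c \<odot>\<^bsub>M\<^esub> w" using surj[OF c] by blast
      ultimately show ?case using c(1)
        by (intro bexI[of _ w]) (auto simp: smult_assoc[symmetric] m_comm)
    qed (use that in auto)
    then have "a \<odot>\<^bsub>M\<^esub> (c \<odot>\<^bsub>M\<^esub> x) = x" if x: "x \<in> carrier M" for x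
    proof -
      obtain z where z: "z \<in> carrier M" "x = c [^] m \<odot>\<^bsub>M\<^esub> z"
        using \<open>\<And>x n. x \<in> carrier M \<Longrightarrow> \<exists>z\<in>carrier M. x = c [^] n \<odot>\<^bsub>M\<^esub> z\<close> x by blast
      have "a \<odot>\<^bsub>M\<^esub> (c \<odot>\<^bsub>M\<^esub> x) = (c [^] Suc m \<otimes> a) \<odot>\<^bsub>M\<^esub> z"
        using c(1) a(1) z(1) by (simp add: z(2) smult_assoc[symmetric] m_ac)
      also have "\<dots> = x" by (simp only: a(2)[symmetric] z(2)[symmetric])
      finally show ?thesis .
    qed
    then show ?thesis using a(1) by blast
  qed
  have "carrier M \<noteq> {\<zero>\<^bsub>M\<^esub>}"
    using nfg gen_empty unfolding fg_submod_def by auto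
  then obtain h where h: "h \<in> carrier M" "h \<noteq> \<zero>\<^bsub>M\<^esub>" by blast
  \<comment> \<open>The hyperplane. For \<open>y\<close> outside \<open>G\<close>, maximality puts
    \<open>h\<close> into \<open>G + k y\<close>, say \<open>h = g + r y\<close>. Here
    \<open>r y\<close> is nonzero since \<open>h\<close> is not in \<open>G\<close>, so
    \<open>r\<close> is invertible on \<open>M\<close> and \<open>y\<close> lies in
    \<open>G + k h\<close>. Thus \<open>h\<close> and finitely many generators of the proper
    submodule \<open>G\<close> generate \<open>M\<close>.\<close>
  obtain G where G: "submodule G k M" "h \<notin> G" "\<And>H. submodule H k M \<Longrightarrow> G \<subset> H \<Longrightarrow> h \<in> H"
    using submodule_avoiding[OF submodule_singleton, of h] h by auto
  obtain A where A: "finite A" "A \<subseteq> carrier M" "gen_submod k M A = G"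
    using proper[OF G(1)] G(2) h unfolding fg_submod_def by blast
  note Gh = submodule_set_add[OF G(1) submodule_cyclic(1)[OF h(1)]]
  have "y \<in> set_add M G ((\<lambda>a. a \<odot>\<^bsub>M\<^esub> h) ` carrier k)" if y: "y \<in> carrier M" for y
  proof (cases "y \<in> G")
    case True
    then show ?thesis using set_add_upper1[OF G(1) submodule_cyclic(1)[OF h(1)]] by blast
  next
    case False
    note cy = submodule_cyclic[OF y]
    have "h \<in> set_add M G ((\<lambda>a. a \<odot>\<^bsub>M\<^esub> y) ` carrier k)"
      using set_add_upper1[OF G(1) cy(1)] set_add_upper2[OF G(1) cy(1)] cy(2) False
      by (intro G(3) submodule_set_add G(1) cy) auto
    then obtain g r where gr: "g \<in> G" "r \<in> carrier k" "h = g \<oplus>\<^bsub>M\<^esub> r \<odot>\<^bsub>M\<^esub> y" unfolding set_add_iff by blast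
    then have gM: "g \<in> carrier M" using submoduleD[OF G(1)] by blast
    then have "r \<odot>\<^bsub>M\<^esub> y \<noteq> \<zero>\<^bsub>M\<^esub>" using gr G(2) by auto
    then obtain s where s: "s \<in> carrier k" "s \<odot>\<^bsub>M\<^esub> (r \<odot>\<^bsub>M\<^esub> y) = y" using inverse gr(2) y by blast
    then have "s \<odot>\<^bsub>M\<^esub> h = s \<odot>\<^bsub>M\<^esub> g \<oplus>\<^bsub>M\<^esub> y" using gr gM y by (simp add: smult_r_distr)
    moreover have "s \<odot>\<^bsub>M\<^esub> h \<in> set_add M G ((\<lambda>a. a \<odot>\<^bsub>M\<^esub> h) ` carrier k)"
      using set_add_upper2[OF G(1) submodule_cyclic(1)[OF h(1)]] s(1) by blast
    moreover have "s \<odot>\<^bsub>M\<^esub> g \<in> set_add M G ((\<lambda>a. a \<odot>\<^bsub>M\<^esub> h) ` carrier k)"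
      using set_add_upper1[OF G(1) submodule_cyclic(1)[OF h(1)]] s(1) gr(1) submoduleD(5)[OF G(1)] by blast
    ultimately show ?thesis using submodule_add_cancel[OF Gh] y by metis
  qed
  then have "gen_submod k M (insert h A) = carrier M"
    using submoduleD(1)[OF Gh] A h by (auto simp: gen_insert)
  then show False using nfg A h unfolding fg_submod_def by (metis finite_insert insert_subset)
qed

text \<open>In a minimal submodule that is not finitely generated all proper submodules are finitely
  generated, which makes it finitely generated after all.\<close>

lemma dcc_imp_fg:
  assumes "dcc k M" "submodule H k M" shows "fg_submod k M H"
proof (rule ccontr)
  assume "\<not> fg_submod k M H"
  then obtain K where K: "submodule K k M" "\<not> fg_submod k M K"
      "\<And>L. submodule L k M \<Longrightarrow> \<not> fg_submod k M L \<Longrightarrow> L \<subseteq> K \<Longrightarrow> L = K"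
    using dcc_minimal[OF assms, of "\<lambda>K. \<not> fg_submod k M K"] by blast
  interpret K: rmodule k "restrict_mod M K" by (rule rmodule_restrict[OF K(1)])
  interpret K: artinian_rmodule k "restrict_mod M K" by unfold_locales (rule artinian)
  have restr: "fg_submod k (restrict_mod M K) L \<longleftrightarrow> fg_submod k M L"
    if "submodule L k M" "L \<subseteq> K" for L
    using K.fg_module_restrict_iff[of L] fg_module_restrict_iff[OF that(1)] submodule_restrict[OF K(1)] that
    by simp
  have "fg_submod k (restrict_mod M K) (carrier (restrict_mod M K))"
  proof (rule K.fg_if_proper_fg)
    fix L assume "submodule L k (restrict_mod M K)" "L \<noteq> carrier (restrict_mod M K)"
    then show "fg_submod k (restrict_mod M K) L"
      using K(3)[of L] restr[of L] submodule_restrict[OF K(1)] by auto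
  qed
  then show False using K(1,2) restr[of K] by simp
qed

end

section \<open>Transfer from the base ring to the algebra along the structure map\<close>

definition restrict_scalars :: "('k \<Rightarrow> 'a) \<Rightarrow> ('a, 'm) module \<Rightarrow> ('k, 'm) module" where
  "restrict_scalars \<phi> M = \<lparr>carrier = carrier M, mult = undefined, one = undefined, zero = \<zero>\<^bsub>M\<^esub>,
     add = add M, smult = (\<lambda>c x. \<phi> c \<odot>\<^bsub>M\<^esub> x)\<rparr>"

lemma restrict_scalars_simps [simp]:
  "carrier (restrict_scalars \<phi> M) = carrier M" "\<zero>\<^bsub>restrict_scalars \<phi> M\<^esub> = \<zero>\<^bsub>M\<^esub>"
  "x \<oplus>\<^bsub>restrict_scalars \<phi> M\<^esub> y = x \<oplus>\<^bsub>M\<^esub> y" "c \<odot>\<^bsub>restrict_scalars \<phi> M\<^esub> x = \<phi> c \<odot>\<^bsub>M\<^esub> x"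
  by (simp_all add: restrict_scalars_def)

locale artin_alg =
  fixes k :: "('k, 'c) ring_scheme" and \<phi> :: "'k \<Rightarrow> 'a" and R :: "('a, 'b) ring_scheme"
  assumes artin_algebra: "artin_algebra k \<phi> R"
begin

sublocale k: cring k
  using artin_algebra by (simp add: artin_algebra_def)
sublocale R: ring R
  using artin_algebra by (simp add: artin_algebra_def)

lemma \<phi>_simps [simp]:
  "c \<in> carrier k \<Longrightarrow> \<phi> c \<in> carrier R"
  "c \<in> carrier k \<Longrightarrow> d \<in> carrier k \<Longrightarrow> \<phi> (c \<oplus>\<^bsub>k\<^esub> d) = \<phi> c \<oplus>\<^bsub>R\<^esub> \<phi> d"
  "c \<in> carrier k \<Longrightarrow> d \<in> carrier k \<Longrightarrow> \<phi> (c \<otimes>\<^bsub>k\<^esub> d) = \<phi> c \<otimes>\<^bsub>R\<^esub> \<phi> d"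
  "\<phi> \<one>\<^bsub>k\<^esub> = \<one>\<^bsub>R\<^esub>"
  using artin_algebra unfolding artin_algebra_def ring_hom_def by auto

lemma artinian_ring: "artinian_ring k"
  using artin_algebra by (simp add: artin_algebra_def)

lemma \<phi>_central: "c \<in> carrier k \<Longrightarrow> x \<in> carrier R \<Longrightarrow> \<phi> c \<otimes>\<^bsub>R\<^esub> x = x \<otimes>\<^bsub>R\<^esub> \<phi> c"
  using artin_algebra unfolding artin_algebra_def by auto

lemma artinian_restrict_scalars:
  assumes "rmodule R M" shows "artinian_rmodule k (restrict_scalars \<phi> M)"
proof -
  interpret rmodule R M by fact
  have "abelian_group (restrict_scalars \<phi> M)"
    by (rule abelian_groupI) (auto simp: M.a_ac intro: M.l_neg bexI[of _ "\<ominus>\<^bsub>M\<^esub> _"])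
  then show ?thesis
    unfolding artinian_rmodule_def artinian_rmodule_axioms_def rmodule_def right_module_def right_module_axioms_def
    using k.cring_axioms k.ring_axioms artinian_ring
    by (auto simp: smult_l_distr smult_r_distr smult_assoc)
qed

lemma submodule_restrict_scalars:
  assumes "rmodule R M" "submodule H R M" shows "submodule H k (restrict_scalars \<phi> M)"
proof -
  interpret rmodule R M by fact
  interpret s: artinian_rmodule k "restrict_scalars \<phi> M" by (rule artinian_restrict_scalars[OF assms(1)])
  show ?thesis using submoduleD[OF assms(2)] by (simp add: s.submodule_iff)
qed

text \<open>The products of generators of \<open>M\<close> over \<open>R\<close> with generators of
  \<open>R\<close> over \<open>k\<close> span \<open>M\<close> over \<open>k\<close>. Their span
  \<open>G\<close> contains \<open>x r\<close> for each generator \<open>x\<close> and each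
  \<open>r\<close> in \<open>R\<close>. The elements \<open>y\<close> with \<open>y r\<close> in
  \<open>G\<close> for all \<open>r\<close> form a \<open>k\<close>-submodule, because
  \<open>\<phi>\<close> is central, and contain the products; so \<open>G\<close> is closed under
  \<open>R\<close>.\<close>

lemma fg_restrict_scalars:
  assumes "rmodule R M" "fg_submod R M (carrier M)"
  shows "fg_submod k (restrict_scalars \<phi> M) (carrier M)"
proof -
  interpret M: rmodule R M by fact
  interpret s: artinian_rmodule k "restrict_scalars \<phi> M" by (rule artinian_restrict_scalars[OF assms(1)])
  interpret Rk: artinian_rmodule k "restrict_scalars \<phi> (regular_mod R)"
    by (rule artinian_restrict_scalars[OF R.rmodule_regular])
  obtain A where A: "finite A" "A \<subseteq> carrier M" "gen_submod R M A = carrier M"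
    using assms(2) unfolding fg_submod_def by blast
  \<comment> \<open>The fields are filled in such a way that this record is literally the
    \<open>k\<close>-module occurring in \<open>artin_algebra\<close>.\<close>
  have "fg_module k (restrict_scalars \<phi> (regular_mod R))"
    using artin_algebra unfolding artin_algebra_def restrict_scalars_def regular_mod_def by simp
  then obtain B where B: "finite B" "B \<subseteq> carrier R"
    "gen_submod k (restrict_scalars \<phi> (regular_mod R)) B = carrier R"
    unfolding fg_module_def by auto
  define C where "C = (\<lambda>(b, x). b \<odot>\<^bsub>M\<^esub> x) ` (B \<times> A)"
  define G where "G = gen_submod k (restrict_scalars \<phi> M) C"
  have C: "finite C" "C \<subseteq> carrier M" unfolding C_def using A B by (auto intro!: M.smult_closed)
  have G: "submodule G k (restrict_scalars \<phi> M)"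
    unfolding G_def using C by (intro s.submodule_gen) auto
  note GD = s.submoduleD[OF G, simplified]
  have rx: "r \<odot>\<^bsub>M\<^esub> x \<in> G" if "x \<in> A" "r \<in> carrier R" for x r
  proof -
    have xM: "x \<in> carrier M" using that A by auto
    have "submodule {r \<in> carrier R. r \<odot>\<^bsub>M\<^esub> x \<in> G} k (restrict_scalars \<phi> (regular_mod R))"
      using xM GD by (auto simp: Rk.submodule_iff M.smult_l_distr M.smult_assoc)
    moreover have "B \<subseteq> {r \<in> carrier R. r \<odot>\<^bsub>M\<^esub> x \<in> G}"
      using B(2) s.gen_upper[of C] that(1) unfolding G_def C_def by auto
    ultimately show ?thesis using B(3) Rk.gen_least that(2) by blast
  qed
  have "submodule {y \<in> carrier M. \<forall>r\<in>carrier R. r \<odot>\<^bsub>M\<^esub> y \<in> G} k (restrict_scalars \<phi> M)"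
    using GD by (auto simp: s.submodule_iff M.smult_r_distr M.smult_assoc[symmetric] \<phi>_central)
  moreover have "C \<subseteq> {y \<in> carrier M. \<forall>r\<in>carrier R. r \<odot>\<^bsub>M\<^esub> y \<in> G}"
  proof
    fix y assume "y \<in> C"
    then obtain b x where y: "y = b \<odot>\<^bsub>M\<^esub> x" "b \<in> carrier R" "x \<in> A" "x \<in> carrier M"
      using A(2) B(2) unfolding C_def by auto
    then show "y \<in> {y \<in> carrier M. \<forall>r\<in>carrier R. r \<odot>\<^bsub>M\<^esub> y \<in> G}"
      using rx by (auto simp: M.smult_assoc[symmetric])
  qed
  ultimately have "G \<subseteq> {y \<in> carrier M. \<forall>r\<in>carrier R. r \<odot>\<^bsub>M\<^esub> y \<in> G}"
    unfolding G_def using s.gen_least by blast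
  then have "submodule G R M"
    using GD by (auto simp: M.submodule_iff)
  moreover have "A \<subseteq> G"
  proof
    fix x assume x: "x \<in> A"
    then have "x \<in> carrier M" using A by auto
    then show "x \<in> G" using rx[OF x, of "\<one>\<^bsub>R\<^esub>"] by simp
  qed
  ultimately have "G = carrier M"
    using A(3) M.gen_least GD(1) by blast
  then show ?thesis
    unfolding fg_submod_def using C G_def by auto
qed

text \<open>Every \<open>R\<close>-submodule is a \<open>k\<close>-submodule, so chains of the
  former stop, and generators over \<open>k\<close> of an \<open>R\<close>-submodule also generate
  it over \<open>R\<close>.\<close>

lemma
  assumes "fg_module R M"
  shows fg_dcc: "dcc R M" and fg_submodule: "submodule H R M \<Longrightarrow> fg_submod R M H"
proof -
  interpret M: rmodule R M using assms by (simp add: rmodule_def fg_module_def)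
  interpret s: artinian_rmodule k "restrict_scalars \<phi> M"
    by (rule artinian_restrict_scalars[OF M.rmodule_axioms])
  note sub = submodule_restrict_scalars[OF M.rmodule_axioms]
  have "fg_submod R M (carrier M)" using assms by (simp add: M.fg_module_iff)
  from s.fg_imp_dcc fg_restrict_scalars[OF M.rmodule_axioms this]
  have dcc: "dcc k (restrict_scalars \<phi> M)" by simp
  then show "dcc R M" unfolding dcc_def using sub by blast
  assume H: "submodule H R M"
  obtain A where A: "finite A" "A \<subseteq> carrier M" "gen_submod k (restrict_scalars \<phi> M) A = H"
    using s.dcc_imp_fg[OF dcc sub[OF H]] unfolding fg_submod_def by auto
  have "gen_submod R M A = H"
  proof
    show "gen_submod R M A \<subseteq> H" using s.gen_upper[of A] A(3) by (intro M.gen_least H) simp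
    show "H \<subseteq> gen_submod R M A"
      using s.gen_least[OF sub[OF M.submodule_gen[OF A(2)]] M.gen_upper] A(3) by simp
  qed
  then show "fg_submod R M H" unfolding fg_submod_def using A by blast
qed

lemma fg_restrict: "fg_module R M \<Longrightarrow> submodule H R M \<Longrightarrow> fg_module R (restrict_mod M H)"
  using rmodule.fg_module_restrict_iff[of R M H] fg_submodule[of M H]
  by (simp add: fg_module_def rmodule_def)

end

section \<open>Quotients and the radical\<close>

lemma rmodule_fg: "fg_module R M \<Longrightarrow> rmodule R M"
  by (simp add: fg_module_def rmodule_def)

lemma rmodule_homI:
  "rmodule R M \<Longrightarrow> rmodule R N \<Longrightarrow> f \<in> mod_hom R M N \<Longrightarrow> rmodule_hom R M N f"
  by (simp add: rmodule_hom_def rmodule_hom_axioms_def)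

lemma mod_hom_restrict:
  "f \<in> mod_hom R M N \<Longrightarrow> H \<subseteq> carrier M \<Longrightarrow> f ` H \<subseteq> K \<Longrightarrow>
    f \<in> mod_hom R (restrict_mod M H) (restrict_mod N K)"
  unfolding mod_hom_def by (auto simp: subset_iff)

lemma mod_hom_restrict_left:
  "f \<in> mod_hom R M N \<Longrightarrow> H \<subseteq> carrier M \<Longrightarrow> f \<in> mod_hom R (restrict_mod M H) N"
  unfolding mod_hom_def by (auto simp: subset_iff)

lemma mod_hom_compose:
  "f \<in> mod_hom R M N \<Longrightarrow> g \<in> mod_hom R N P \<Longrightarrow> (\<lambda>x. g (f x)) \<in> mod_hom R M P"
  unfolding mod_hom_def by (auto simp: Pi_iff)

lemma mod_hom_id: "(\<lambda>x. x) \<in> mod_hom R M M"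
  unfolding mod_hom_def by auto

lemma mod_hom_inv:
  assumes "rmodule R M" "f \<in> mod_hom R M N" "bij_betw f (carrier M) (carrier N)"
  shows "inv_into (carrier M) f \<in> mod_hom R N M"
proof -
  interpret rmodule R M by fact
  have f: "\<And>x y. x \<in> carrier M \<Longrightarrow> y \<in> carrier M \<Longrightarrow> f (x \<oplus>\<^bsub>M\<^esub> y) = f x \<oplus>\<^bsub>N\<^esub> f y"
    "\<And>a x. a \<in> carrier R \<Longrightarrow> x \<in> carrier M \<Longrightarrow> f (a \<odot>\<^bsub>M\<^esub> x) = a \<odot>\<^bsub>N\<^esub> f x"
    using assms(2) unfolding mod_hom_def by auto
  have inv: "inv_into (carrier M) f (f x) = x" if "x \<in> carrier M" for x
    using assms(3) that by (simp add: bij_betw_inv_into_left)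
  have N: "carrier N = f ` carrier M" using assms(3) by (simp add: bij_betw_def)
  show ?thesis
    unfolding mod_hom_def N by (auto simp: inv f[symmetric])
qed

lemma mod_iso_sym: "rmodule R M \<Longrightarrow> mod_iso R M N \<Longrightarrow> mod_iso R N M"
  unfolding mod_iso_def using mod_hom_inv[of R M _ N] bij_betw_inv_into by metis

lemma quot_mod_simps [simp]:
  "\<zero>\<^bsub>quot_mod M H\<^esub> = H" "X \<oplus>\<^bsub>quot_mod M H\<^esub> Y = set_add M X Y"
  "a \<odot>\<^bsub>quot_mod M H\<^esub> X = set_add M H ((\<lambda>x. a \<odot>\<^bsub>M\<^esub> x) ` X)"
  by (simp_all add: quot_mod_def)

lemma quot_mod_carrier: "carrier (quot_mod M H) = (\<lambda>x. H +>\<^bsub>M\<^esub> x) ` carrier M"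
  by (auto simp: quot_mod_def A_RCOSETS_def')

lemma r_coset_iff: "y \<in> H +>\<^bsub>M\<^esub> x \<longleftrightarrow> (\<exists>h\<in>H. y = h \<oplus>\<^bsub>M\<^esub> x)"
  by (auto simp: a_r_coset_def')

context rmodule
begin

lemma r_coset_eq_iff:
  assumes "submodule H R M" "x \<in> carrier M" "y \<in> carrier M"
  shows "H +>\<^bsub>M\<^esub> x = H +>\<^bsub>M\<^esub> y \<longleftrightarrow> x \<ominus>\<^bsub>M\<^esub> y \<in> H"
proof
  note H = submoduleD[OF assms(1)]
  have "x \<in> H +>\<^bsub>M\<^esub> x" unfolding r_coset_iff using H(3) assms(2) by (intro bexI[of _ "\<zero>\<^bsub>M\<^esub>"]) auto
  moreover assume "H +>\<^bsub>M\<^esub> x = H +>\<^bsub>M\<^esub> y"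
  ultimately have "x \<in> H +>\<^bsub>M\<^esub> y" by simp
  then obtain h where h: "h \<in> H" "x = h \<oplus>\<^bsub>M\<^esub> y" unfolding r_coset_iff by blast
  then have "x \<ominus>\<^bsub>M\<^esub> y = h" using H(2) assms(3) by simp
  then show "x \<ominus>\<^bsub>M\<^esub> y \<in> H" using h(1) by simp
next
  note H = submoduleD[OF assms(1)]
  assume d: "x \<ominus>\<^bsub>M\<^esub> y \<in> H"
  have sub: "H +>\<^bsub>M\<^esub> x \<subseteq> H +>\<^bsub>M\<^esub> y" if d: "x \<ominus>\<^bsub>M\<^esub> y \<in> H" and xy: "x \<in> carrier M" "y \<in> carrier M" for x y
  proof
    fix z assume "z \<in> H +>\<^bsub>M\<^esub> x"
    then obtain h where h: "h \<in> H" "z = h \<oplus>\<^bsub>M\<^esub> x" unfolding r_coset_iff by blast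
    have "z = (h \<oplus>\<^bsub>M\<^esub> (x \<ominus>\<^bsub>M\<^esub> y)) \<oplus>\<^bsub>M\<^esub> y" using h H(2) xy by (simp add: M.a_assoc)
    then show "z \<in> H +>\<^bsub>M\<^esub> y" unfolding r_coset_iff using H(4)[OF h(1) d] by blast
  qed
  have "\<ominus>\<^bsub>M\<^esub> (x \<ominus>\<^bsub>M\<^esub> y) = y \<ominus>\<^bsub>M\<^esub> x"
    using assms by (simp add: a_minus_def M.minus_add M.a_comm)
  then have "y \<ominus>\<^bsub>M\<^esub> x \<in> H" using submodule_uminus[OF assms(1) d] by simp
  then show "H +>\<^bsub>M\<^esub> x = H +>\<^bsub>M\<^esub> y" using sub d assms by blast
qed

lemma r_coset_zero_iff:
  assumes "submodule H R M" "x \<in> carrier M"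
  shows "H +>\<^bsub>M\<^esub> x = H \<longleftrightarrow> x \<in> H"
proof -
  have "H +>\<^bsub>M\<^esub> \<zero>\<^bsub>M\<^esub> = H" using submoduleD(2)[OF assms(1)] by (auto simp: r_coset_iff)
  then show ?thesis using r_coset_eq_iff[OF assms(1,2), of "\<zero>\<^bsub>M\<^esub>"] assms(2)
      add_minus_cancel(2)[of "\<zero>\<^bsub>M\<^esub>" x] by simp
qed

lemma r_coset_add:
  assumes "submodule H R M" "x \<in> carrier M" "y \<in> carrier M"
  shows "set_add M (H +>\<^bsub>M\<^esub> x) (H +>\<^bsub>M\<^esub> y) = H +>\<^bsub>M\<^esub> (x \<oplus>\<^bsub>M\<^esub> y)"
proof (intro equalityI subsetI)
  note H = submoduleD[OF assms(1)]
  fix z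
  { assume "z \<in> set_add M (H +>\<^bsub>M\<^esub> x) (H +>\<^bsub>M\<^esub> y)"
    then obtain h h' where "h \<in> H" "h' \<in> H" "z = (h \<oplus>\<^bsub>M\<^esub> x) \<oplus>\<^bsub>M\<^esub> (h' \<oplus>\<^bsub>M\<^esub> y)"
      unfolding set_add_iff Bex_def r_coset_iff by blast
    then show "z \<in> H +>\<^bsub>M\<^esub> (x \<oplus>\<^bsub>M\<^esub> y)"
      unfolding r_coset_iff using H assms by (intro bexI[of _ "h \<oplus>\<^bsub>M\<^esub> h'"]) (auto simp: M.a_ac) }
  { assume "z \<in> H +>\<^bsub>M\<^esub> (x \<oplus>\<^bsub>M\<^esub> y)"
    then obtain h where "h \<in> H" "z = (h \<oplus>\<^bsub>M\<^esub> x) \<oplus>\<^bsub>M\<^esub> (\<zero>\<^bsub>M\<^esub> \<oplus>\<^bsub>M\<^esub> y)"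
      unfolding r_coset_iff using H(2) assms by (auto simp: M.a_assoc)
    then show "z \<in> set_add M (H +>\<^bsub>M\<^esub> x) (H +>\<^bsub>M\<^esub> y)"
      unfolding set_add_iff Bex_def r_coset_iff using H(3) by blast }
qed

lemma r_coset_smult:
  assumes "submodule H R M" "x \<in> carrier M" "a \<in> carrier R"
  shows "set_add M H ((\<lambda>x. a \<odot>\<^bsub>M\<^esub> x) ` (H +>\<^bsub>M\<^esub> x)) = H +>\<^bsub>M\<^esub> (a \<odot>\<^bsub>M\<^esub> x)"
proof (intro equalityI subsetI)
  note H = submoduleD[OF assms(1)]
  fix z
  { assume "z \<in> set_add M H ((\<lambda>x. a \<odot>\<^bsub>M\<^esub> x) ` (H +>\<^bsub>M\<^esub> x))"
    then obtain h h' where *: "h \<in> H" "h' \<in> H" "z = h \<oplus>\<^bsub>M\<^esub> (a \<odot>\<^bsub>M\<^esub> (h' \<oplus>\<^bsub>M\<^esub> x))"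
      unfolding set_add_iff Bex_def image_iff r_coset_iff by blast
    then have "z = (h \<oplus>\<^bsub>M\<^esub> a \<odot>\<^bsub>M\<^esub> h') \<oplus>\<^bsub>M\<^esub> a \<odot>\<^bsub>M\<^esub> x"
      using H(2) assms by (simp add: smult_r_distr M.a_assoc)
    then show "z \<in> H +>\<^bsub>M\<^esub> (a \<odot>\<^bsub>M\<^esub> x)"
      unfolding r_coset_iff using * H(4,5) assms(3) by blast }
  { assume "z \<in> H +>\<^bsub>M\<^esub> (a \<odot>\<^bsub>M\<^esub> x)"
    then obtain h where "h \<in> H" "z = h \<oplus>\<^bsub>M\<^esub> (a \<odot>\<^bsub>M\<^esub> (\<zero>\<^bsub>M\<^esub> \<oplus>\<^bsub>M\<^esub> x))"
      unfolding r_coset_iff using assms by auto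
    then show "z \<in> set_add M H ((\<lambda>x. a \<odot>\<^bsub>M\<^esub> x) ` (H +>\<^bsub>M\<^esub> x))"
      unfolding set_add_iff Bex_def image_iff r_coset_iff using H(3) by blast }
qed

lemma quot_proj_hom: "submodule H R M \<Longrightarrow> (\<lambda>x. H +>\<^bsub>M\<^esub> x) \<in> mod_hom R M (quot_mod M H)"
  unfolding mod_hom_def by (auto simp: quot_mod_carrier r_coset_add r_coset_smult)

lemma rmodule_quot:
  assumes H: "submodule H R M" shows "rmodule R (quot_mod M H)"
proof -
  note [simp] = r_coset_add[OF H] r_coset_smult[OF H]
  have zero: "H = H +>\<^bsub>M\<^esub> \<zero>\<^bsub>M\<^esub>" using r_coset_zero_iff[OF H, of "\<zero>\<^bsub>M\<^esub>"] submoduleD(3)[OF H] by simp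
  have "abelian_group (quot_mod M H)"
  proof (rule abelian_groupI)
    show "\<zero>\<^bsub>quot_mod M H\<^esub> \<in> carrier (quot_mod M H)"
      using zero by (auto simp: quot_mod_carrier)
    fix X assume "X \<in> carrier (quot_mod M H)"
    then obtain x where x: "x \<in> carrier M" "X = H +>\<^bsub>M\<^esub> x" by (auto simp: quot_mod_carrier)
    then show "\<zero>\<^bsub>quot_mod M H\<^esub> \<oplus>\<^bsub>quot_mod M H\<^esub> X = X"
      using r_coset_add[OF H, of "\<zero>\<^bsub>M\<^esub>" x] zero by simp
    show "\<exists>Y\<in>carrier (quot_mod M H). Y \<oplus>\<^bsub>quot_mod M H\<^esub> X = \<zero>\<^bsub>quot_mod M H\<^esub>"
      using x zero by (intro bexI[of _ "H +>\<^bsub>M\<^esub> (\<ominus>\<^bsub>M\<^esub> x)"]) (auto simp: quot_mod_carrier M.l_neg)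
  qed (auto simp: quot_mod_carrier M.a_ac)
  then show ?thesis
    unfolding rmodule_def right_module_def right_module_axioms_def using R.ring_axioms
    by (auto simp: quot_mod_carrier smult_l_distr smult_r_distr smult_assoc)
qed

lemma fg_quot: "fg_module R M \<Longrightarrow> submodule H R M \<Longrightarrow> fg_module R (quot_mod M H)"
proof -
  assume fg: "fg_module R M" and H: "submodule H R M"
  interpret Q: rmodule R "quot_mod M H" by (rule rmodule_quot[OF H])
  interpret p: rmodule_hom R M "quot_mod M H" "\<lambda>x. H +>\<^bsub>M\<^esub> x"
    by (intro rmodule_homI rmodule_axioms Q.rmodule_axioms quot_proj_hom H)
  show ?thesis using fg p.fg_submod_image by (simp add: fg_module_iff Q.fg_module_iff quot_mod_carrier)
qed

text \<open>Replaces a factor given by cosets with a map on \<open>M\<close> itself; filtration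
  factors are used only through such maps.\<close>

lemma iso_quot_hom:
  assumes H: "submodule H R M" and T: "mod_iso R (quot_mod M H) T" "rmodule R T"
  obtains q where "q \<in> mod_hom R M T" "q ` carrier M = carrier T" "{x \<in> carrier M. q x = \<zero>\<^bsub>T\<^esub>} = H"
proof -
  obtain e where e: "e \<in> mod_hom R (quot_mod M H) T" "bij_betw e (carrier (quot_mod M H)) (carrier T)"
    using T(1) unfolding mod_iso_def by blast
  interpret e: rmodule_hom R "quot_mod M H" T e
    by (intro rmodule_homI rmodule_quot T H e)
  have "e (H +>\<^bsub>M\<^esub> x) = \<zero>\<^bsub>T\<^esub> \<longleftrightarrow> x \<in> H" if x: "x \<in> carrier M" for x
  proof -
    have "e (H +>\<^bsub>M\<^esub> x) = \<zero>\<^bsub>T\<^esub> \<longleftrightarrow> H +>\<^bsub>M\<^esub> x = H"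
      using e.inj_iff_kernel e(2) x e.f_zero by (auto simp: bij_betw_def quot_mod_carrier)
    then show ?thesis using r_coset_zero_iff[OF H x] by simp
  qed
  then show thesis
    using mod_hom_compose[OF quot_proj_hom[OF H] e(1)] e(2) submoduleD(2)[OF H]
    by (intro that[of "\<lambda>x. e (H +>\<^bsub>M\<^esub> x)"]) (auto simp: bij_betw_def quot_mod_carrier image_image)
qed

section \<open>The radical and maximal submodules\<close>

lemma rad_eq: "rad R M = restrict_mod M (carrier (rad R M))"
  by (simp add: rad_def)

lemma mem_rad: "x \<in> carrier (rad R M) \<longleftrightarrow> x \<in> carrier M \<and> (\<forall>K. maximal_submod R M K \<longrightarrow> x \<in> K)"
  by (simp add: rad_def)

lemma submodule_rad: "submodule (carrier (rad R M)) R M"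
  using submodule_Inter[of "{K. maximal_submod R M K}"] by (simp add: rad_def maximal_submod_def)

lemma maximal_adjoin:
  assumes K: "maximal_submod R M K" and x: "x \<in> carrier M" "x \<notin> K" and y: "y \<in> carrier M"
  obtains u a where "u \<in> K" "a \<in> carrier R" "y = u \<oplus>\<^bsub>M\<^esub> a \<odot>\<^bsub>M\<^esub> x"
proof -
  have K': "submodule K R M" using K by (simp add: maximal_submod_def)
  note c = submodule_cyclic[OF x(1)]
  have "set_add M K ((\<lambda>a. a \<odot>\<^bsub>M\<^esub> x) ` carrier R) = carrier M"
    using K submodule_set_add[OF K' c(1)] set_add_upper1[OF K' c(1)] set_add_upper2[OF K' c(1)] c(2) x(2)
    unfolding maximal_submod_def by blast
  then show thesis using y that unfolding set_add_iff set_eq_iff by blast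
qed

text \<open>\<open>D\<close> is minimal among the submodules whose sum with \<open>W\<close> is
  \<open>M\<close>. If \<open>x\<close> in \<open>D \<inter> W\<close> missed a maximal submodule
  \<open>K\<close>, each \<open>d\<close> in \<open>D\<close> would be \<open>u + x a\<close> with
  \<open>u\<close> in \<open>D \<inter> K\<close> and \<open>x a\<close> in \<open>W\<close>. So
  \<open>D \<inter> K\<close> would already supplement \<open>W\<close>, and minimality would put
  \<open>x\<close> into \<open>K\<close>.\<close>

lemma supplement:
  assumes "dcc R M" and W: "submodule W R M"
  obtains D where "submodule D R M" "set_add M D W = carrier M" "D \<inter> W \<subseteq> carrier (rad R M)"
proof -
  have "set_add M (carrier M) W = carrier M"
    using set_add_least[OF submodule_carrier, of "carrier M" W] set_add_upper1[OF submodule_carrier W]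
      submoduleD(1)[OF W] by blast
  then obtain D where D: "submodule D R M" "set_add M D W = carrier M"
    "\<And>L. submodule L R M \<Longrightarrow> set_add M L W = carrier M \<Longrightarrow> L \<subseteq> D \<Longrightarrow> L = D"
    using dcc_minimal[OF assms(1) submodule_carrier, of "\<lambda>D. set_add M D W = carrier M"] by auto
  have "x \<in> K" if x: "x \<in> D" "x \<in> W" and K: "maximal_submod R M K" for x K
  proof (rule ccontr)
    assume "x \<notin> K"
    have K': "submodule K R M" using K by (simp add: maximal_submod_def)
    have xM: "x \<in> carrier M" using x submoduleD(2)[OF W] by blast
    have "y \<in> set_add M (D \<inter> K) W" if y: "y \<in> carrier M" for y
    proof -
      obtain d w where dw: "d \<in> D" "w \<in> W" "y = d \<oplus>\<^bsub>M\<^esub> w" using y D(2) unfolding set_add_iff set_eq_iff by blast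
      have dM: "d \<in> carrier M" "w \<in> carrier M" using dw submoduleD(2)[OF D(1)] submoduleD(2)[OF W] by auto
      obtain u a where u: "u \<in> K" "a \<in> carrier R" "d = u \<oplus>\<^bsub>M\<^esub> a \<odot>\<^bsub>M\<^esub> x"
        using maximal_adjoin[OF K xM \<open>x \<notin> K\<close> dM(1)] by blast
      have uM: "u \<in> carrier M" using u submoduleD(2)[OF K'] by blast
      have "u \<in> D" using submodule_add_cancel'[OF D(1), of "a \<odot>\<^bsub>M\<^esub> x" u] submoduleD(5)[OF D(1)] x u dw uM by simp
      moreover have "y = u \<oplus>\<^bsub>M\<^esub> (a \<odot>\<^bsub>M\<^esub> x \<oplus>\<^bsub>M\<^esub> w)" using dw u uM dM xM by (simp add: M.a_assoc)
      moreover have "a \<odot>\<^bsub>M\<^esub> x \<oplus>\<^bsub>M\<^esub> w \<in> W" using submoduleD(4,5)[OF W] u x dw by simp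
      ultimately show ?thesis unfolding set_add_iff using u(1) by blast
    qed
    then have "set_add M (D \<inter> K) W = carrier M"
      using submoduleD(1)[OF submodule_set_add[OF submodule_Int[OF D(1) K'] W]] by blast
    then have "D \<inter> K = D" using D(3)[of "D \<inter> K"] submodule_Int[OF D(1) K'] by blast
    then show False using x \<open>x \<notin> K\<close> by blast
  qed
  then have "D \<inter> W \<subseteq> carrier (rad R M)" using submoduleD(2)[OF W] by (auto simp: mem_rad)
  with D show thesis using that by blast
qed

text \<open>This is semisimplicity of M/rad(M) without quotients. With a supplement \<open>D\<close>
  of \<open>W\<close> write \<open>y = d + w\<close>; some maximal \<open>K\<close> misses
  \<open>d\<close>, and \<open>G = W + (D \<inter> K)\<close> is the submodule wanted. It misses
  \<open>d\<close> because \<open>D \<inter> W\<close> lies in the radical, hence in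
  \<open>K\<close>.\<close>

lemma maximal_separating:
  assumes dcc: "dcc R M" and W: "submodule W R M" "carrier (rad R M) \<subseteq> W"
    and y: "y \<in> carrier M" "y \<notin> W"
  obtains G where "maximal_submod R M G" "W \<subseteq> G" "y \<notin> G"
proof -
  obtain D where D: "submodule D R M" "set_add M D W = carrier M" "D \<inter> W \<subseteq> carrier (rad R M)"
    using supplement[OF dcc W(1)] by blast
  have split: "\<exists>d w. d \<in> D \<and> w \<in> W \<and> d \<in> carrier M \<and> w \<in> carrier M \<and> z = d \<oplus>\<^bsub>M\<^esub> w" if "z \<in> carrier M" for z
    using that D(2) submoduleD(2)[OF D(1)] submoduleD(2)[OF W(1)] unfolding set_add_iff set_eq_iff by blast
  obtain d w where d: "d \<in> D" "w \<in> W" "d \<in> carrier M" "w \<in> carrier M" "y = d \<oplus>\<^bsub>M\<^esub> w"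
    using split[OF y(1)] by blast
  have "d \<notin> W" using y d submoduleD(4)[OF W(1)] by blast
  then have "d \<notin> carrier (rad R M)" using W(2) by blast
  then obtain K where K: "maximal_submod R M K" "d \<notin> K" using d(3) by (auto simp: mem_rad)
  then have K': "submodule K R M" by (simp add: maximal_submod_def)
  note DK = submodule_Int[OF D(1) K']
  define G where "G = set_add M W (D \<inter> K)"
  have G: "submodule G R M" "W \<subseteq> G" "D \<inter> K \<subseteq> G"
    using submodule_set_add[OF W(1) DK] set_add_upper1[OF W(1) DK] set_add_upper2[OF W(1) DK]
    by (simp_all add: G_def)
  have "y \<notin> G"
  proof
    assume "y \<in> G"
    then have "d \<in> G" using submodule_add_cancel'[OF G(1), of w d] d G(2) by blast
    then obtain w' e where we: "w' \<in> W" "e \<in> D \<inter> K" "d = w' \<oplus>\<^bsub>M\<^esub> e"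
      unfolding G_def set_add_iff by blast
    then have "w' \<in> carrier M" using submoduleD(2)[OF W(1)] by blast
    then have "w' \<in> D" using submodule_add_cancel'[OF D(1), of e w'] we d by blast
    then have "w' \<in> K" using D(3) we(1) K(1) by (auto simp: mem_rad)
    then show False using we K(2) submoduleD(4)[OF K'] by blast
  qed
  moreover have "H = carrier M" if H: "submodule H R M" "G \<subset> H" for H
  proof -
    obtain h where h: "h \<in> H" "h \<notin> G" using H by blast
    then obtain d' w' where dw: "d' \<in> D" "w' \<in> W" "d' \<in> carrier M" "w' \<in> carrier M" "h = d' \<oplus>\<^bsub>M\<^esub> w'"
      using split submoduleD(2)[OF H(1)] by blast
    have "d' \<in> H" using submodule_add_cancel'[OF H(1), of w' d'] dw h H(2) G(2) by blast
    have "d' \<notin> K" using dw h G submoduleD(4)[OF G(1)] by blast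
    have "z \<in> H" if z: "z \<in> carrier M" for z
    proof -
      obtain d'' w'' where z: "d'' \<in> D" "w'' \<in> W" "d'' \<in> carrier M" "w'' \<in> carrier M" "z = d'' \<oplus>\<^bsub>M\<^esub> w''"
        using split[OF z] by blast
      obtain u a where u: "u \<in> K" "a \<in> carrier R" "d'' = u \<oplus>\<^bsub>M\<^esub> a \<odot>\<^bsub>M\<^esub> d'"
        using maximal_adjoin[OF K(1) dw(3) \<open>d' \<notin> K\<close> z(3)] by blast
      then have "u \<in> D"
        using submodule_add_cancel'[OF D(1), of "a \<odot>\<^bsub>M\<^esub> d'" u] submoduleD(5)[OF D(1)] submoduleD(2)[OF K'] dw z
        by simp
      then have "u \<in> H" using u G H by blast
      then have "d'' \<in> H" using u submoduleD(4,5)[OF H(1)] \<open>d' \<in> H\<close> by simp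
      moreover have "w'' \<in> H" using z G H by blast
      ultimately show ?thesis using z submoduleD(4)[OF H(1)] by simp
    qed
    then show ?thesis using submoduleD(1)[OF H(1)] by blast
  qed
  ultimately have "maximal_submod R M G"
    unfolding maximal_submod_def using G(1) y(1) by blast
  then show thesis using that G(2) \<open>y \<notin> G\<close> by blast
qed

text \<open>In a generating set of least size each \<open>x\<close> lies outside the submodule
  generated by the others. A submodule containing the others and maximal in missing \<open>x\<close>
  is maximal outright, since anything larger contains all generators.\<close>

lemma maximal_exists:
  assumes "fg_module R M" "carrier M \<noteq> {\<zero>\<^bsub>M\<^esub>}"
  obtains K where "maximal_submod R M K"
proof -
  define P where "P n \<longleftrightarrow> (\<exists>A. finite A \<and> card A = n \<and> A \<subseteq> carrier M \<and> gen_submod R M A = carrier M)" for n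
  have "\<exists>n. P n" using assms(1) unfolding fg_module_iff fg_submod_def P_def by blast
  then have "P (LEAST n. P n)" by (rule LeastI_ex)
  then obtain A where A: "finite A" "card A = (LEAST n. P n)" "A \<subseteq> carrier M" "gen_submod R M A = carrier M"
    unfolding P_def by blast
  have "A \<noteq> {}" using A(4) gen_empty assms(2) by auto
  then obtain x where x: "x \<in> A" by blast
  let ?W = "gen_submod R M (A - {x})"
  have W: "submodule ?W R M" using A by (intro submodule_gen) auto
  have "card (A - {x}) < (LEAST n. P n)" using A x by (metis card_Diff1_less)
  then have "\<not> P (card (A - {x}))" by (rule not_less_Least)
  then have "?W \<noteq> carrier M" using A unfolding P_def by blast
  have "x \<notin> ?W"
  proof
    assume "x \<in> ?W"
    then have "A \<subseteq> ?W" using gen_upper[of "A - {x}"] by blast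
    then have "carrier M \<subseteq> ?W" using gen_least[OF W, of A] A(4) by simp
    then show False using \<open>?W \<noteq> carrier M\<close> submoduleD(1)[OF W] by blast
  qed
  then obtain G where G: "submodule G R M" "?W \<subseteq> G" "x \<notin> G" "\<And>H. submodule H R M \<Longrightarrow> G \<subset> H \<Longrightarrow> x \<in> H"
    using submodule_avoiding[OF W] by blast
  have "H = carrier M" if H: "submodule H R M" "G \<subset> H" for H
  proof -
    have "x \<in> H" using G H by blast
    then have "A \<subseteq> H" using gen_upper[of "A - {x}"] G(2) H(2) by blast
    then show ?thesis using gen_least[OF H(1)] A(4) submoduleD(1)[OF H(1)] by blast
  qed
  moreover have "G \<noteq> carrier M" using G(3) x A(3) by blast
  ultimately have "maximal_submod R M G" unfolding maximal_submod_def using G(1) by blast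
  then show thesis by (rule that)
qed

end

context rmodule_hom
begin

text \<open>The preimage of a maximal submodule is maximal as soon as it is proper.\<close>

lemma rad_hom: "f ` carrier (rad R M) \<subseteq> carrier (rad R N)"
proof -
  have "f x \<in> K" if x: "x \<in> carrier (rad R M)" and K: "maximal_submod R N K" for x K
  proof (rule ccontr)
    assume nK: "f x \<notin> K"
    have K': "submodule K R N" using K by (simp add: maximal_submod_def)
    let ?P = "{x \<in> carrier M. f x \<in> K}"
    have P: "submodule ?P R M" by (rule submodule_preimage[OF K'])
    have xM: "x \<in> carrier M" using x by (simp add: M.mem_rad)
    have "H = carrier M" if H: "submodule H R M" "?P \<subset> H" for H
    proof -
      obtain h where h: "h \<in> H" "h \<in> carrier M" "f h \<notin> K" using H M.submoduleD(2)[OF H(1)] by blast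
      have "y \<in> H" if y: "y \<in> carrier M" for y
      proof -
        obtain u a where u: "u \<in> K" "a \<in> carrier R" "f y = u \<oplus>\<^bsub>N\<^esub> a \<odot>\<^bsub>N\<^esub> f h"
          using N.maximal_adjoin[OF K, of "f h" "f y"] h y by auto
        then have "f (y \<ominus>\<^bsub>M\<^esub> a \<odot>\<^bsub>M\<^esub> h) = u" using y h N.submoduleD(2)[OF K'] by simp
        then have "y \<ominus>\<^bsub>M\<^esub> a \<odot>\<^bsub>M\<^esub> h \<in> ?P" using u h y by simp
        then have "y \<ominus>\<^bsub>M\<^esub> a \<odot>\<^bsub>M\<^esub> h \<in> H" using H(2) by blast
        then have "(y \<ominus>\<^bsub>M\<^esub> a \<odot>\<^bsub>M\<^esub> h) \<oplus>\<^bsub>M\<^esub> a \<odot>\<^bsub>M\<^esub> h \<in> H"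
          using M.submoduleD(4,5)[OF H(1)] h u by simp
        then show ?thesis using y h u by simp
      qed
      then show ?thesis using M.submoduleD(1)[OF H(1)] by blast
    qed
    then have "maximal_submod R M ?P" unfolding maximal_submod_def using P xM nK by blast
    then show False using x nK unfolding M.mem_rad by blast
  qed
  then show ?thesis by (auto simp: N.mem_rad M.mem_rad)
qed

text \<open>If \<open>z\<close> in rad(N) had no preimage in rad(M), a preimage \<open>y\<close> of
  \<open>z\<close> would lie outside \<open>W\<close>, the sum of rad(M) and the kernel. A maximal
  \<open>G\<close> above \<open>W\<close> missing \<open>y\<close> contains the kernel, so its image
  is maximal in \<open>N\<close> and misses \<open>z\<close>, a contradiction.\<close>

lemma rad_onto:
  assumes dcc: "dcc R M" and onto: "f ` carrier M = carrier N"
  shows "f ` carrier (rad R M) = carrier (rad R N)"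
proof
  show "f ` carrier (rad R M) \<subseteq> carrier (rad R N)" by (rule rad_hom)
  show "carrier (rad R N) \<subseteq> f ` carrier (rad R M)"
  proof (rule ccontr)
    assume "\<not> ?thesis"
    then obtain z where z: "z \<in> carrier (rad R N)" "z \<notin> f ` carrier (rad R M)" by blast
    then obtain y where y: "y \<in> carrier M" "f y = z" using onto by (metis N.mem_rad imageE)
    define W where "W = set_add M (carrier (rad R M)) {x \<in> carrier M. f x = \<zero>\<^bsub>N\<^esub>}"
    note W = M.submodule_set_add[OF M.submodule_rad submodule_kernel, folded W_def]
      M.set_add_upper1[OF M.submodule_rad submodule_kernel, folded W_def]
      M.set_add_upper2[OF M.submodule_rad submodule_kernel, folded W_def]
    have "y \<notin> W"
    proof
      assume "y \<in> W"
      then obtain r u where "r \<in> carrier (rad R M)" "u \<in> carrier M" "f u = \<zero>\<^bsub>N\<^esub>" "y = r \<oplus>\<^bsub>M\<^esub> u"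
        unfolding W_def set_add_iff by blast
      then have "z = f r" using y M.submoduleD(2)[OF M.submodule_rad] by auto
      then show False using z(2) \<open>r \<in> carrier (rad R M)\<close> by blast
    qed
    then obtain G where G: "maximal_submod R M G" "W \<subseteq> G" "y \<notin> G"
      using M.maximal_separating[OF dcc W(1,2) y(1)] by blast
    then have G': "submodule G R M" by (simp add: maximal_submod_def)
    have preim: "x \<in> G" if x: "x \<in> carrier M" "f x \<in> f ` G" for x
    proof -
      obtain g where g: "g \<in> G" "f x = f g" using x by blast
      then have gM: "g \<in> carrier M" using M.submoduleD(2)[OF G'] by blast
      then have "f (x \<ominus>\<^bsub>M\<^esub> g) = \<zero>\<^bsub>N\<^esub>" using g x gM by (simp add: a_minus_def N.M.r_neg)
      then have "x \<ominus>\<^bsub>M\<^esub> g \<in> G" using W(3) G(2) x gM by auto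
      then have "(x \<ominus>\<^bsub>M\<^esub> g) \<oplus>\<^bsub>M\<^esub> g \<in> G" using g M.submoduleD(4)[OF G'] by blast
      then show ?thesis using x gM by simp
    qed
    have "H = carrier N" if H: "submodule H R N" "f ` G \<subset> H" for H
    proof -
      obtain h where h: "h \<in> H" "h \<notin> f ` G" using H by blast
      let ?P = "{x \<in> carrier M. f x \<in> H}"
      have "submodule ?P R M" by (rule submodule_preimage[OF H(1)])
      moreover have "G \<subset> ?P"
      proof
        show "G \<subseteq> ?P" using H(2) M.submoduleD(2)[OF G'] by blast
        obtain x where "x \<in> carrier M" "h = f x" using h onto N.submoduleD(2)[OF H(1)] by blast
        then show "G \<noteq> ?P" using h by blast
      qed
      ultimately have "?P = carrier M" using G(1) unfolding maximal_submod_def by blast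
      then have "f ` carrier M \<subseteq> H" by auto
      then show ?thesis using onto N.submoduleD(1)[OF H(1)] by simp
    qed
    moreover have "f ` G \<noteq> carrier N" using preim y G(3) f_closed by blast
    ultimately have "maximal_submod R N (f ` G)"
      unfolding maximal_submod_def using submodule_image[OF G'] by blast
    then have "z \<in> f ` G" using z(1) by (simp add: N.mem_rad)
    then show False using preim y G(3) by blast
  qed
qed

end

section \<open>Torsion submodules and layer length\<close>

text \<open>For simple members of \<open>S\<close> this says that M/K is filtered by
  \<open>S\<close>, read from the top: each step passes to the kernel of a map into some
  \<open>T\<close> in \<open>S\<close>. The map may be zero, in which case the step stands still.
  The inductive form allows arguments factor by factor without forming quotients.\<close>

inductive cofiltered ::
  "('a, 'b) ring_scheme \<Rightarrow> 'a rmod set \<Rightarrow> ('a, 'm) module \<Rightarrow> 'm set \<Rightarrow> bool"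
  for R S M where
  top: "cofiltered R S M (carrier M)"
| step: "cofiltered R S M C \<Longrightarrow> T \<in> S \<Longrightarrow> q \<in> mod_hom R (restrict_mod M C) T \<Longrightarrow>
    cofiltered R S M {x \<in> C. q x = \<zero>\<^bsub>T\<^esub>}"

lemma simple_fg:
  assumes "simple_mod R T" shows "fg_module R T"
proof -
  interpret rmodule R T using assms by (simp add: simple_mod_def rmodule_def)
  obtain x where x: "x \<in> carrier T" "x \<noteq> \<zero>\<^bsub>T\<^esub>"
    using assms unfolding simple_mod_def zero_mod_def by blast
  have "submodule (gen_submod R T {x}) R T" using x by (intro submodule_gen) simp
  then have "gen_submod R T {x} = carrier T"
    using assms x gen_upper[of "{x}"] unfolding simple_mod_def by blast
  then show ?thesis unfolding fg_module_iff fg_submod_def using x by (intro exI[of _ "{x}"]) simp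
qed

locale artin_simples = artin_alg k \<phi> R
  for k :: "('k, 'c) ring_scheme" and \<phi> :: "'k \<Rightarrow> 'a" and R :: "('a, 'b) ring_scheme" +
  fixes S :: "'a rmod set"
  assumes simple: "\<forall>T\<in>S. simple_mod R T"
begin

abbreviation t where "t \<equiv> torsion_sub R S"
abbreviation F where "F \<equiv> rad_torsion R S"

lemma rmodule_S: "T \<in> S \<Longrightarrow> rmodule R T"
  using simple by (auto simp: simple_mod_def rmodule_def)

lemma filtered_S:
  assumes T: "T \<in> S" shows "filtered R S T"
proof -
  interpret rmodule R T by (rule rmodule_S[OF T])
  note z = submodule_singleton
  interpret p: rmodule_hom R T "quot_mod T {\<zero>\<^bsub>T\<^esub>}" "\<lambda>x. {\<zero>\<^bsub>T\<^esub>} +>\<^bsub>T\<^esub> x"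
    by (intro rmodule_homI rmodule_axioms rmodule_quot quot_proj_hom z)
  have "mod_iso R T (quot_mod T {\<zero>\<^bsub>T\<^esub>})"
    unfolding mod_iso_def using p.hom r_coset_zero_iff[OF z] p.inj_iff_kernel
    by (intro bexI[of _ "\<lambda>x. {\<zero>\<^bsub>T\<^esub>} +>\<^bsub>T\<^esub> x"]) (auto simp: bij_betw_def quot_mod_carrier)
  then have iso: "mod_iso R (quot_mod T {\<zero>\<^bsub>T\<^esub>}) T"
    by (rule mod_iso_sym[OF rmodule_axioms])
  define G where "G n = (if n = (0::nat) then {\<zero>\<^bsub>T\<^esub>} else carrier T)" for n
  show ?thesis
    unfolding filtered_def
    using T simple simple_fg submodule_singleton submodule_carrier iso
    by (intro conjI exI[of _ "1::nat"] exI[of _ G]) (auto simp: G_def intro!: bexI[of _ T])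
qed

text \<open>Maps into the simple modules of \<open>S\<close> suffice as tests: if the image of
  \<open>f\<close> lies in one member of a filtration of \<open>N\<close>, composing with the map
  onto the next factor gives zero, so the image lies one member lower, and finally in zero.\<close>

lemma torsion_iff:
  "torsion R S M \<longleftrightarrow>
     fg_module R M \<and> (\<forall>T\<in>S. \<forall>f\<in>mod_hom R M T. \<forall>x\<in>carrier M. f x = \<zero>\<^bsub>T\<^esub>)"
proof
  assume M: "torsion R S M"
  have "T \<in> modcat R" if "T \<in> S" for T
    using that simple simple_fg by (auto simp: modcat_def)
  with M show "fg_module R M \<and> (\<forall>T\<in>S. \<forall>f\<in>mod_hom R M T. \<forall>x\<in>carrier M. f x = \<zero>\<^bsub>T\<^esub>)"
    unfolding torsion_def using filtered_S by blast
next
  assume M: "fg_module R M \<and> (\<forall>T\<in>S. \<forall>f\<in>mod_hom R M T. \<forall>x\<in>carrier M. f x = \<zero>\<^bsub>T\<^esub>)"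
  have "f x = \<zero>\<^bsub>N\<^esub>" if N: "filtered R S N" and f: "f \<in> mod_hom R M N" and x: "x \<in> carrier M"
    for N :: "'a rmod" and f x
  proof -
    interpret rmodule_hom R M N f
      using M N f by (intro rmodule_homI rmodule_fg) (auto simp: filtered_def)
    obtain m G where G: "G 0 = {\<zero>\<^bsub>N\<^esub>}" "G m = carrier N" "\<And>i. i \<le> m \<Longrightarrow> submodule (G i) R N"
      "\<And>i. i < m \<Longrightarrow> G i \<subseteq> G (Suc i) \<and>
         (\<exists>T\<in>S. mod_iso R (quot_mod (restrict_mod N (G (Suc i))) (G i)) T)"
      using N unfolding filtered_def by blast
    \<comment> \<open>The index runs downwards because the filtration is peeled off from the
      top.\<close>
    have "i \<le> m \<Longrightarrow> f ` carrier M \<subseteq> G (m - i)" for i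
    proof (induction i)
      case 0
      have "f ` carrier M \<subseteq> carrier N" by (simp add: image_subset_iff)
      then show ?case by (simp only: G(2) diff_zero)
    next
      case (Suc i)
      define j where "j = m - Suc i"
      have j: "j < m" "Suc j = m - i" using Suc.prems by (auto simp: j_def)
      then obtain T where T: "T \<in> S" "mod_iso R (quot_mod (restrict_mod N (G (Suc j))) (G j)) T"
        using G(4) by blast
      have Gj: "submodule (G (Suc j)) R N" "submodule (G j) R N" using G(3) j by auto
      interpret Nj: rmodule R "restrict_mod N (G (Suc j))" by (rule N.rmodule_restrict[OF Gj(1)])
      have sub: "submodule (G j) R (restrict_mod N (G (Suc j)))"
        using N.submodule_restrict[OF Gj(1)] Gj(2) G(4)[OF j(1)] by blast
      obtain q where q: "q \<in> mod_hom R (restrict_mod N (G (Suc j))) T"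
        "{x \<in> carrier (restrict_mod N (G (Suc j))). q x = \<zero>\<^bsub>T\<^esub>} = G j"
        by (rule Nj.iso_quot_hom[OF sub T(2) rmodule_S[OF T(1)]])
      have fG: "f ` carrier M \<subseteq> G (Suc j)" using Suc j by simp
      have "f \<in> mod_hom R M (restrict_mod N (G (Suc j)))"
        using mod_hom_restrict[OF f, of "carrier M"] fG by simp
      from bspec[OF bspec[OF conjunct2[OF M] T(1)] mod_hom_compose[OF this q(1)]]
      have "\<forall>x\<in>carrier M. q (f x) = \<zero>\<^bsub>T\<^esub>" .
      then have "f ` carrier M \<subseteq> {x \<in> G (Suc j). q x = \<zero>\<^bsub>T\<^esub>}" using fG by blast
      then show ?case using q(2) by (simp add: j_def)
    qed
    from this[of m] G(1) x show ?thesis by auto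
  qed
  with M show "torsion R S M" by (simp add: torsion_def)
qed

lemma torsionD:
  "torsion R S M \<Longrightarrow> T \<in> S \<Longrightarrow> f \<in> mod_hom R M T \<Longrightarrow> x \<in> carrier M \<Longrightarrow> f x = \<zero>\<^bsub>T\<^esub>"
  unfolding torsion_iff by blast

lemma cofiltered_submodule:
  assumes "rmodule R M" "cofiltered R S M K" shows "submodule K R M"
proof -
  interpret rmodule R M by fact
  from assms(2) show ?thesis
  proof induction
    case (step C T q)
    interpret C: rmodule_hom R "restrict_mod M C" T q
      by (intro rmodule_homI rmodule_restrict rmodule_S step)
    show ?case using C.submodule_kernel submodule_restrict[OF step.IH] by simp
  qed (rule submodule_carrier)
qed

text \<open>Each map \<open>q\<close> of the descent vanishes on the torsion submodule
  \<open>H\<close>, so \<open>H\<close> survives every passage to a kernel.\<close>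

lemma torsion_below_cofiltered:
  assumes "rmodule R M" "cofiltered R S M K" "torsion R S (restrict_mod M H)" "H \<subseteq> carrier M"
  shows "H \<subseteq> K"
  using assms(2)
proof induction
  case (step C T q)
  have "q \<in> mod_hom R (restrict_mod M H) T"
    using mod_hom_restrict_left[OF step(3), of H] step by simp
  from torsionD[OF assms(3) step(2) this] show ?case using step.IH by auto
qed (rule assms)

text \<open>Let \<open>K\<close> be minimal among the cofiltered submodules. The kernel of a map
  from \<open>K\<close> into a member of \<open>S\<close> is again cofiltered, hence equals
  \<open>K\<close>; so \<open>K\<close> is torsion. It lies above every torsion submodule, which
  shows that the \<open>GREATEST\<close> in the definition exists and is \<open>K\<close>.\<close>

lemma torsion_sub_props:
  assumes fg: "fg_module R M"
  shows "t M = restrict_mod M (carrier (t M))" "submodule (carrier (t M)) R M"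
    "torsion R S (t M)" "cofiltered R S M (carrier (t M))"
proof -
  interpret rmodule R M by (rule rmodule_fg[OF fg])
  obtain K where K: "submodule K R M" "cofiltered R S M K"
    "\<And>L. submodule L R M \<Longrightarrow> cofiltered R S M L \<Longrightarrow> L \<subseteq> K \<Longrightarrow> L = K"
    using dcc_minimal[OF fg_dcc[OF fg] submodule_carrier, of "cofiltered R S M"] cofiltered.top by blast
  have "f x = \<zero>\<^bsub>T\<^esub>" if T: "T \<in> S" "f \<in> mod_hom R (restrict_mod M K) T" "x \<in> K" for T f x
  proof -
    have "cofiltered R S M {x \<in> K. f x = \<zero>\<^bsub>T\<^esub>}" using cofiltered.step[OF K(2) T(1,2)] .
    then have "{x \<in> K. f x = \<zero>\<^bsub>T\<^esub>} = K"
      using K(3) cofiltered_submodule[OF rmodule_axioms] by blast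
    then show ?thesis using T(3) by blast
  qed
  then have tors: "torsion R S (restrict_mod M K)"
    unfolding torsion_iff using fg_restrict[OF fg K(1)] by simp
  have "(GREATEST H. submodule H R M \<and> torsion R S (restrict_mod M H)) = K"
    using K tors torsion_below_cofiltered[OF rmodule_axioms K(2)] submoduleD(1)
    by (intro Greatest_equality) blast+
  then have "t M = restrict_mod M K" by (simp add: torsion_sub_def)
  then show "t M = restrict_mod M (carrier (t M))" "submodule (carrier (t M)) R M"
    "torsion R S (t M)" "cofiltered R S M (carrier (t M))"
    using K tors by simp_all
qed

lemma torsion_sub_greatest:
  assumes "fg_module R M" "torsion R S (restrict_mod M H)" "H \<subseteq> carrier M"
  shows "H \<subseteq> carrier (t M)"
  using torsion_below_cofiltered[OF rmodule_fg torsion_sub_props(4)] assms by blast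

lemma fg_torsion_sub: "fg_module R M \<Longrightarrow> fg_module R (t M)"
  using torsion_sub_props(3) torsion_def by blast

lemma torsion_sub_idem:
  assumes "fg_module R M" shows "t (t M) = t M"
proof -
  have "carrier (t M) \<subseteq> carrier (t (t M))"
    using torsion_sub_greatest[OF fg_torsion_sub[OF assms], of "carrier (t M)"]
      torsion_sub_props(3)[OF assms] by simp
  moreover have "carrier (t (t M)) \<subseteq> carrier (t M)"
    using torsion_sub_props(2)[OF fg_torsion_sub[OF assms]]
      rmodule.submoduleD(1)[OF rmodule_fg[OF fg_torsion_sub[OF assms]]] by blast
  ultimately have "carrier (t (t M)) = carrier (t M)" by blast
  then show ?thesis using torsion_sub_props(1)[OF fg_torsion_sub[OF assms]] by simp
qed

lemma torsion_image:
  assumes "rmodule_hom R M N f" "fg_module R N" "submodule H R M" "torsion R S (restrict_mod M H)"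
  shows "torsion R S (restrict_mod N (f ` H))"
proof -
  interpret rmodule_hom R M N f by fact
  have "g y = \<zero>\<^bsub>T\<^esub>" if g: "T \<in> S" "g \<in> mod_hom R (restrict_mod N (f ` H)) T" "y \<in> f ` H" for g T y
  proof -
    have "f \<in> mod_hom R (restrict_mod M H) (restrict_mod N (f ` H))"
      by (rule mod_hom_restrict[OF hom M.submoduleD(1)[OF assms(3)] order_refl])
    from torsionD[OF assms(4) g(1) mod_hom_compose[OF this g(2)]] show ?thesis using g(3) by auto
  qed
  then show ?thesis
    unfolding torsion_iff using fg_restrict[OF assms(2) submodule_image[OF assms(3)]] by simp
qed

lemma torsion_sub_hom_image:
  assumes "rmodule_hom R M N f" "fg_module R M" "fg_module R N"
  shows "f ` carrier (t M) \<subseteq> carrier (t N)"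
proof -
  interpret rmodule_hom R M N f by fact
  note tM = torsion_sub_props[OF assms(2)]
  have "torsion R S (restrict_mod N (f ` carrier (t M)))"
    using torsion_image[OF assms(1,3) tM(2)] tM(1,3) by simp
  moreover have "f ` carrier (t M) \<subseteq> carrier N"
    using M.submoduleD(2)[OF tM(2)] by (simp add: image_subset_iff)
  ultimately show ?thesis by (rule torsion_sub_greatest[OF assms(3)])
qed

text \<open>Induction down the descent from \<open>M\<close> to t(M) shows that the image of each
  member still contains t(N). At a step \<open>q\<close> from \<open>C\<close> to \<open>T\<close>
  the question is what \<open>q\<close> does on \<open>?Z\<close>, the part of the kernel of
  \<open>f\<close> inside \<open>C\<close>; as \<open>T\<close> is simple, \<open>q\<close> is
  either zero there or onto \<open>T\<close>.\<close>

lemma torsion_sub_onto: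
  assumes "rmodule_hom R M N f" "fg_module R M" "fg_module R N" and onto: "f ` carrier M = carrier N"
  shows "f ` carrier (t M) = carrier (t N)"
proof
  interpret rmodule_hom R M N f by fact
  show "f ` carrier (t M) \<subseteq> carrier (t N)" by (rule torsion_sub_hom_image[OF assms(1-3)])
  note tN = torsion_sub_props[OF assms(3)]
  have "carrier (t N) \<subseteq> f ` K" if "cofiltered R S M K" for K
    using that
  proof induction
    case top
    then show ?case using onto N.submoduleD(1)[OF tN(2)] by simp
  next
    case (step C T q)
    have C: "submodule C R M" by (rule cofiltered_submodule[OF M.rmodule_axioms step(1)])
    interpret q: rmodule_hom R "restrict_mod M C" T q
      by (intro rmodule_homI M.rmodule_restrict rmodule_S step C)
    note CD = M.submoduleD[OF C]
    have qadd: "q (x \<oplus>\<^bsub>M\<^esub> y) = q x \<oplus>\<^bsub>T\<^esub> q y" if "x \<in> C" "y \<in> C" for x y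
      using q.f_add[of x y] that by simp
    have qsmult: "q (a \<odot>\<^bsub>M\<^esub> x) = a \<odot>\<^bsub>T\<^esub> q x" if "x \<in> C" "a \<in> carrier R" for x a
      using q.f_smult[of a x] that by simp
    have quminus: "q (\<ominus>\<^bsub>M\<^esub> x) = \<ominus>\<^bsub>T\<^esub> q x" if "x \<in> C" for x
      using qsmult[OF that, of "\<ominus>\<^bsub>R\<^esub> \<one>\<^bsub>R\<^esub>"] M.smult_minus_one[OF CD(2)[OF that]]
        q.N.smult_minus_one[of "q x"] q.f_closed that by simp
    have qC: "q x \<in> carrier T" if "x \<in> C" for x using q.f_closed that by simp
    have diff: "x \<ominus>\<^bsub>M\<^esub> y \<in> C" "f (x \<ominus>\<^bsub>M\<^esub> y) = f x \<ominus>\<^bsub>N\<^esub> f y" "q (x \<ominus>\<^bsub>M\<^esub> y) = q x \<ominus>\<^bsub>T\<^esub> q y"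
      if "x \<in> C" "y \<in> C" for x y
      using that M.submodule_minus[OF C] CD(2) qadd[OF _ M.submodule_uminus[OF C]] quminus
      by (simp_all add: a_minus_def)
    let ?Z = "C \<inter> {x \<in> carrier M. f x = \<zero>\<^bsub>N\<^esub>}"
    have Z: "submodule ?Z R (restrict_mod M C)"
      using M.submodule_restrict[OF C] M.submodule_Int[OF C submodule_kernel] by blast
    show ?case
    proof (cases "\<forall>x\<in>?Z. q x = \<zero>\<^bsub>T\<^esub>")
      case True
      have same: "q x = q y" if xy: "x \<in> C" "y \<in> C" "f x = f y" for x y
      proof -
        have "f (x \<ominus>\<^bsub>M\<^esub> y) = \<zero>\<^bsub>N\<^esub>"
          using diff[OF xy(1,2)] xy CD(2) by (simp add: a_minus_def N.M.r_neg)
        then have "q x \<ominus>\<^bsub>T\<^esub> q y = \<zero>\<^bsub>T\<^esub>" using True diff[OF xy(1,2)] CD(2) by auto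
        then show ?thesis using q.N.add_minus_cancel(1)[of "q y" "q x"] qC[OF xy(1)] qC[OF xy(2)] by simp
      qed
      \<comment> \<open>\<open>q\<close> factors through the image of \<open>C\<close>. The induced
        map kills the torsion module t(N), so every preimage in \<open>C\<close> of an element of
        t(N) is in the kernel of \<open>q\<close>.\<close>
      define g where "g y = q (inv_into C f y)" for y
      have g: "g (f x) = q x" if "x \<in> C" for x
        unfolding g_def using that by (intro same inv_into_into f_inv_into_f) auto
      have tNC: "carrier (t N) \<subseteq> f ` C" by (rule step.IH)
      have "g \<in> mod_hom R (restrict_mod N (f ` C)) T"
        unfolding mod_hom_def
        using CD qC by (auto simp: g qadd qsmult f_add[symmetric] f_smult[symmetric] simp del: f_add f_smult)
      then have "g \<in> mod_hom R (t N) T"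
        using mod_hom_restrict_left[of g R "restrict_mod N (f ` C)" T "carrier (t N)"] tNC tN(1) by simp
      then have "g y = \<zero>\<^bsub>T\<^esub>" if "y \<in> carrier (t N)" for y
        using torsionD[OF tN(3) step(2)] that by blast
      then show ?thesis using tNC g by (auto simp: subset_iff image_iff) metis
    next
      case False
      \<comment> \<open>A preimage \<open>x\<close> in \<open>C\<close> is now corrected by some
        \<open>z\<close> in \<open>?Z\<close> with \<open>q z = q x\<close>; this leaves its image
        under \<open>f\<close> unchanged.\<close>
      then have "q ` ?Z = carrier T"
        using q.submodule_image[OF Z] simple step(2) unfolding simple_mod_def by blast
      show ?thesis
      proof
        fix y assume "y \<in> carrier (t N)"
        then obtain x where x: "x \<in> C" "y = f x" using step.IH by blast
        then obtain z where z: "z \<in> C" "f z = \<zero>\<^bsub>N\<^esub>" "q z = q x"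
          using \<open>q ` ?Z = carrier T\<close> qC[OF x(1)] by (smt (verit) Int_iff imageE mem_Collect_eq)
        have "q (x \<ominus>\<^bsub>M\<^esub> z) = \<zero>\<^bsub>T\<^esub>"
          using diff(3)[OF x(1) z(1)] z(3) qC[OF x(1)] by (simp add: a_minus_def q.N.M.r_neg)
        moreover have "f (x \<ominus>\<^bsub>M\<^esub> z) = y"
          using diff(2)[OF x(1) z(1)] z x CD(2)
            N.add_minus_cancel(2)[of "\<zero>\<^bsub>N\<^esub>" y] by simp
        ultimately show "y \<in> f ` {x \<in> C. q x = \<zero>\<^bsub>T\<^esub>}"
          using diff(1)[OF x(1) z(1)] by blast
      qed
    qed
  qed
  then show "carrier (t N) \<subseteq> f ` carrier (t M)"
    using torsion_sub_props(4)[OF assms(2)] by blast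
qed

lemma torsion_sub_hom:
  assumes "rmodule_hom R M N f" "fg_module R M" "fg_module R N"
  shows "rmodule_hom R (t M) (t N) f"
proof -
  interpret rmodule_hom R M N f by fact
  note tM = torsion_sub_props[OF assms(2)] and tN = torsion_sub_props[OF assms(3)]
  have "f \<in> mod_hom R (restrict_mod M (carrier (t M))) (restrict_mod N (carrier (t N)))"
    using torsion_sub_hom_image[OF assms] M.submoduleD(1)[OF tM(2)] by (intro mod_hom_restrict hom)
  then show ?thesis
    by (intro rmodule_homI rmodule_fg fg_torsion_sub assms) (simp add: tM(1)[symmetric] tN(1)[symmetric])
qed

section \<open>The functor F, its powers and the layer length\<close>

lemma rad_torsion_props:
  assumes "fg_module R M"
  shows "F M = restrict_mod M (carrier (F M))" "submodule (carrier (F M)) R M" "fg_module R (F M)"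
    "carrier (F M) \<subseteq> carrier (t M)"
proof -
  note tM = torsion_sub_props[OF assms]
  interpret M: rmodule R M by (rule rmodule_fg[OF assms])
  interpret t: rmodule R "t M" by (intro rmodule_fg fg_torsion_sub assms)
  have eq: "F M = restrict_mod (t M) (carrier (F M))"
    unfolding rad_torsion_def by (rule t.rad_eq)
  then show "F M = restrict_mod M (carrier (F M))" by (metis tM(1) restrict_mod_simps(5))
  have sub: "submodule (carrier (F M)) R (t M)" unfolding rad_torsion_def by (rule t.submodule_rad)
  then show "carrier (F M) \<subseteq> carrier (t M)" by (rule t.submoduleD)
  show "fg_module R (F M)" using fg_restrict[OF fg_torsion_sub[OF assms] sub] eq by simp
  show "submodule (carrier (F M)) R M"
    using sub tM(1) M.submodule_restrict[OF tM(2), of "carrier (F M)"] by metis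
qed

lemma rad_torsion_hom:
  assumes "rmodule_hom R M N f" "fg_module R M" "fg_module R N"
  shows "rmodule_hom R (F M) (F N) f"
proof -
  interpret M: rmodule_hom R M N f by fact
  interpret t: rmodule_hom R "t M" "t N" f by (rule torsion_sub_hom[OF assms])
  note FM = rad_torsion_props[OF assms(2)] and FN = rad_torsion_props[OF assms(3)]
  have "f \<in> mod_hom R (restrict_mod M (carrier (F M))) (restrict_mod N (carrier (F N)))"
    using t.rad_hom M.M.submoduleD(1)[OF FM(2)]
    by (intro mod_hom_restrict M.hom) (simp_all add: rad_torsion_def)
  then show ?thesis
    using FM FN by (intro rmodule_homI rmodule_fg) auto
qed

lemma rad_torsion_onto:
  assumes "rmodule_hom R M N f" "fg_module R M" "fg_module R N" "f ` carrier M = carrier N"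
  shows "f ` carrier (F M) = carrier (F N)"
proof -
  interpret t: rmodule_hom R "t M" "t N" f by (rule torsion_sub_hom[OF assms(1-3)])
  show ?thesis
    unfolding rad_torsion_def
    by (intro t.rad_onto fg_dcc fg_torsion_sub assms torsion_sub_onto)
qed

text \<open>All powers are restrictions of \<open>M\<close> itself, so zero, sum and action are
  those of \<open>M\<close>, and members of different depth can be compared as subsets.\<close>

lemma funpow_props:
  assumes "fg_module R M"
  shows "(F ^^ n) M = restrict_mod M (carrier ((F ^^ n) M)) \<and> submodule (carrier ((F ^^ n) M)) R M \<and>
    fg_module R ((F ^^ n) M)"
proof (induction n)
  case 0
  then show ?case using assms rmodule.submodule_carrier[OF rmodule_fg[OF assms]] by simp
next
  case (Suc n)
  let ?X = "(F ^^ n) M"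
  interpret M: rmodule R M by (rule rmodule_fg[OF assms])
  note X = conjunct1[OF Suc] conjunct1[OF conjunct2[OF Suc]] conjunct2[OF conjunct2[OF Suc]]
  note FX = rad_torsion_props[OF X(3)]
  have "F ?X = restrict_mod M (carrier (F ?X))" using FX(1) X(1) by (metis restrict_mod_simps(5))
  moreover have "submodule (carrier (F ?X)) R M"
    using FX(2) X(1) M.submodule_restrict[OF X(2), of "carrier (F ?X)"] by metis
  ultimately show ?case using FX(3) by simp
qed

lemmas funpow_restrict = funpow_props[THEN conjunct1]
  and funpow_submodule = funpow_props[THEN conjunct2, THEN conjunct1]
  and fg_funpow = funpow_props[THEN conjunct2, THEN conjunct2]

lemma funpow_hom:
  assumes "rmodule_hom R M N f" "fg_module R M" "fg_module R N"
  shows "rmodule_hom R ((F ^^ n) M) ((F ^^ n) N) f"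
  by (induction n) (simp_all add: assms rad_torsion_hom fg_funpow)

lemma funpow_onto:
  assumes "rmodule_hom R M N f" "fg_module R M" "fg_module R N" "f ` carrier M = carrier N"
  shows "f ` carrier ((F ^^ n) M) = carrier ((F ^^ n) N)"
  by (induction n) (simp_all add: assms rad_torsion_onto fg_funpow funpow_hom)

text \<open>The relation through which the layer length is handled: by
  \<open>layer_length_le_iff\<close> it is the bound by \<open>n\<close>, and it avoids arithmetic
  with an infimum in the extended naturals.\<close>

definition layers_le :: "nat \<Rightarrow> ('a, 'm) module \<Rightarrow> bool" where
  "layers_le n M \<longleftrightarrow> zero_mod (t ((F ^^ n) M))"

lemma layers_le_iff:
  assumes "fg_module R M"
  shows "layers_le n M \<longleftrightarrow> (\<forall>x\<in>carrier (t ((F ^^ n) M)). x = \<zero>\<^bsub>M\<^esub>)"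
proof -
  note X = torsion_sub_props[OF fg_funpow[OF assms], of n]
  interpret X: rmodule R "(F ^^ n) M" by (intro rmodule_fg fg_funpow assms)
  have z: "\<zero>\<^bsub>(F ^^ n) M\<^esub> = \<zero>\<^bsub>M\<^esub>" using funpow_restrict[OF assms, of n] by (metis restrict_mod_simps(2))
  then have "\<zero>\<^bsub>t ((F ^^ n) M)\<^esub> = \<zero>\<^bsub>M\<^esub>" using X(1) by (metis restrict_mod_simps(2))
  moreover have "\<zero>\<^bsub>M\<^esub> \<in> carrier (t ((F ^^ n) M))" using X.submoduleD(3)[OF X(2)] z by simp
  ultimately show ?thesis unfolding layers_le_def zero_mod_def by auto
qed

lemma layers_le_Suc:
  assumes "fg_module R M" "layers_le n M" shows "layers_le (Suc n) M"
proof -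
  let ?X = "(F ^^ n) M"
  note X = fg_funpow[OF assms(1), of n] and FX = fg_funpow[OF assms(1), of "Suc n"]
  have "carrier (t (F ?X)) \<subseteq> carrier (F ?X)"
    using torsion_sub_props(2)[OF FX] rmodule.submoduleD(1)[OF rmodule_fg[OF FX]] by simp
  then have "carrier (t (F ?X)) \<subseteq> carrier (t ?X)" using rad_torsion_props(4)[OF X] by simp
  then show ?thesis using assms by (auto simp: layers_le_iff)
qed

lemma layers_le_mono: "fg_module R M \<Longrightarrow> layers_le m M \<Longrightarrow> m \<le> n \<Longrightarrow> layers_le n M"
  by (rotate_tac 2, induction n rule: dec_induct) (auto intro: layers_le_Suc)

lemma layer_length_le_iff:
  assumes "fg_module R M" shows "layer_length R S M \<le> enat n \<longleftrightarrow> layers_le n M"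
proof
  let ?A = "{enat i | i. layers_le i M}"
  have eq: "layer_length R S M = Inf ?A" unfolding layer_length_def layers_le_def ..
  assume le: "layer_length R S M \<le> enat n"
  \<comment> \<open>The infimum of the empty set is infinity, which exceeds every
    \<open>enat n\<close>; a nonempty set of extended naturals attains its infimum.\<close>
  have "?A \<noteq> {}"
  proof
    assume e: "?A = {}"
    show False using le unfolding eq e by (simp add: top_enat_def)
  qed
  then have "Inf ?A \<in> ?A" unfolding Inf_enat_def by (metis (mono_tags, lifting) LeastI_ex ex_in_conv)
  then obtain i where "Inf ?A = enat i" "layers_le i M" by blast
  then show "layers_le n M" using le layers_le_mono[OF assms] by (simp add: eq)
next
  assume "layers_le n M"
  then show "layer_length R S M \<le> enat n"
    unfolding layer_length_def layers_le_def by (intro Inf_lower) blast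
qed

lemma layers_le_inj:
  assumes f: "rmodule_hom R L M f" "fg_module R L" "fg_module R M" "inj_on f (carrier L)"
    and "layers_le n M"
  shows "layers_le n L"
proof -
  interpret rmodule_hom R L M f by fact
  interpret tn: rmodule_hom R "t ((F ^^ n) L)" "t ((F ^^ n) M)" f
    by (intro torsion_sub_hom funpow_hom fg_funpow f)
  have "x = \<zero>\<^bsub>L\<^esub>" if x: "x \<in> carrier (t ((F ^^ n) L))" for x
  proof -
    have "f x = \<zero>\<^bsub>M\<^esub>" using tn.f_closed[OF x] assms(5) f(3) by (auto simp: layers_le_iff)
    moreover have "x \<in> carrier ((F ^^ n) L)"
      using x torsion_sub_props(2)[OF fg_funpow[OF f(2)], of n]
        rmodule.submoduleD(2)[OF rmodule_fg[OF fg_funpow[OF f(2)]]] by blast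
    then have "x \<in> carrier L" using M.submoduleD(2)[OF funpow_submodule[OF f(2)]] by blast
    ultimately show ?thesis using f(4) by (simp add: inj_iff_kernel)
  qed
  then show ?thesis using f(2) by (simp add: layers_le_iff)
qed

lemma layers_le_onto:
  assumes g: "rmodule_hom R M N g" "fg_module R M" "fg_module R N" "g ` carrier M = carrier N"
    and "layers_le n M"
  shows "layers_le n N"
proof -
  interpret rmodule_hom R M N g by fact
  have "carrier (t ((F ^^ n) N)) = g ` carrier (t ((F ^^ n) M))"
    by (rule torsion_sub_onto[symmetric]) (intro funpow_hom fg_funpow g funpow_onto)+
  then show ?thesis using assms by (auto simp: layers_le_iff)
qed

text \<open>Idempotence of \<open>t\<close> gives \<open>F (t M) = F M\<close>. Thus a bound for the
  torsion submodule is a bound for the module.\<close>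

lemma torsion_funpow_torsion:
  assumes "fg_module R M" shows "t ((F ^^ m) (t M)) = t ((F ^^ m) M)"
proof -
  have "F (t M) = F M" using torsion_sub_idem[OF assms] by (simp add: rad_torsion_def)
  then show ?thesis by (cases m) (simp_all add: torsion_sub_idem[OF assms] funpow_Suc_right del: funpow.simps(2))
qed

text \<open>As t(F^n(N)) vanishes, \<open>?Z\<close> lies in the kernel of \<open>g\<close>, hence
  in the image of \<open>f\<close>. The carriers of \<open>L\<close> and \<open>M\<close> may have
  different types, so the inverse of \<open>f\<close> on its image is what embeds \<open>?Z\<close>
  into \<open>L\<close> and gives it at most \<open>m\<close> layers.\<close>

lemma layers_le_ext:
  assumes L: "fg_module R L" "layers_le m L" "rmodule_hom R L M f"
    and N: "fg_module R N" "layers_le n N" "rmodule_hom R M N g"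
    and M: "fg_module R M" and exact: "{x \<in> carrier M. g x = \<zero>\<^bsub>N\<^esub>} \<subseteq> f ` carrier L"
    and inj: "inj_on f (carrier L)"
  shows "layers_le (m + n) M"
proof -
  interpret f: rmodule_hom R L M f by fact
  interpret g: rmodule_hom R M N g by fact
  let ?Z = "t ((F ^^ n) M)"
  interpret gn: rmodule_hom R ?Z "t ((F ^^ n) N)" g
    by (intro torsion_sub_hom funpow_hom fg_funpow N M)
  note fg = fg_funpow[OF M, of n] fg_torsion_sub[OF fg_funpow[OF M, of n]]
  note Fn = funpow_restrict[OF M, of n] funpow_submodule[OF M, of n] torsion_sub_props[OF fg(1)]
  have Z: "?Z = restrict_mod M (carrier ?Z)" using Fn(1,3) by (metis restrict_mod_simps(5))
  have ZM: "submodule (carrier ?Z) R M"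
    using Fn(1,2,4) f.N.submodule_restrict[OF Fn(2), of "carrier ?Z"] by metis
  have "carrier ?Z \<subseteq> f ` carrier L"
  proof
    fix x assume x: "x \<in> carrier ?Z"
    then have "g x = \<zero>\<^bsub>N\<^esub>" using gn.f_closed[OF x] N by (auto simp: layers_le_iff)
    then show "x \<in> f ` carrier L" using exact f.N.submoduleD(2)[OF ZM x] by blast
  qed
  define f' where "f' = inv_into (carrier L) f"
  have bij: "bij_betw f (carrier L) (carrier (restrict_mod M (f ` carrier L)))"
    using inj by (simp add: bij_betw_def)
  have "f' \<in> mod_hom R (restrict_mod M (f ` carrier L)) L"
    unfolding f'_def
    using mod_hom_inv[OF f.M.rmodule_axioms _ bij] mod_hom_restrict[OF f.hom, of "carrier L" "f ` carrier L"]
    by simp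
  then have "f' \<in> mod_hom R ?Z L"
    using mod_hom_restrict_left[of f' R _ L "carrier ?Z"] \<open>carrier ?Z \<subseteq> f ` carrier L\<close> Z
    by (metis restrict_mod_simps(1,5))
  then have "rmodule_hom R ?Z L f'"
    by (intro rmodule_homI rmodule_fg fg L)
  moreover have "inj_on f' (carrier ?Z)"
    unfolding f'_def using \<open>carrier ?Z \<subseteq> f ` carrier L\<close> by (rule inj_on_inv_into)
  ultimately have "layers_le m ?Z"
    using layers_le_inj[OF _ fg(2) L(1)] L(2) by blast
  then show ?thesis
    using torsion_funpow_torsion[OF fg(1), of m] by (simp add: layers_le_def funpow_add)
qed

lemma enat_le_if_le: "(\<And>n. y \<le> enat n \<Longrightarrow> x \<le> enat n) \<Longrightarrow> x \<le> y"
  by (cases y) auto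

lemma layer_length_short_exact:
  assumes fg: "fg_module R L" "fg_module R M" "fg_module R N" and ex: "short_exact R L f M g N"
  shows "layer_length R S L \<le> layer_length R S M" "layer_length R S N \<le> layer_length R S M"
    "layer_length R S M \<le> layer_length R S L + layer_length R S N"
proof -
  have f: "rmodule_hom R L M f" and g: "rmodule_hom R M N g"
    using ex fg by (auto simp: short_exact_def intro!: rmodule_homI rmodule_fg)
  have inj: "inj_on f (carrier L)" and onto: "g ` carrier M = carrier N"
    and kernel: "{x \<in> carrier M. g x = \<zero>\<^bsub>N\<^esub>} \<subseteq> f ` carrier L"
    using ex by (simp_all add: short_exact_def)
  show "layer_length R S L \<le> layer_length R S M"
    by (rule enat_le_if_le) (simp add: layer_length_le_iff fg layers_le_inj[OF f fg(1,2) inj])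
  show "layer_length R S N \<le> layer_length R S M"
    by (rule enat_le_if_le) (simp add: layer_length_le_iff fg layers_le_onto[OF g fg(2,3) onto])
  show "layer_length R S M \<le> layer_length R S L + layer_length R S N"
  proof (cases "layer_length R S L"; cases "layer_length R S N")
    fix m n assume "layer_length R S L = enat m" "layer_length R S N = enat n"
    then have "layers_le m L" "layers_le n N" "layer_length R S L + layer_length R S N = enat (m + n)"
      using layer_length_le_iff[OF fg(1), of m] layer_length_le_iff[OF fg(3), of n] by simp_all
    then show ?thesis
      using layers_le_ext[OF fg(1) _ f fg(3) _ g fg(2) kernel inj] layer_length_le_iff[OF fg(2)] by simp
  qed auto
qed

text \<open>The chain of the F^n(M) stops, and t(F^m(M)) is squeezed between two equal members of
  it. It is therefore its own radical; a nonzero finitely generated module has a maximal submodule,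
  so it is zero.\<close>

lemma layer_length_finite:
  assumes fg: "fg_module R M" obtains n where "layers_le n M"
proof -
  interpret rmodule R M by (rule rmodule_fg[OF fg])
  have sub: "carrier ((F ^^ Suc n) M) \<subseteq> carrier (t ((F ^^ n) M))" for n
    using rad_torsion_props(4)[OF fg_funpow[OF fg, of n]] by simp
  have sub': "carrier (t ((F ^^ n) M)) \<subseteq> carrier ((F ^^ n) M)" for n
    using torsion_sub_props(2)[OF fg_funpow[OF fg, of n]]
      rmodule.submoduleD(1)[OF rmodule_fg[OF fg_funpow[OF fg, of n]]] by blast
  have "\<forall>n. submodule (carrier ((F ^^ n) M)) R M \<and> carrier ((F ^^ Suc n) M) \<subseteq> carrier ((F ^^ n) M)"
    using funpow_submodule[OF fg] sub sub' by blast
  then obtain m where m: "\<forall>n\<ge>m. carrier ((F ^^ n) M) = carrier ((F ^^ m) M)"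
    using fg_dcc[OF fg, unfolded dcc_def, THEN spec, of "\<lambda>n. carrier ((F ^^ n) M)"] by blast
  let ?Z = "t ((F ^^ m) M)"
  have fgZ: "fg_module R ?Z" by (intro fg_torsion_sub fg_funpow fg)
  interpret Z: rmodule R ?Z by (rule rmodule_fg[OF fgZ])
  have "carrier ((F ^^ Suc m) M) = carrier ((F ^^ m) M)" using m by (meson le_SucI order_refl)
  then have "carrier ((F ^^ Suc m) M) = carrier ?Z" using sub[of m] sub'[of m] by blast
  then have "carrier (rad R ?Z) = carrier ?Z" by (simp add: rad_torsion_def)
  then have max: "maximal_submod R ?Z K \<Longrightarrow> carrier ?Z \<subseteq> K" for K
    using Z.mem_rad by blast
  have nm: "\<not> maximal_submod R ?Z K" for K
    using max[of K] Z.submoduleD(1)[of K] by (auto simp: maximal_submod_def)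
  have "carrier ?Z = {\<zero>\<^bsub>?Z\<^esub>}"
  proof (rule ccontr)
    assume "carrier ?Z \<noteq> {\<zero>\<^bsub>?Z\<^esub>}"
    then obtain K where "maximal_submod R ?Z K" by (rule Z.maximal_exists[OF fgZ])
    then show False using nm by blast
  qed
  then show thesis using that[of m] by (simp add: layers_le_def zero_mod_def)
qed

end

section \<open>Direct sums and retracts\<close>

lemma dsum_simps [simp]:
  "carrier (dsum Ms) = (\<Pi>\<^sub>E i\<in>{..<length Ms}. carrier (Ms ! i))"
  "\<zero>\<^bsub>dsum Ms\<^esub> = (\<lambda>i\<in>{..<length Ms}. \<zero>\<^bsub>Ms ! i\<^esub>)"
  "f \<oplus>\<^bsub>dsum Ms\<^esub> g = (\<lambda>i\<in>{..<length Ms}. f i \<oplus>\<^bsub>Ms ! i\<^esub> g i)"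
  "a \<odot>\<^bsub>dsum Ms\<^esub> f = (\<lambda>i\<in>{..<length Ms}. a \<odot>\<^bsub>Ms ! i\<^esub> f i)"
  by (simp_all add: dsum_def)

lemma rmodule_dsum:
  assumes "ring R" "\<And>i. i < length Ms \<Longrightarrow> rmodule R (Ms ! i)"
  shows "rmodule R (dsum Ms)"
proof -
  note rm = assms(2)[unfolded rmodule_def]
  note ag = right_module.axioms(2)[OF rm]
  note am = abelian_group.axioms(1)[OF ag]
  have "abelian_group (dsum Ms)"
  proof (rule abelian_groupI)
    fix f g h assume "f \<in> carrier (dsum Ms)" "g \<in> carrier (dsum Ms)" "h \<in> carrier (dsum Ms)"
    then have *: "f i \<in> carrier (Ms ! i)" "g i \<in> carrier (Ms ! i)" "h i \<in> carrier (Ms ! i)"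
      if "i < length Ms" for i using that by auto
    show "f \<oplus>\<^bsub>dsum Ms\<^esub> g \<oplus>\<^bsub>dsum Ms\<^esub> h = f \<oplus>\<^bsub>dsum Ms\<^esub> (g \<oplus>\<^bsub>dsum Ms\<^esub> h)"
      using * by (auto simp: restrict_def fun_eq_iff abelian_monoid.a_assoc[OF am])
  next
    fix f g assume "f \<in> carrier (dsum Ms)" "g \<in> carrier (dsum Ms)"
    then have *: "f i \<in> carrier (Ms ! i)" "g i \<in> carrier (Ms ! i)"
      if "i < length Ms" for i using that by auto
    show "f \<oplus>\<^bsub>dsum Ms\<^esub> g = g \<oplus>\<^bsub>dsum Ms\<^esub> f"
      using * by (auto simp: restrict_def fun_eq_iff abelian_monoid.a_comm[OF am])
    show "f \<oplus>\<^bsub>dsum Ms\<^esub> g \<in> carrier (dsum Ms)"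
      using * by (auto simp: abelian_monoid.a_closed[OF am])
  next
    fix f assume f: "f \<in> carrier (dsum Ms)"
    then have *: "f i \<in> carrier (Ms ! i)" if "i < length Ms" for i using that by auto
    show "\<zero>\<^bsub>dsum Ms\<^esub> \<oplus>\<^bsub>dsum Ms\<^esub> f = f"
      using * f by (auto simp: restrict_def fun_eq_iff abelian_monoid.l_zero[OF am] PiE_def extensional_def)
    show "\<exists>g\<in>carrier (dsum Ms). g \<oplus>\<^bsub>dsum Ms\<^esub> f = \<zero>\<^bsub>dsum Ms\<^esub>"
      using * by (intro bexI[of _ "\<lambda>i\<in>{..<length Ms}. \<ominus>\<^bsub>Ms ! i\<^esub> f i"])
        (auto simp: fun_eq_iff abelian_group.l_neg[OF ag] abelian_group.a_inv_closed[OF ag])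
  qed (auto simp: abelian_monoid.zero_closed[OF am])
  moreover have "f i \<in> carrier (Ms ! i)" if "f \<in> carrier (dsum Ms)" "i < length Ms" for f i
    using that by auto
  ultimately show ?thesis
    unfolding rmodule_def right_module_def right_module_axioms_def using assms(1)
    by (auto simp: restrict_def fun_eq_iff PiE_iff extensional_def right_module.smult_closed[OF rm]
        right_module.smult_l_distr[OF rm] right_module.smult_r_distr[OF rm]
        right_module.smult_assoc[OF rm] right_module.smult_one[OF rm]
        ring.ring_simprules(1,5)[OF assms(1)])
qed

lemma dsum_proj_hom: "i < length Ms \<Longrightarrow> (\<lambda>f. f i) \<in> mod_hom R (dsum Ms) (Ms ! i)"
  unfolding mod_hom_def by auto

lemma dsum_pair_hom:
  assumes "\<And>i. i < length Ms \<Longrightarrow> h i \<in> mod_hom R N (Ms ! i)"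
  shows "(\<lambda>x. \<lambda>i\<in>{..<length Ms}. h i x) \<in> mod_hom R N (dsum Ms)"
  using assms unfolding mod_hom_def by (auto simp: fun_eq_iff Pi_iff)

lemma mod_hom_add:
  assumes "rmodule R M" "rmodule R N" "f \<in> mod_hom R M N" "g \<in> mod_hom R M N"
  shows "(\<lambda>x. f x \<oplus>\<^bsub>N\<^esub> g x) \<in> mod_hom R M N"
proof -
  interpret f: rmodule_hom R M N f by (intro rmodule_homI assms)
  interpret g: rmodule_hom R M N g by (intro rmodule_homI assms)
  show ?thesis unfolding mod_hom_def by (auto simp: f.N.smult_r_distr f.N.M.a_ac)
qed

lemma mod_hom_zero: "rmodule R M \<Longrightarrow> rmodule R N \<Longrightarrow> (\<lambda>x. \<zero>\<^bsub>N\<^esub>) \<in> mod_hom R M N"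
proof -
  assume "rmodule R M" "rmodule R N"
  then interpret N: rmodule R N by simp
  show ?thesis unfolding mod_hom_def by simp
qed

text \<open>\<open>M\<close> is isomorphic to a direct summand of \<open>D\<close>. Stating this by
  a split pair of maps allows different carrier types and leaves the complement implicit.\<close>

definition retract :: "('a, 'b) ring_scheme \<Rightarrow> ('a, 'm) module \<Rightarrow> ('a, 'n) module \<Rightarrow> bool" where
  "retract R M D \<longleftrightarrow> (\<exists>i\<in>mod_hom R M D. \<exists>p\<in>mod_hom R D M. \<forall>x\<in>carrier M. p (i x) = x)"

lemma retractI:
  "i \<in> mod_hom R M D \<Longrightarrow> p \<in> mod_hom R D M \<Longrightarrow> (\<And>x. x \<in> carrier M \<Longrightarrow> p (i x) = x) \<Longrightarrow> retract R M D"
  unfolding retract_def by blast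

lemma retractE:
  assumes "retract R M D"
  obtains i p where "i \<in> mod_hom R M D" "p \<in> mod_hom R D M" "\<forall>x\<in>carrier M. p (i x) = x"
  using assms unfolding retract_def by blast

lemma retract_trans:
  assumes "retract R L M" "retract R M N" shows "retract R L N"
proof -
  obtain i p where ip: "i \<in> mod_hom R L M" "p \<in> mod_hom R M L" "\<forall>x\<in>carrier L. p (i x) = x"
    by (rule retractE[OF assms(1)])
  obtain j q where jq: "j \<in> mod_hom R M N" "q \<in> mod_hom R N M" "\<forall>x\<in>carrier M. q (j x) = x"
    by (rule retractE[OF assms(2)])
  have "i x \<in> carrier M" if "x \<in> carrier L" for x using ip(1) that unfolding mod_hom_def by auto
  then show ?thesis
    using ip jq by (intro retractI[OF mod_hom_compose[OF ip(1) jq(1)] mod_hom_compose[OF jq(2) ip(2)]]) simp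
qed

lemma retract_inj: "retract R M D \<Longrightarrow> \<exists>i\<in>mod_hom R M D. inj_on i (carrier M)"
  unfolding retract_def by (metis inj_on_inverseI)

text \<open>\<open>I\<close> is an arbitrary record here, as are the representatives in
  \<open>rep_finite\<close>; the two inverses are taken on the sides of \<open>M\<close> and
  \<open>N\<close>, where the module laws hold.\<close>

lemma retract_if_iso:
  assumes "rmodule R M" "rmodule R N" "mod_iso R M I" "mod_iso R N I" shows "retract R M N"
proof -
  obtain f where f: "f \<in> mod_hom R M I" "bij_betw f (carrier M) (carrier I)"
    using assms(3) unfolding mod_iso_def by blast
  obtain g where g: "g \<in> mod_hom R N I" "bij_betw g (carrier N) (carrier I)"
    using assms(4) unfolding mod_iso_def by blast
  show ?thesis
  proof (rule retractI)
    show "(\<lambda>x. inv_into (carrier N) g (f x)) \<in> mod_hom R M N"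
      by (rule mod_hom_compose[OF f(1) mod_hom_inv[OF assms(2) g]])
    show "(\<lambda>x. inv_into (carrier M) f (g x)) \<in> mod_hom R N M"
      by (rule mod_hom_compose[OF g(1) mod_hom_inv[OF assms(1) f]])
    fix x assume x: "x \<in> carrier M"
    then have "f x \<in> carrier I" using f(1) unfolding mod_hom_def by auto
    then show "inv_into (carrier M) f (g (inv_into (carrier N) g (f x))) = x"
      using bij_betw_inv_into_right[OF g(2)] bij_betw_inv_into_left[OF f(2) x] by simp
  qed
qed

lemma mod_iso_refl: "mod_iso R M M"
  unfolding mod_iso_def using mod_hom_id bij_betw_id[unfolded id_def] by blast

lemma retract_dsum_summand:
  assumes "ring R" "\<And>i. i < length Ms \<Longrightarrow> rmodule R (Ms ! i)" "i < length Ms"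
  shows "retract R (Ms ! i) (dsum Ms)"
proof (rule retractI)
  have "(if j = i then (\<lambda>x. x) else (\<lambda>x. \<zero>\<^bsub>Ms ! j\<^esub>)) \<in> mod_hom R (Ms ! i) (Ms ! j)"
    if "j < length Ms" for j
    using that mod_hom_zero[OF assms(2,2)] assms(3) mod_hom_id by auto
  then show "(\<lambda>x. \<lambda>j\<in>{..<length Ms}. (if j = i then (\<lambda>x. x) else (\<lambda>x. \<zero>\<^bsub>Ms ! j\<^esub>)) x) \<in>
      mod_hom R (Ms ! i) (dsum Ms)"
    by (rule dsum_pair_hom)
  show "(\<lambda>f. f i) \<in> mod_hom R (dsum Ms) (Ms ! i)" by (rule dsum_proj_hom[OF assms(3)])
qed (use assms(3) in simp)

text \<open>The trivial intersection makes components unique, and uniqueness makes the chosen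
  components linear.\<close>

lemma (in rmodule) decomposition_projections:
  assumes H: "submodule H R M" and K: "submodule K R M"
    and sum: "set_add M H K = carrier M" and int: "H \<inter> K = {\<zero>\<^bsub>M\<^esub>}"
  obtains u v where "u \<in> mod_hom R M (restrict_mod M H)" "v \<in> mod_hom R M (restrict_mod M K)"
    "\<And>x. x \<in> carrier M \<Longrightarrow> u x \<oplus>\<^bsub>M\<^esub> v x = x"
proof -
  note HD = submoduleD[OF H] and KD = submoduleD[OF K]
  have "\<forall>x\<in>carrier M. \<exists>y. fst y \<in> H \<and> snd y \<in> K \<and> x = fst y \<oplus>\<^bsub>M\<^esub> snd y"
    using sum unfolding set_add_iff set_eq_iff by (metis fst_conv snd_conv)
  then obtain w where w: "\<And>x. x \<in> carrier M \<Longrightarrow> fst (w x) \<in> H \<and> snd (w x) \<in> K \<and> x = fst (w x) \<oplus>\<^bsub>M\<^esub> snd (w x)"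
    by metis
  define u v where "u x = fst (w x)" and "v x = snd (w x)" for x
  have uv: "u x \<in> H" "v x \<in> K" "u x \<oplus>\<^bsub>M\<^esub> v x = x" "u x \<in> carrier M" "v x \<in> carrier M" if "x \<in> carrier M" for x
    using w[OF that] HD(2) KD(2) by (simp_all add: u_def v_def)
  have unique: "h = h' \<and> k = k'"
    if hk: "h \<in> H" "h' \<in> H" "k \<in> K" "k' \<in> K" "h \<oplus>\<^bsub>M\<^esub> k = h' \<oplus>\<^bsub>M\<^esub> k'" for h h' k k'
  proof -
    have c: "h \<in> carrier M" "h' \<in> carrier M" "k \<in> carrier M" "k' \<in> carrier M" using hk HD KD by auto
    have "(h \<ominus>\<^bsub>M\<^esub> h') \<oplus>\<^bsub>M\<^esub> k = (h \<oplus>\<^bsub>M\<^esub> k) \<ominus>\<^bsub>M\<^esub> h'" using c by (simp add: a_minus_def M.a_ac)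
    then have "(h \<ominus>\<^bsub>M\<^esub> h') \<oplus>\<^bsub>M\<^esub> k = k'" using c hk(5) by simp
    then have "h \<ominus>\<^bsub>M\<^esub> h' \<in> K" using submodule_add_cancel'[OF K hk(3)] hk(4) c by simp
    then have "h \<ominus>\<^bsub>M\<^esub> h' = \<zero>\<^bsub>M\<^esub>" using submodule_minus[OF H hk(1,2)] int by blast
    then have "h = h'" using add_minus_cancel(1)[OF c(2,1)] c by simp
    then show ?thesis using hk(5) c by simp
  qed
  have add: "u (x \<oplus>\<^bsub>M\<^esub> y) = u x \<oplus>\<^bsub>M\<^esub> u y \<and> v (x \<oplus>\<^bsub>M\<^esub> y) = v x \<oplus>\<^bsub>M\<^esub> v y"
    if xy: "x \<in> carrier M" "y \<in> carrier M" for x y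
  proof (rule unique)
    have "(u x \<oplus>\<^bsub>M\<^esub> u y) \<oplus>\<^bsub>M\<^esub> (v x \<oplus>\<^bsub>M\<^esub> v y) = (u x \<oplus>\<^bsub>M\<^esub> v x) \<oplus>\<^bsub>M\<^esub> (u y \<oplus>\<^bsub>M\<^esub> v y)"
      using uv(4,5)[OF xy(1)] uv(4,5)[OF xy(2)] by (simp add: M.a_ac)
    then show "u (x \<oplus>\<^bsub>M\<^esub> y) \<oplus>\<^bsub>M\<^esub> v (x \<oplus>\<^bsub>M\<^esub> y) = (u x \<oplus>\<^bsub>M\<^esub> u y) \<oplus>\<^bsub>M\<^esub> (v x \<oplus>\<^bsub>M\<^esub> v y)"
      using uv(3) xy by simp
  qed (use uv xy HD(4) KD(4) in simp_all)
  have smult: "u (a \<odot>\<^bsub>M\<^esub> x) = a \<odot>\<^bsub>M\<^esub> u x \<and> v (a \<odot>\<^bsub>M\<^esub> x) = a \<odot>\<^bsub>M\<^esub> v x"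
    if ax: "a \<in> carrier R" "x \<in> carrier M" for a x
  proof (rule unique)
    have "a \<odot>\<^bsub>M\<^esub> u x \<oplus>\<^bsub>M\<^esub> a \<odot>\<^bsub>M\<^esub> v x = a \<odot>\<^bsub>M\<^esub> (u x \<oplus>\<^bsub>M\<^esub> v x)"
      using uv(4,5)[OF ax(2)] ax by (simp add: smult_r_distr)
    then show "u (a \<odot>\<^bsub>M\<^esub> x) \<oplus>\<^bsub>M\<^esub> v (a \<odot>\<^bsub>M\<^esub> x) = a \<odot>\<^bsub>M\<^esub> u x \<oplus>\<^bsub>M\<^esub> a \<odot>\<^bsub>M\<^esub> v x"
      using uv(3) ax by simp
  qed (use uv ax HD(5) KD(5) in simp_all)
  have "u \<in> mod_hom R M (restrict_mod M H)" "v \<in> mod_hom R M (restrict_mod M K)"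
    unfolding mod_hom_def using uv add smult by auto
  then show thesis using that uv(3) by blast
qed

lemma retract_dsum_append:
  assumes "ring R" and M: "rmodule R M" "submodule H R M" "submodule K R M"
    "set_add M H K = carrier M" "H \<inter> K = {\<zero>\<^bsub>M\<^esub>}"
    and ret: "retract R (restrict_mod M H) (dsum Us)" "retract R (restrict_mod M K) (dsum Vs)"
    and rm: "\<And>U. U \<in> set Us \<union> set Vs \<Longrightarrow> rmodule R U"
  shows "retract R M (dsum (Us @ Vs))"
proof -
  interpret rmodule R M by fact
  let ?a = "length Us" and ?b = "length Vs" and ?D = "dsum (Us @ Vs)"
  have D: "rmodule R ?D" using rm by (intro rmodule_dsum assms(1)) (metis nth_mem set_append)
  obtain u v where uv: "u \<in> mod_hom R M (restrict_mod M H)" "v \<in> mod_hom R M (restrict_mod M K)"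
    "\<And>x. x \<in> carrier M \<Longrightarrow> u x \<oplus>\<^bsub>M\<^esub> v x = x"
    by (rule decomposition_projections[OF M(2-5)]) blast
  obtain i p where ip: "i \<in> mod_hom R (restrict_mod M H) (dsum Us)" "p \<in> mod_hom R (dsum Us) (restrict_mod M H)"
    "\<forall>x\<in>carrier (restrict_mod M H). p (i x) = x" by (rule retractE[OF ret(1)])
  obtain j q where jq: "j \<in> mod_hom R (restrict_mod M K) (dsum Vs)" "q \<in> mod_hom R (dsum Vs) (restrict_mod M K)"
    "\<forall>x\<in>carrier (restrict_mod M K). q (j x) = x" by (rule retractE[OF ret(2)])
  \<comment> \<open>The coordinates of the concatenated list: those of the
    \<open>H\<close>-component come first, those of the \<open>K\<close>-component follow, shifted
    by the length of \<open>Us\<close>.\<close>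
  define e where "e n x = (if n < ?a then i (u x) n else j (v x) (n - ?a))" for n x
  have "e n \<in> mod_hom R M ((Us @ Vs) ! n)" if "n < length (Us @ Vs)" for n
  proof (cases "n < ?a")
    case True
    then have "e n = (\<lambda>x. i (u x) n)" by (simp add: e_def fun_eq_iff)
    then show ?thesis
      using mod_hom_compose[OF mod_hom_compose[OF uv(1) ip(1)] dsum_proj_hom[OF True]] True
      by (simp add: nth_append)
  next
    case False
    then have n: "n - ?a < ?b" using that by simp
    have "e n = (\<lambda>x. j (v x) (n - ?a))" using False by (simp add: e_def fun_eq_iff)
    then show ?thesis
      using mod_hom_compose[OF mod_hom_compose[OF uv(2) jq(1)] dsum_proj_hom[OF n]] False
      by (simp add: nth_append)
  qed
  then have e: "(\<lambda>x. \<lambda>n\<in>{..<length (Us @ Vs)}. e n x) \<in> mod_hom R M ?D" by (rule dsum_pair_hom)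
  have left: "(\<lambda>f. \<lambda>n\<in>{..<?a}. f n) \<in> mod_hom R ?D (dsum Us)"
  proof (rule dsum_pair_hom)
    show "(\<lambda>f. f n) \<in> mod_hom R ?D (Us ! n)" if "n < ?a" for n
      using dsum_proj_hom[of n "Us @ Vs" R] that by (simp add: nth_append del: dsum_simps)
  qed
  have right: "(\<lambda>f. \<lambda>n\<in>{..<?b}. f (?a + n)) \<in> mod_hom R ?D (dsum Vs)"
  proof (rule dsum_pair_hom)
    show "(\<lambda>f. f (?a + n)) \<in> mod_hom R ?D (Vs ! n)" if "n < ?b" for n
      using dsum_proj_hom[of "?a + n" "Us @ Vs" R] that by (simp add: nth_append del: dsum_simps)
  qed
  have incl: "g \<in> mod_hom R ?D M" if "g \<in> mod_hom R ?D (restrict_mod M H)" "H \<subseteq> carrier M" for g H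
    using that unfolding mod_hom_def by auto
  have ret: "(\<lambda>f. p (\<lambda>n\<in>{..<?a}. f n) \<oplus>\<^bsub>M\<^esub> q (\<lambda>n\<in>{..<?b}. f (?a + n))) \<in> mod_hom R ?D M"
    using submoduleD(1)[OF M(2)] submoduleD(1)[OF M(3)]
    by (intro mod_hom_add D M(1) incl[OF mod_hom_compose[OF left ip(2)]]
        incl[OF mod_hom_compose[OF right jq(2)]])
  show ?thesis
  proof (rule retractI[OF e ret])
    fix x assume x: "x \<in> carrier M"
    have ux: "u x \<in> H" and vx: "v x \<in> K" using uv(1,2) x unfolding mod_hom_def by auto
    have iu: "i (u x) \<in> carrier (dsum Us)" and jv: "j (v x) \<in> carrier (dsum Vs)"
      using ip(1) jq(1) ux vx unfolding mod_hom_def by (auto simp del: dsum_simps)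
    have "(\<lambda>n\<in>{..<?a}. (\<lambda>n\<in>{..<length (Us @ Vs)}. e n x) n) = i (u x)"
      using iu by (auto simp: e_def fun_eq_iff restrict_def PiE_def extensional_def)
    moreover have "(\<lambda>n\<in>{..<?b}. (\<lambda>n\<in>{..<length (Us @ Vs)}. e n x) (?a + n)) = j (v x)"
      using jv by (auto simp: e_def fun_eq_iff restrict_def PiE_def extensional_def)
    ultimately show "p (\<lambda>n\<in>{..<?a}. (\<lambda>n\<in>{..<length (Us @ Vs)}. e n x) n) \<oplus>\<^bsub>M\<^esub>
        q (\<lambda>n\<in>{..<?b}. (\<lambda>n\<in>{..<length (Us @ Vs)}. e n x) (?a + n)) = x"
      using ip(3) jq(3) ux vx uv(3)[OF x] by simp
  qed
qed

text \<open>The projection to the last summand has a copy of the shorter sum as its kernel.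
  Induction from the right end is chosen because appending leaves the earlier indices in
  place.\<close>

lemma fg_dsum:
  assumes "ring R"
  shows "(\<And>M. M \<in> set Ms \<Longrightarrow> fg_module R M) \<Longrightarrow> fg_module R (dsum Ms)"
proof (induction Ms rule: rev_induct)
  case Nil
  interpret rmodule R "dsum []" by (rule rmodule_dsum) (use assms in auto)
  have "gen_submod R (dsum []) {} = carrier (dsum [])"
    unfolding gen_empty by auto
  then show ?case
    unfolding fg_module_iff fg_submod_def by blast
next
  case (snoc X Ms)
  let ?n = "length Ms" and ?D = "dsum (Ms @ [X])"
  have rm: "rmodule R ((Ms @ [X]) ! i)" if "i < length (Ms @ [X])" for i
    using snoc.prems[of "(Ms @ [X]) ! i"] nth_mem[OF that] by (simp add: rmodule_def fg_module_def)
  have X: "fg_module R X" "rmodule R X" using snoc.prems[of X] by (simp_all add: rmodule_def fg_module_def)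
  interpret D: rmodule R ?D by (rule rmodule_dsum[OF assms rm])
  have fgMs: "fg_module R (dsum Ms)" using snoc by simp
  then interpret E: rmodule R "dsum Ms" by (simp add: rmodule_def fg_module_def)
  have "(\<lambda>f. f ?n) \<in> mod_hom R ?D X" using dsum_proj_hom[of ?n "Ms @ [X]" R] by (simp del: dsum_simps)
  then interpret p: rmodule_hom R ?D X "\<lambda>f. f ?n"
    by (intro rmodule_homI D.rmodule_axioms X)
  define e where "e i = (if i < ?n then (\<lambda>f. f i) else (\<lambda>f. \<zero>\<^bsub>X\<^esub>))" for i and f :: "nat \<Rightarrow> 'c"
  have "e i \<in> mod_hom R (dsum Ms) ((Ms @ [X]) ! i)" if "i < length (Ms @ [X])" for i
    using that dsum_proj_hom[of i Ms R] mod_hom_zero[OF E.rmodule_axioms X(2)]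
    by (auto simp: e_def nth_append less_Suc_eq simp del: dsum_simps)
  then have "(\<lambda>f. \<lambda>i\<in>{..<length (Ms @ [X])}. e i f) \<in> mod_hom R (dsum Ms) ?D" by (rule dsum_pair_hom)
  then interpret e: rmodule_hom R "dsum Ms" ?D "\<lambda>f. \<lambda>i\<in>{..<length (Ms @ [X])}. e i f"
    by (intro rmodule_homI D.rmodule_axioms E.rmodule_axioms)
  have "x \<in> (\<lambda>f. f ?n) ` carrier ?D" if "x \<in> carrier X" for x
  proof (rule image_eqI[of _ _ "\<lambda>i\<in>{..<Suc ?n}. if i < ?n then \<zero>\<^bsub>Ms ! i\<^esub> else x"])
    have "\<zero>\<^bsub>Ms ! i\<^esub> \<in> carrier (Ms ! i)" if "i < ?n" for i
      using E.M.zero_closed that by (auto simp: restrict_def PiE_iff)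
    then show "(\<lambda>i\<in>{..<Suc ?n}. if i < ?n then \<zero>\<^bsub>Ms ! i\<^esub> else x) \<in> carrier ?D"
      using that by (auto simp: nth_append less_Suc_eq)
  qed simp
  moreover have "(\<lambda>f. f ?n) ` carrier ?D \<subseteq> carrier X"
    using p.f_closed by (simp add: image_subset_iff del: dsum_simps)
  ultimately have im: "(\<lambda>f. f ?n) ` carrier ?D = carrier X" by blast
  have ker: "{f \<in> carrier ?D. f ?n = \<zero>\<^bsub>X\<^esub>} = (\<lambda>f. \<lambda>i\<in>{..<length (Ms @ [X])}. e i f) ` carrier (dsum Ms)"
  proof (intro equalityI subsetI)
    fix f assume f: "f \<in> {f \<in> carrier ?D. f ?n = \<zero>\<^bsub>X\<^esub>}"
    show "f \<in> (\<lambda>f. \<lambda>i\<in>{..<length (Ms @ [X])}. e i f) ` carrier (dsum Ms)"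
    proof (rule image_eqI[of _ _ "restrict f {..<?n}"])
      show "f = (\<lambda>i\<in>{..<length (Ms @ [X])}. e i (restrict f {..<?n}))"
        using f by (auto simp: e_def fun_eq_iff restrict_def PiE_def extensional_def less_Suc_eq)
      show "restrict f {..<?n} \<in> carrier (dsum Ms)"
        using f by (auto simp: PiE_iff nth_append less_Suc_eq split: if_splits)
    qed
  next
    fix f assume "f \<in> (\<lambda>f. \<lambda>i\<in>{..<length (Ms @ [X])}. e i f) ` carrier (dsum Ms)"
    then obtain g where g: "g \<in> carrier (dsum Ms)" "f = (\<lambda>i\<in>{..<length (Ms @ [X])}. e i g)" by blast
    then show "f \<in> {f \<in> carrier ?D. f ?n = \<zero>\<^bsub>X\<^esub>}"
      using e.f_closed[OF g(1)] by (simp add: e_def del: dsum_simps)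
  qed
  have "fg_submod R ?D (carrier ?D)"
  proof (rule p.fg_submod_if_image_kernel)
    show "fg_submod R X ((\<lambda>f. f ?n) ` carrier ?D)" using X p.N.fg_module_iff unfolding im by blast
    show "fg_submod R ?D {f \<in> carrier ?D. f ?n = \<zero>\<^bsub>X\<^esub>}"
      unfolding ker using e.fg_submod_image fgMs E.fg_module_iff by blast
  qed
  then show ?case using D.fg_module_iff by blast
qed

lemma (in rmodule) retract_zero:
  assumes "ring R" "carrier M = {\<zero>\<^bsub>M\<^esub>}" shows "retract R M (dsum [])"
proof -
  have D: "rmodule R (dsum [])" by (rule rmodule_dsum[OF assms(1)]) simp
  show ?thesis
    using assms(2) mod_hom_zero[OF rmodule_axioms D] mod_hom_zero[OF D rmodule_axioms]
    by (intro retractI[of "\<lambda>_. \<zero>\<^bsub>dsum []\<^esub>" _ _ _ "\<lambda>_. \<zero>\<^bsub>M\<^esub>"]) auto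
qed

section \<open>Copies in the fixed carrier type and additive closures\<close>

context artin_alg
begin

lemma fg_regular: "fg_module R (regular_mod R)"
proof -
  interpret rmodule R "regular_mod R" by (rule R.rmodule_regular)
  have one: "\<one>\<^bsub>R\<^esub> \<in> carrier (regular_mod R)" by simp
  have sub: "submodule (gen_submod R (regular_mod R) {\<one>\<^bsub>R\<^esub>}) R (regular_mod R)"
    using one by (intro submodule_gen) simp
  have "a \<in> gen_submod R (regular_mod R) {\<one>\<^bsub>R\<^esub>}" if "a \<in> carrier R" for a
    using submoduleD(5)[OF sub that, of "\<one>\<^bsub>R\<^esub>"] gen_upper[of "{\<one>\<^bsub>R\<^esub>}"] that by simp
  then have "gen_submod R (regular_mod R) {\<one>\<^bsub>R\<^esub>} = carrier (regular_mod R)"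
    using submoduleD(1)[OF sub] by auto
  then show ?thesis unfolding fg_module_iff fg_submod_def using one by (intro exI[of _ "{\<one>\<^bsub>R\<^esub>}"]) simp
qed

text \<open>Direct sums, quotients and the regular module have other carrier types; this brings them
  into the fixed one, with both mutually inverse maps at hand.\<close>

lemma modcat_copy:
  assumes "fg_module R M"
  obtains N e e' where "N \<in> modcat R" "fg_module R N" "e \<in> mod_hom R M N" "e' \<in> mod_hom R N M"
    "bij_betw e (carrier M) (carrier N)" "bij_betw e' (carrier N) (carrier M)"
    "\<And>x. x \<in> carrier M \<Longrightarrow> e' (e x) = x" "\<And>y. y \<in> carrier N \<Longrightarrow> e (e' y) = y"
proof -
  obtain N e where N: "N \<in> modcat R" "e \<in> mod_hom R M N" "bij_betw e (carrier M) (carrier N)"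
    using fg_module_iso_modcat[OF assms] unfolding mod_iso_def by blast
  show thesis
    using N bij_betw_inv_into[OF N(3)] bij_betw_inv_into_left[OF N(3)] bij_betw_inv_into_right[OF N(3)]
    by (intro that[of N e "inv_into (carrier M) e"] mod_hom_inv rmodule_fg assms) (simp_all add: modcat_def)
qed

text \<open>The kernel \<open>K\<close> of the retraction \<open>p\<close> is the complement
  required by \<open>add_closure\<close>: the map sending \<open>(m, y)\<close> to
  \<open>i m + y\<close> is an isomorphism onto the sum. \<open>Y\<close> is a copy of
  \<open>K\<close> in the fixed type.\<close>

lemma retract_imp_add_closure:
  assumes M: "M \<in> modcat R" and ret: "retract R M (dsum Us)" and Us: "set Us \<subseteq> \<U>" "set Us \<subseteq> modcat R"
  shows "M \<in> add_closure R \<U>"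
proof -
  let ?D = "dsum Us"
  have fgD: "fg_module R ?D" using Us(2) by (intro fg_dsum R.ring_axioms) (auto simp: modcat_def)
  have fgM: "fg_module R M" using M by (simp add: modcat_def)
  obtain i p where ip: "i \<in> mod_hom R M ?D" "p \<in> mod_hom R ?D M" "\<forall>x\<in>carrier M. p (i x) = x"
    by (rule retractE[OF ret])
  interpret i: rmodule_hom R M ?D i by (intro rmodule_homI rmodule_fg fgM fgD ip)
  interpret p: rmodule_hom R ?D M p by (intro rmodule_homI rmodule_fg fgM fgD ip)
  define K where "K = {d \<in> carrier ?D. p d = \<zero>\<^bsub>M\<^esub>}"
  have K: "submodule K R ?D" unfolding K_def by (rule p.submodule_kernel)
  obtain Y e e' where Y: "Y \<in> modcat R" "fg_module R Y" "e \<in> mod_hom R (restrict_mod ?D K) Y"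
    "e' \<in> mod_hom R Y (restrict_mod ?D K)"
    "bij_betw e (carrier (restrict_mod ?D K)) (carrier Y)" "bij_betw e' (carrier Y) (carrier (restrict_mod ?D K))"
    "\<And>x. x \<in> carrier (restrict_mod ?D K) \<Longrightarrow> e' (e x) = x" "\<And>y. y \<in> carrier Y \<Longrightarrow> e (e' y) = y"
    using modcat_copy[OF fg_restrict[OF fgD K]] by metis
  have KD: "K \<subseteq> carrier ?D" unfolding K_def by blast
  have e'D: "e' \<in> mod_hom R Y ?D" using Y(4) KD unfolding mod_hom_def by (auto simp del: dsum_simps)
  interpret e': rmodule_hom R Y ?D e' by (intro rmodule_homI rmodule_fg Y fgD e'D)
  let ?E = "dsum [M, Y]"
  have fgE: "fg_module R ?E" using fgM Y(2) by (intro fg_dsum R.ring_axioms) auto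
  have pr: "(\<lambda>f. f 0) \<in> mod_hom R ?E M" "(\<lambda>f. f 1) \<in> mod_hom R ?E Y"
    using dsum_proj_hom[of 0 "[M, Y]" R] dsum_proj_hom[of 1 "[M, Y]" R] by (simp_all del: dsum_simps)
  define h where "h f = i (f 0) \<oplus>\<^bsub>?D\<^esub> e' (f 1)" for f :: "nat \<Rightarrow> (nat \<Rightarrow> 'a) set"
  have "h \<in> mod_hom R ?E ?D"
    unfolding h_def by (intro mod_hom_add rmodule_fg fgE fgD mod_hom_compose[OF pr(1) ip(1)]
        mod_hom_compose[OF pr(2) e'D])
  then interpret h: rmodule_hom R ?E ?D h by (intro rmodule_homI rmodule_fg fgE fgD)
  have comp: "f 0 \<in> carrier M" "f 1 \<in> carrier Y" if "f \<in> carrier ?E" for f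
    using pr that unfolding mod_hom_def by (simp_all add: Pi_iff del: dsum_simps)
  have e'K: "e' y \<in> carrier ?D" "p (e' y) = \<zero>\<^bsub>M\<^esub>" if "y \<in> carrier Y" for y
    using Y(6) that unfolding bij_betw_def K_def by (auto simp del: dsum_simps)
  have inj: "inj_on h (carrier ?E)"
    unfolding h.inj_iff_kernel
  proof (intro ballI impI)
    fix f assume f: "f \<in> carrier ?E" and h0: "h f = \<zero>\<^bsub>?D\<^esub>"
    note c = comp[OF f]
    have "p (h f) = f 0"
      unfolding h_def using p.f_add[OF i.f_closed[OF c(1)] e'K(1)[OF c(2)]] bspec[OF ip(3) c(1)] e'K(2)[OF c(2)] c(1)
      by (simp del: dsum_simps)
    then have f0: "f 0 = \<zero>\<^bsub>M\<^esub>" using h0 p.f_zero by simp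
    then have "e' (f 1) = \<zero>\<^bsub>?D\<^esub>" using h0 e'.f_closed[OF c(2)] i.f_zero unfolding h_def
      by (simp del: dsum_simps)
    then have f1: "f 1 = \<zero>\<^bsub>Y\<^esub>"
      using Y(6) c(2) e'.inj_iff_kernel unfolding bij_betw_def by blast
    show "f = \<zero>\<^bsub>?E\<^esub>"
      using f f0 f1 by (auto simp: fun_eq_iff restrict_def PiE_def extensional_def less_Suc_eq numeral_2_eq_2)
  qed
  have "d \<in> h ` carrier ?E" if d: "d \<in> carrier ?D" for d
  proof -
    \<comment> \<open>The component of \<open>d\<close> in the kernel of \<open>p\<close>;
      \<open>d\<close> comes from the pair of \<open>p d\<close> and this element.\<close>
    let ?k = "d \<ominus>\<^bsub>?D\<^esub> i (p d)"
    have pd: "p d \<in> carrier M" by (rule p.f_closed[OF d])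
    have ipd: "i (p d) \<in> carrier ?D" by (rule i.f_closed[OF pd])
    have "p ?k = \<zero>\<^bsub>M\<^esub>"
      using p.f_minus[OF d ipd] bspec[OF ip(3) pd] pd by (simp add: a_minus_def i.M.M.r_neg del: dsum_simps)
    then have k: "?k \<in> K" unfolding K_def using i.N.M.minus_closed[OF d ipd] by simp
    have eY: "e ?k \<in> carrier Y" using k Y(3) unfolding mod_hom_def by (auto simp del: dsum_simps)
    define f where "f = (\<lambda>n\<in>{..<length [M, Y]}. if n = 0 then p d else e ?k)"
    have f01: "f 0 = p d" "f 1 = e ?k" by (simp_all add: f_def)
    have "f \<in> carrier ?E" using pd eY by (auto simp: f_def less_Suc_eq)
    moreover have "h f = d"
      unfolding h_def f01 using Y(7)[of ?k] k i.N.add_minus_cancel(1)[OF ipd d] by (simp del: dsum_simps)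
    ultimately show ?thesis by blast
  qed
  then have "h ` carrier ?E = carrier ?D" using h.f_closed by blast
  then have "mod_iso R ?E ?D"
    unfolding mod_iso_def using h.hom inj by (auto simp: bij_betw_def simp del: dsum_simps)
  then show ?thesis unfolding add_closure_def using M Y(1) Us(1) by blast
qed

end

section \<open>Extension layers in the representation-finite case\<close>

context artin_simples
begin

lemma layers_le_if_hom_inj:
  "f \<in> mod_hom R L M \<Longrightarrow> inj_on f (carrier L) \<Longrightarrow> fg_module R L \<Longrightarrow> fg_module R M \<Longrightarrow>
    layers_le n M \<Longrightarrow> layers_le n L"
  by (rule layers_le_inj[OF rmodule_homI[OF rmodule_fg rmodule_fg]])

lemma layers_le_restrict:
  assumes "fg_module R M" "submodule H R M" "layers_le n M"
  shows "layers_le n (restrict_mod M H)"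
proof (rule layers_le_if_hom_inj)
  show "(\<lambda>x. x) \<in> mod_hom R (restrict_mod M H) M"
    using rmodule.submoduleD(2)[OF rmodule_fg[OF assms(1)] assms(2)] unfolding mod_hom_def by auto
qed (use assms fg_restrict in auto)

text \<open>Each coordinate projection maps t(F^n) of the sum into t(F^n) of the summand, which is
  zero; so all coordinates vanish.\<close>

lemma layers_le_dsum:
  assumes "\<And>M. M \<in> set Ms \<Longrightarrow> fg_module R M \<and> layers_le n M"
  shows "layers_le n (dsum Ms)"
proof -
  have fgD: "fg_module R (dsum Ms)" using assms by (intro fg_dsum R.ring_axioms) blast
  interpret D: rmodule R "dsum Ms" by (rule rmodule_fg[OF fgD])
  note FD = fg_funpow[OF fgD, of n]
  have "z = \<zero>\<^bsub>dsum Ms\<^esub>" if z: "z \<in> carrier (t ((F ^^ n) (dsum Ms)))" for z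
  proof -
    have "z \<in> carrier ((F ^^ n) (dsum Ms))"
      using z torsion_sub_props(2)[OF FD] rmodule.submoduleD(2)[OF rmodule_fg[OF FD]] by blast
    then have zD: "z \<in> carrier (dsum Ms)" using D.submoduleD(2)[OF funpow_submodule[OF fgD]] by blast
    have "z i = \<zero>\<^bsub>Ms ! i\<^esub>" if i: "i < length Ms" for i
    proof -
      have fgi: "fg_module R (Ms ! i)" "layers_le n (Ms ! i)" using assms nth_mem[OF i] by blast+
      interpret rmodule_hom R "dsum Ms" "Ms ! i" "\<lambda>f. f i"
        by (intro rmodule_homI rmodule_fg fgD fgi dsum_proj_hom i)
      interpret tn: rmodule_hom R "t ((F ^^ n) (dsum Ms))" "t ((F ^^ n) (Ms ! i))" "\<lambda>f. f i"
        by (intro torsion_sub_hom funpow_hom fg_funpow fgD fgi rmodule_hom_axioms)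
      show ?thesis using tn.f_closed[OF z] fgi(2) layers_le_iff[OF fgi(1)] by blast
    qed
    then show ?thesis using zD by (auto simp: fun_eq_iff restrict_def PiE_def extensional_def)
  qed
  then show ?thesis using layers_le_iff[OF fgD] by blast
qed

text \<open>A direct summand of a finite sum embeds into that sum, and the bound passes to finite
  sums and to submodules.\<close>

lemma add_closure_layers_le:
  assumes "\<And>U. U \<in> \<U> \<Longrightarrow> U \<in> modcat R \<and> layers_le n U" "M \<in> add_closure R \<U>"
  shows "M \<in> modcat R \<and> layers_le n M"
proof -
  obtain Y Us where *: "M \<in> modcat R" "Y \<in> modcat R" "set Us \<subseteq> \<U>" "mod_iso R (dsum [M, Y]) (dsum Us)"
    using assms(2) unfolding add_closure_def by blast
  have fg: "fg_module R M" "fg_module R Y" using * by (simp_all add: modcat_def)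
  have Us: "fg_module R U \<and> layers_le n U" if "U \<in> set Us" for U
    using assms(1) *(3) that by (auto simp: modcat_def)
  have D: "fg_module R (dsum Us)" "fg_module R (dsum [M, Y])"
    using Us fg by (auto intro!: fg_dsum R.ring_axioms)
  have rm: "rmodule R ([M, Y] ! i)" if "i < length [M, Y]" for i
    using that fg rmodule_fg by (auto simp: less_Suc_eq)
  obtain e where e: "e \<in> mod_hom R (dsum [M, Y]) (dsum Us)" "bij_betw e (carrier (dsum [M, Y])) (carrier (dsum Us))"
    using *(4) unfolding mod_iso_def by blast
  have "layers_le n (dsum [M, Y])"
    using layers_le_if_hom_inj[OF e(1) _ D(2,1) layers_le_dsum[OF Us]] e(2) by (simp add: bij_betw_def)
  moreover have "retract R M (dsum [M, Y])"
    using retract_dsum_summand[OF R.ring_axioms rm, where i = 0] by (simp del: dsum_simps)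
  then obtain i where "i \<in> mod_hom R M (dsum [M, Y])" "inj_on i (carrier M)"
    using retract_inj by blast
  ultimately have "layers_le n M" using layers_le_if_hom_inj fg(1) D(2) by blast
  then show ?thesis using *(1) by blast
qed

text \<open>\<open>P\<close> is in essence a free module, built with one more copy of the ring for
  each generator. The sum leaves the carrier type at every step, so it is copied back, and only its
  bound and its map to \<open>M\<close> are remembered. For no generators the zero map from one copy
  of the ring serves.\<close>

lemma layers_le_if_generated:
  assumes M: "fg_module R M" and n: "layers_le n (regular_mod R)" and A: "finite A" "A \<subseteq> carrier M"
  shows "\<exists>P g. fg_module R P \<and> layers_le n P \<and> g \<in> mod_hom R P M \<and>
    g ` carrier (P :: 'a rmod) = gen_submod R M A"
proof -
  interpret M: rmodule R M by (rule rmodule_fg[OF M])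
  obtain Q :: "'a rmod" and e e' where Q: "fg_module R Q" "e \<in> mod_hom R (regular_mod R) Q"
    "e' \<in> mod_hom R Q (regular_mod R)"
    "bij_betw e' (carrier Q) (carrier (regular_mod R))"
    using modcat_copy[OF fg_regular] by metis
  have lQ: "layers_le n Q"
    using layers_le_if_hom_inj[OF Q(3) _ Q(1) fg_regular n] Q(4) by (simp add: bij_betw_def)
  interpret Q: rmodule R Q by (rule rmodule_fg[OF Q(1)])
  show ?thesis
    using A
  proof (induction A rule: finite_induct)
    case empty
    have "(\<lambda>_. \<zero>\<^bsub>M\<^esub>) ` carrier Q = gen_submod R M {}"
      unfolding M.gen_empty using Q.M.zero_closed by auto
    then show ?case using Q(1) lQ mod_hom_zero[OF Q.rmodule_axioms M.rmodule_axioms] by blast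
  next
    case (insert x A)
    then obtain P :: "'a rmod" and g where P: "fg_module R P" "layers_le n P" "g \<in> mod_hom R P M"
      "g ` carrier P = gen_submod R M A" by auto
    have xM: "x \<in> carrier M" using insert by simp
    let ?D = "dsum [P, Q]"
    have D: "fg_module R ?D" using P Q by (auto intro!: fg_dsum R.ring_axioms)
    have lD: "layers_le n ?D" by (rule layers_le_dsum) (use P Q lQ in auto)
    have pr: "(\<lambda>f. f 0) \<in> mod_hom R ?D P" "(\<lambda>f. f 1) \<in> mod_hom R ?D Q"
      using dsum_proj_hom[of 0 "[P, Q]" R] dsum_proj_hom[of 1 "[P, Q]" R] by (simp_all del: dsum_simps)
    define h where "h f = g (f 0) \<oplus>\<^bsub>M\<^esub> e' (f 1) \<odot>\<^bsub>M\<^esub> x" for f :: "nat \<Rightarrow> (nat \<Rightarrow> 'a) set"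
    have h: "h \<in> mod_hom R ?D M"
      unfolding h_def
      by (intro mod_hom_add rmodule_fg D M mod_hom_compose[OF pr(1) P(3)]
          mod_hom_compose[OF mod_hom_compose[OF pr(2) Q(3)] rmodule_hom.hom[OF M.regular_hom[OF xM]]])
    have gen: "gen_submod R M (insert x A) =
        set_add M (g ` carrier P) ((\<lambda>a. a \<odot>\<^bsub>M\<^esub> x) ` carrier R)"
      using insert xM P(4) by (simp add: M.gen_insert)
    have him: "h ` carrier ?D = gen_submod R M (insert x A)"
    proof (intro equalityI subsetI)
      fix y assume "y \<in> h ` carrier ?D"
      then obtain f where f: "f \<in> carrier ?D" "y = h f" by blast
      have "f 0 \<in> carrier P" "f 1 \<in> carrier Q"
        using pr f(1) unfolding mod_hom_def by (simp_all add: Pi_iff del: dsum_simps)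
      moreover from this have "e' (f 1) \<in> carrier R" using Q(3) unfolding mod_hom_def by auto
      ultimately show "y \<in> gen_submod R M (insert x A)"
        using f(2) unfolding h_def gen set_add_iff by blast
    next
      fix y assume "y \<in> gen_submod R M (insert x A)"
      then obtain p a where pa: "p \<in> carrier P" "a \<in> carrier R" "y = g p \<oplus>\<^bsub>M\<^esub> a \<odot>\<^bsub>M\<^esub> x"
        unfolding gen set_add_iff by blast
      then obtain q where q: "q \<in> carrier Q" "e' q = a"
        using Q(4) unfolding bij_betw_def by (metis imageE regular_mod_simps(1))
      define f where "f = (\<lambda>i\<in>{..<length [P, Q]}. if i = 0 then p else q)"
      have "f 0 = p" "f 1 = q" by (simp_all add: f_def)
      then have "y = h f" using pa q by (simp add: h_def)
      moreover have "f \<in> carrier ?D" using pa q by (auto simp: f_def less_Suc_eq)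
      ultimately show "y \<in> h ` carrier ?D" by blast
    qed
    obtain D' :: "'a rmod" and u u' where D': "fg_module R D'" "u \<in> mod_hom R ?D D'" "u' \<in> mod_hom R D' ?D"
      "bij_betw u' (carrier D') (carrier ?D)"
      using modcat_copy[OF D] by metis
    have "layers_le n D'"
      using layers_le_if_hom_inj[OF D'(3) _ D'(1) D lD] D'(4) by (simp add: bij_betw_def)
    moreover have "(\<lambda>y. h (u' y)) ` carrier D' = gen_submod R M (insert x A)"
      using D'(4) him unfolding bij_betw_def by (metis image_image)
    ultimately show ?case using D'(1) mod_hom_compose[OF D'(3) h] by blast
  qed
qed

lemma layers_le_regular:
  assumes M: "fg_module R M" and n: "layers_le n (regular_mod R)" shows "layers_le n M"
proof -
  interpret M: rmodule R M by (rule rmodule_fg[OF M])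
  obtain A where A: "finite A" "A \<subseteq> carrier M" "gen_submod R M A = carrier M"
    using M unfolding fg_module_def by blast
  obtain P :: "'a rmod" and g where P: "fg_module R P" "layers_le n P" "g \<in> mod_hom R P M"
    "g ` carrier P = carrier M"
    using layers_le_if_generated[OF M n A(1,2)] A(3) by auto
  show ?thesis
    using layers_le_onto[OF rmodule_homI[OF rmodule_fg[OF P(1)] M.rmodule_axioms P(3)] P(1) M P(4,2)] .
qed

text \<open>A minimal submodule of \<open>M\<close> that is no retract of a power of
  \<open>X\<close> is nonzero, since the empty power covers zero, and it is decomposable, since it
  inherits the bound \<open>d\<close>. Its two proper summands are retracts of powers by minimality,
  and the two powers are concatenated.\<close>

lemma retract_power_if_indecomposables:
  assumes X: "X \<in> modcat R"
    and ind: "\<And>N. N \<in> modcat R \<Longrightarrow> indecomposable_mod R N \<Longrightarrow> layers_le d N \<Longrightarrow> retract R N X"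
    and M: "M \<in> modcat R" "layers_le d M"
  shows "\<exists>n. retract R M (dsum (replicate n X))"
proof (rule ccontr)
  assume bad: "\<not> ?thesis"
  have fg: "fg_module R M" "fg_module R X" using M X by (simp_all add: modcat_def)
  interpret M: rmodule R M by (rule rmodule_fg[OF fg(1)])
  have rmX: "rmodule R X" by (rule rmodule_fg[OF fg(2)])
  define P where "P H \<longleftrightarrow> \<not> (\<exists>n. retract R (restrict_mod M H) (dsum (replicate n X)))" for H
  have "P (carrier M)" using bad by (simp add: P_def)
  then obtain H where H: "submodule H R M" "P H" "\<And>L. submodule L R M \<Longrightarrow> P L \<Longrightarrow> L \<subseteq> H \<Longrightarrow> L = H"
    using dcc_minimal[OF fg_dcc[OF fg(1)] M.submodule_carrier, of P] by blast
  let ?N = "restrict_mod M H"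
  interpret N: rmodule R ?N by (rule M.rmodule_restrict[OF H(1)])
  have N: "?N \<in> modcat R" "layers_le d ?N"
    using fg_restrict[OF fg(1) H(1)] layers_le_restrict[OF fg(1) H(1) M(2)] by (simp_all add: modcat_def)
  have "\<not> indecomposable_mod R ?N"
  proof
    assume "indecomposable_mod R ?N"
    then have "retract R ?N X" by (rule ind[OF N(1) _ N(2)])
    moreover have "retract R X (dsum (replicate 1 X))"
      using retract_dsum_summand[OF R.ring_axioms, of "[X]" 0] rmX by (simp del: dsum_simps)
    ultimately show False using H(2) retract_trans unfolding P_def by blast
  qed
  moreover have "\<not> zero_mod ?N"
  proof
    assume "zero_mod ?N"
    then have "retract R ?N (dsum (replicate 0 X))"
      using N.retract_zero[OF R.ring_axioms] unfolding zero_mod_def by (simp del: dsum_simps)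
    then show False using H(2) unfolding P_def by blast
  qed
  ultimately obtain U V where UV: "submodule U R ?N" "submodule V R ?N" "set_add ?N U V = carrier ?N"
    "U \<inter> V = {\<zero>\<^bsub>?N\<^esub>}" "U \<noteq> {\<zero>\<^bsub>?N\<^esub>}" "V \<noteq> {\<zero>\<^bsub>?N\<^esub>}"
    unfolding indecomposable_mod_def using N.right_module_axioms by blast
  have sub: "submodule U R M" "U \<subseteq> H" "submodule V R M" "V \<subseteq> H"
    using UV(1,2) M.submodule_restrict[OF H(1)] by blast+
  have "U \<noteq> H" "V \<noteq> H" using UV(4-6) sub by blast+
  then have "\<not> P U" "\<not> P V" using H(3) sub by blast+
  then obtain a b where "retract R (restrict_mod ?N U) (dsum (replicate a X))"
    "retract R (restrict_mod ?N V) (dsum (replicate b X))" unfolding P_def by auto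
  then have "retract R ?N (dsum (replicate a X @ replicate b X))"
    using rmX by (intro retract_dsum_append[OF R.ring_axioms N.rmodule_axioms UV(1-4)]) auto
  then show False using H(2) unfolding P_def replicate_add[symmetric] by blast
qed

text \<open>The finitely many representatives are treated one by one: when some indecomposable
  module with the bound \<open>d\<close> is isomorphic to the representative, that module is added
  to \<open>X\<close> as a summand. Each sum is copied back into the fixed type.\<close>

lemma additive_generator_exists:
  assumes "rep_finite R"
  obtains X where "X \<in> modcat R" "layers_le d X"
    "\<And>N. N \<in> modcat R \<Longrightarrow> indecomposable_mod R N \<Longrightarrow> layers_le d N \<Longrightarrow> retract R N X"
proof -
  define good where "good N \<longleftrightarrow> N \<in> modcat R \<and> indecomposable_mod R N \<and> layers_le d N" for N
  obtain \<I> :: "'a rmod set" where I: "finite \<I>"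
    "\<And>N. N \<in> modcat R \<Longrightarrow> indecomposable_mod R N \<Longrightarrow> \<exists>I\<in>\<I>. mod_iso R N I"
    using assms unfolding rep_finite_def by blast
  have "\<exists>X. X \<in> modcat R \<and> layers_le d X \<and> (\<forall>N. good N \<longrightarrow> (\<exists>I\<in>\<I>. mod_iso R N I) \<longrightarrow> retract R N X)"
    using I(1)
  proof (induction \<I> rule: finite_induct)
    case empty
    obtain Q :: "'a rmod" where Q: "fg_module R Q" using modcat_copy[OF fg_regular] by metis
    interpret Q: rmodule R Q by (rule rmodule_fg[OF Q])
    \<comment> \<open>The empty sum, realised in the fixed type as the zero submodule of a copy of
      the ring.\<close>
    let ?Z = "restrict_mod Q {\<zero>\<^bsub>Q\<^esub>}"
    have Z: "fg_module R ?Z" by (rule fg_restrict[OF Q Q.submodule_singleton])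
    have "carrier (t ((F ^^ d) ?Z)) \<subseteq> carrier ((F ^^ d) ?Z)"
      using torsion_sub_props(2)[OF fg_funpow[OF Z, of d]]
        rmodule.submoduleD(1)[OF rmodule_fg[OF fg_funpow[OF Z, of d]]] by blast
    also have "\<dots> \<subseteq> {\<zero>\<^bsub>Q\<^esub>}"
      using rmodule.submoduleD(1)[OF rmodule_fg[OF Z] funpow_submodule[OF Z, of d]] by simp
    finally have "layers_le d ?Z" using layers_le_iff[OF Z] by auto
    then show ?case using Z unfolding modcat_def by blast
  next
    case (insert I J)
    then obtain X where X: "X \<in> modcat R" "layers_le d X"
      "\<And>N I. good N \<Longrightarrow> I \<in> J \<Longrightarrow> mod_iso R N I \<Longrightarrow> retract R N X" by blast
    show ?case
    proof (cases "\<exists>N. good N \<and> mod_iso R N I")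
      case False
      then show ?thesis using X by blast
    next
      case True
      \<comment> \<open>\<open>I\<close> itself need not be a module (its zero is unconstrained), so a module isomorphic to it is added.\<close>
      then obtain N0 where N0: "good N0" "mod_iso R N0 I" by blast
      have fg: "fg_module R X" "fg_module R N0" using X(1) N0(1) by (simp_all add: good_def modcat_def)
      let ?D = "dsum [X, N0]"
      have D: "fg_module R ?D" using fg by (auto intro!: fg_dsum R.ring_axioms)
      have lD: "layers_le d ?D" by (rule layers_le_dsum) (use fg X N0 in \<open>auto simp: good_def\<close>)
      obtain D' :: "'a rmod" and u u' where D': "D' \<in> modcat R" "fg_module R D'" "u \<in> mod_hom R ?D D'"
        "u' \<in> mod_hom R D' ?D" "bij_betw u (carrier ?D) (carrier D')" "bij_betw u' (carrier D') (carrier ?D)"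
        using modcat_copy[OF D] by metis
      have lD': "layers_le d D'"
        using layers_le_if_hom_inj[OF D'(4) _ D'(2) D lD] D'(6) by (simp add: bij_betw_def)
      have DD': "retract R ?D D'"
        using D'(3,5) retract_if_iso[OF rmodule_fg[OF D] rmodule_fg[OF D'(2)] _ mod_iso_refl]
        unfolding mod_iso_def by blast
      have rm: "rmodule R ([X, N0] ! i)" if "i < length [X, N0]" for i
        using that fg rmodule_fg by (auto simp: less_Suc_eq)
      have r: "retract R X D'" "retract R N0 D'"
        using retract_trans[OF retract_dsum_summand[OF R.ring_axioms rm, of 0] DD']
          retract_trans[OF retract_dsum_summand[OF R.ring_axioms rm, of 1] DD'] by (simp_all del: dsum_simps)
      have "retract R N D'" if N: "good N" "I' \<in> insert I J" "mod_iso R N I'" for N I'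
      proof (cases "I' = I")
        case True
        have "retract R N N0"
          using N N0 True by (intro retract_if_iso rmodule_fg) (auto simp: good_def modcat_def)
        then show ?thesis using r(2) by (rule retract_trans)
      next
        case False
        then show ?thesis using X(3)[OF N(1) _ N(3)] N(2) r(1) retract_trans by blast
      qed
      then show ?thesis using D'(1) lD' by blast
    qed
  qed
  then obtain X where X: "X \<in> modcat R" "layers_le d X"
    "\<forall>N. good N \<longrightarrow> (\<exists>I\<in>\<I>. mod_iso R N I) \<longrightarrow> retract R N X" by blast
  show thesis
  proof (rule that[OF X(1,2)])
    show "retract R N X" if "N \<in> modcat R" "indecomposable_mod R N" "layers_le d N" for N
      using X(3) I(2)[OF that(1,2)] that by (simp add: good_def)
  qed
qed

text \<open>The submodule uses up the remaining \<open>d\<close> powers of \<open>F\<close>. For the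
  quotient, F^n commutes with the projection, so F^n(M/F^n(M)) is the image of F^n(M), which is
  zero.\<close>

lemma layers_le_split:
  assumes M: "fg_module R M" and le: "layers_le (d + n) M"
  shows "layers_le d ((F ^^ n) M)" "layers_le n (quot_mod M (carrier ((F ^^ n) M)))"
proof -
  interpret M: rmodule R M by (rule rmodule_fg[OF M])
  show "layers_le d ((F ^^ n) M)" using le by (simp add: layers_le_def funpow_add)
  let ?L = "carrier ((F ^^ n) M)" let ?Q = "quot_mod M ?L"
  note L = funpow_submodule[OF M, of n]
  have Q: "fg_module R ?Q" by (rule M.fg_quot[OF M L])
  interpret p: rmodule_hom R M ?Q "\<lambda>x. ?L +>\<^bsub>M\<^esub> x"
    by (intro rmodule_homI M.rmodule_axioms rmodule_fg[OF Q] M.quot_proj_hom L)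
  have "carrier (t ((F ^^ n) ?Q)) \<subseteq> carrier ((F ^^ n) ?Q)"
    using torsion_sub_props(2)[OF fg_funpow[OF Q, of n]]
      rmodule.submoduleD(1)[OF rmodule_fg[OF fg_funpow[OF Q, of n]]] by blast
  also have "\<dots> = (\<lambda>x. ?L +>\<^bsub>M\<^esub> x) ` ?L"
    by (rule funpow_onto[symmetric, OF p.rmodule_hom_axioms M Q]) (simp add: quot_mod_carrier)
  also have "\<dots> \<subseteq> {?L}"
    using M.r_coset_zero_iff[OF L] M.submoduleD(2)[OF L] by (simp add: image_subset_iff)
  finally show "layers_le n ?Q" unfolding layers_le_iff[OF Q] by auto
qed

text \<open>For index one the claim is that \<open>X\<close> generates all modules with the bound
  \<open>d\<close> under sums and summands. In the induction, subadditivity bounds every extension,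
  and conversely \<open>M\<close> is itself an extension obtained by splitting off a power of
  \<open>F\<close>.\<close>

lemma ext_layer_eq:
  assumes X: "X \<in> modcat R" "layers_le d X"
    "\<And>N. N \<in> modcat R \<Longrightarrow> indecomposable_mod R N \<Longrightarrow> layers_le d N \<Longrightarrow> retract R N X"
  shows "ext_layer R X (Suc n) = {M \<in> modcat R. layers_le (Suc n * d) M}"
proof -
  have add: "add_closure R {X} = {M \<in> modcat R. layers_le d M}"
  proof (intro equalityI subsetI)
    show "M \<in> {M \<in> modcat R. layers_le d M}" if "M \<in> add_closure R {X}" for M
      using add_closure_layers_le[OF _ that, of d] X by auto
    show "M \<in> add_closure R {X}" if "M \<in> {M \<in> modcat R. layers_le d M}" for M
    proof -
      obtain n where "retract R M (dsum (replicate n X))"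
        using retract_power_if_indecomposables[OF X(1,3)] \<open>M \<in> {M \<in> modcat R. layers_le d M}\<close> by blast
      then show ?thesis using that X(1) by (intro retract_imp_add_closure) auto
    qed
  qed
  show ?thesis
  proof (induction n)
    case 0
    show ?case using add by simp
  next
    case (Suc n)
    let ?V = "{M \<in> modcat R. layers_le (Suc n * d) M}"
    let ?E = "{M \<in> modcat R. \<exists>U\<in>{M \<in> modcat R. layers_le d M}. \<exists>V\<in>?V. \<exists>f g. short_exact R U f M g V}"
    have eq: "ext_layer R X (Suc (Suc n)) = add_closure R ?E"
      by (simp only: ext_layer.simps(3) bullet_def add Suc.IH)
    have E: "M \<in> modcat R \<and> layers_le (Suc (Suc n) * d) M" if "M \<in> ?E" for M
    proof -
      obtain U V :: "'a rmod" and f g where *: "fg_module R U" "layers_le d U" "fg_module R V" "layers_le (Suc n * d) V"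
        "short_exact R U f M g V" "fg_module R M"
        using \<open>M \<in> ?E\<close> unfolding modcat_def mem_Collect_eq Bex_def by blast
      have "layers_le (d + Suc n * d) M"
        using * by (intro layers_le_ext[where L = U and N = V and f = f and g = g] rmodule_homI rmodule_fg)
          (auto simp: short_exact_def)
      then show ?thesis using *(6) by (simp add: modcat_def)
    qed
    have "M \<in> add_closure R ?E" if M: "M \<in> modcat R" "layers_le (Suc (Suc n) * d) M" for M
    proof -
      have fgM: "fg_module R M" using M by (simp add: modcat_def)
      interpret M: rmodule R M by (rule rmodule_fg[OF fgM])
      \<comment> \<open>This exponent leaves at most \<open>d\<close> layers in the submodule and
        \<open>Suc n * d\<close> in the quotient, in the order in which \<open>bullet\<close> takes
        its arguments.\<close>
      let ?L = "(F ^^ (Suc n * d)) M" let ?Q = "quot_mod M (carrier ?L)"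
      have le: "layers_le d ?L" "layers_le (Suc n * d) ?Q"
        using layers_le_split[OF fgM, of d "Suc n * d"] M(2) by simp_all
      note L = funpow_submodule[OF fgM, of "Suc n * d"]
      have fg: "fg_module R ?L" "fg_module R ?Q" by (rule fg_funpow[OF fgM], rule M.fg_quot[OF fgM L])
      obtain U u u' where U: "U \<in> modcat R" "fg_module R U" "u' \<in> mod_hom R U ?L"
        "bij_betw u' (carrier U) (carrier ?L)" using modcat_copy[OF fg(1)] by metis
      obtain V v v' where V: "V \<in> modcat R" "fg_module R V" "v \<in> mod_hom R ?Q V" "v' \<in> mod_hom R V ?Q"
        "bij_betw v (carrier ?Q) (carrier V)" "bij_betw v' (carrier V) (carrier ?Q)"
        using modcat_copy[OF fg(2)] by metis
      have leUV: "layers_le d U" "layers_le (Suc n * d) V"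
        using layers_le_if_hom_inj[OF U(3) _ U(2) fg(1) le(1)] U(4)
          layers_le_if_hom_inj[OF V(4) _ V(2) fg(2) le(2)] V(6) by (simp_all add: bij_betw_def)
      interpret v: rmodule_hom R ?Q V v by (intro rmodule_homI rmodule_fg fg V)
      have u'M: "u' \<in> mod_hom R U M"
      proof -
        have "u' \<in> mod_hom R U (restrict_mod M (carrier ?L))" using U(3) funpow_restrict[OF fgM] by metis
        then show ?thesis using M.submoduleD(1)[OF L] unfolding mod_hom_def by auto
      qed
      have ker: "v (carrier ?L +>\<^bsub>M\<^esub> x) = \<zero>\<^bsub>V\<^esub> \<longleftrightarrow> x \<in> carrier ?L" if x: "x \<in> carrier M" for x
      proof -
        have "carrier ?L +>\<^bsub>M\<^esub> x \<in> carrier ?Q" using x by (simp add: quot_mod_carrier)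
        then have "v (carrier ?L +>\<^bsub>M\<^esub> x) = \<zero>\<^bsub>V\<^esub> \<longleftrightarrow> carrier ?L +>\<^bsub>M\<^esub> x = \<zero>\<^bsub>?Q\<^esub>"
          using v.inj_iff_kernel V(5) v.f_zero unfolding bij_betw_def by metis
        then show ?thesis using M.r_coset_zero_iff[OF L x] by simp
      qed
      have "short_exact R U u' M (\<lambda>x. v (carrier ?L +>\<^bsub>M\<^esub> x)) V"
        unfolding short_exact_def
      proof (intro conjI)
        show "(\<lambda>x. v (carrier ?L +>\<^bsub>M\<^esub> x)) \<in> mod_hom R M V"
          by (rule mod_hom_compose[OF M.quot_proj_hom[OF L] V(3)])
        show "u' ` carrier U = {x \<in> carrier M. v (carrier ?L +>\<^bsub>M\<^esub> x) = \<zero>\<^bsub>V\<^esub>}"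
        proof -
          have "u' ` carrier U = carrier ?L" using U(4) by (simp add: bij_betw_def)
          then show ?thesis using ker M.submoduleD(2)[OF L] by auto
        qed
        show "(\<lambda>x. v (carrier ?L +>\<^bsub>M\<^esub> x)) ` carrier M = carrier V"
          using V(5) unfolding bij_betw_def quot_mod_carrier image_image by blast
      qed (use u'M U(4) in \<open>auto simp: bij_betw_def\<close>)
      then have "M \<in> ?E" using M(1) U(1) V(1) leUV by blast
      moreover have "retract R M (dsum [M])"
        using retract_dsum_summand[OF R.ring_axioms, of "[M]" 0] M.rmodule_axioms by (simp del: dsum_simps)
      ultimately show ?thesis using M(1) by (intro retract_imp_add_closure[of M "[M]"]) auto
    qed
    then show ?case
      unfolding eq using add_closure_layers_le[OF E] by blast
  qed
qed

text \<open>The layer with index \<open>n + 1\<close> is everything exactly if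
  \<open>l \<le> (n + 1) * d\<close>, that is, if \<open>n\<close> is at least the ceiling of
  \<open>l / d\<close> minus one.\<close>

lemma orlov_spectrum_contains:
  assumes rf: "rep_finite R" and l: "layer_length R S (regular_mod R) = enat l" and d: "1 \<le> d"
  shows "enat (nat (\<lceil>real l / real d\<rceil> - 1)) \<in> OSpec R"
proof -
  obtain X where X: "X \<in> modcat R" "layers_le d X"
    "\<And>N. N \<in> modcat R \<Longrightarrow> indecomposable_mod R N \<Longrightarrow> layers_le d N \<Longrightarrow> retract R N X"
    by (rule additive_generator_exists[OF rf, of d]) blast
  have reg: "layers_le m (regular_mod R) \<longleftrightarrow> l \<le> m" for m
    using layer_length_le_iff[OF fg_regular, of m] l by simp
  \<comment> \<open>The regular module lies outside the fixed carrier type; a copy of it tests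
    whether a layer is everything.\<close>
  obtain Q e e' where Q: "Q \<in> modcat R" "fg_module R Q" "e \<in> mod_hom R (regular_mod R) Q"
    "bij_betw e (carrier (regular_mod R)) (carrier Q)"
    using modcat_copy[OF fg_regular] by metis
  have all: "modcat R = ext_layer R X (Suc n) \<longleftrightarrow> l \<le> Suc n * d" for n
  proof
    assume "modcat R = ext_layer R X (Suc n)"
    then have "layers_le (Suc n * d) Q" using ext_layer_eq[OF X] Q(1) by blast
    then have "layers_le (Suc n * d) (regular_mod R)"
      using layers_le_if_hom_inj[OF Q(3) _ fg_regular Q(2)] Q(4) unfolding bij_betw_def by blast
    then show "l \<le> Suc n * d" using reg by blast
  next
    assume "l \<le> Suc n * d"
    then have "layers_le (Suc n * d) M" if "M \<in> modcat R" for M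
      using layers_le_regular reg that unfolding modcat_def by blast
    then show "modcat R = ext_layer R X (Suc n)" using ext_layer_eq[OF X] by blast
  qed
  define m where "m = nat (\<lceil>real l / real d\<rceil> - 1)"
  \<comment> \<open>The conversion \<open>nat\<close> truncates only for \<open>l = 0\<close>, where
    both sides hold for every \<open>n\<close>.\<close>
  have m: "l \<le> Suc n * d \<longleftrightarrow> m \<le> n" for n
  proof -
    have "l \<le> Suc n * d \<longleftrightarrow> real l \<le> real (Suc n) * real d"
      by (simp only: of_nat_mult[symmetric] of_nat_le_iff)
    also have "\<dots> \<longleftrightarrow> real l / real d \<le> of_int (int n + 1)" using d by (simp add: field_simps)
    also have "\<dots> \<longleftrightarrow> \<lceil>real l / real d\<rceil> \<le> int n + 1" by (simp only: ceiling_le_iff)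
    also have "\<dots> \<longleftrightarrow> m \<le> n" unfolding m_def by linarith
    finally show ?thesis .
  qed
  have "\<exists>t. ext_layer R X t = modcat R" using all[of m] m[of m] by (intro exI[of _ "Suc m"]) auto
  moreover have "Inf {enat n | n. modcat R = ext_layer R X (n + 1)} = enat m"
    by (rule Inf_eqI) (auto simp: all m simp del: mult_Suc)
  ultimately have "generation_time R X = enat m" unfolding generation_time_def by simp
  then show ?thesis unfolding OSpec_def strong_generator_def m_def[symmetric] using X(1) by force
qed

end

theorem theorem1p1:
  fixes k :: "('k, 'c) ring_scheme" and \<phi> :: "'k \<Rightarrow> 'a" and R :: "('a, 'b) ring_scheme"
    and S :: "'a rmod set"
  assumes "artin_algebra k \<phi> R"
    and "\<forall>T\<in>S. simple_mod R T"
  shows "(\<forall>(L :: ('a, 'l) module) (M :: ('a, 'm) module) (N :: ('a, 'n) module) f g.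
           fg_module R L \<and> fg_module R M \<and> fg_module R N \<and> short_exact R L f M g N \<longrightarrow>
             max (layer_length R S L) (layer_length R S N) \<le> layer_length R S M \<and>
             layer_length R S M \<le> layer_length R S L + layer_length R S N \<and>
             (layer_length R S L = 0 \<longrightarrow> layer_length R S N = layer_length R S M) \<and>
             (layer_length R S N = 0 \<longrightarrow> layer_length R S L = layer_length R S M)) \<and>
         (rep_finite R \<longrightarrow>
           {enat (nat (\<lceil>real (the_enat (layer_length R S (regular_mod R))) / real d\<rceil> - 1)) | d :: nat.
              1 \<le> d \<and> enat d < layer_length R S (regular_mod R)} \<subseteq> OSpec R)"
proof -
  interpret artin_simples k \<phi> R S
    using assms by (simp add: artin_simples_def artin_simples_axioms_def artin_alg_def)
  show ?thesis
  proof (intro conjI impI allI)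
    fix L :: "('a, 'l) module" and M :: "('a, 'm) module" and N :: "('a, 'n) module" and f g
    assume *: "fg_module R L \<and> fg_module R M \<and> fg_module R N \<and> short_exact R L f M g N"
    then have le: "layer_length R S L \<le> layer_length R S M" "layer_length R S N \<le> layer_length R S M"
      "layer_length R S M \<le> layer_length R S L + layer_length R S N"
      using layer_length_short_exact by blast+
    show "max (layer_length R S L) (layer_length R S N) \<le> layer_length R S M" using le by simp
    show "layer_length R S M \<le> layer_length R S L + layer_length R S N" by (rule le)
    show "layer_length R S N = layer_length R S M" if "layer_length R S L = 0" using le that by simp
    show "layer_length R S L = layer_length R S M" if "layer_length R S N = 0" using le that by simp
  next
    assume rf: "rep_finite R"
    \<comment> \<open>Finiteness of the layer length of the ring ensures that
      \<open>the_enat\<close> in the claim returns its true value.\<close>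
    obtain n where "layers_le n (regular_mod R)" by (rule layer_length_finite[OF fg_regular])
    then obtain l where l: "layer_length R S (regular_mod R) = enat l"
      using layer_length_le_iff[OF fg_regular, of n] by (metis enat_ile)
    show "{enat (nat (\<lceil>real (the_enat (layer_length R S (regular_mod R))) / real d\<rceil> - 1)) | d :: nat.
              1 \<le> d \<and> enat d < layer_length R S (regular_mod R)} \<subseteq> OSpec R"
      using orlov_spectrum_contains[OF rf l] unfolding l by auto
  qed
qed

end
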